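(* Let $d\ge1$ be an integer and $\alpha>-1/2$. Let $m\in L^2_\alpha(\mathbb{R}^{d+1}_+)$ satisfy the admissibility condition $$\int_0^\infty |m(\sigma x)|^2\,\frac{d\sigma}{\sigma}=1,\qquad x\in\mathbb{R}^{d+1}_+.$$ (i) (Plancherel formula) For all $\varphi\in L^2_\alpha(\mathbb{R}^{d+1}_+)$, $$\int_{\mathbb{R}^{d+1}_+}|\varphi(x)|^2\,d\mu_\alpha(x)=\int_0^\infty \|\mathcal{T}_{w,m,\sigma}\varphi\|_{\alpha,2}^2\,\frac{d\sigma}{\sigma}.$$ (ii) (First Calderón formula) Let $\varphi\in L^1_\alpha(\mathbb{R}^{d+1}_+)$ be such that $\mathcal{F}_{W,\alpha}\varphi\in L^1_\alpha(\mathbb{R}^{d+1}_+)$. Then $$\varphi(x)=\int_0^\infty\Big(\mathcal{T}_{w,m,\sigma}\varphi *_W \mathcal{F}^{-1}_{W,\alpha}(\overline{m_\sigma})\Big)(x)\,\frac{d\sigma}{\sigma}\quad\text{for a.e. }x\in\mathbb{R}^{d+1}_+.$$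
   Context: Notation: $\mathbb{R}^{d+1}_+=\mathbb{R}^d\times(0,\infty)$; $x=(x',x_{d+1})$; $-x$ denotes $(-x',x_{d+1})$ (only the first $d$ coordinates change sign). Functions are complex-valued. $L^p_\alpha(\mathbb{R}^{d+1}_+)$ is the $L^p$ space, with norm $\|\cdot\|_{\alpha,p}$, of the measure $$d\mu_\alpha(x)=\frac{x_{d+1}^{2\alpha+1}}{(2\pi)^{d/2}2^{\alpha}\Gamma(\alpha+1)}\,dx\quad\text{on }\mathbb{R}^{d+1}_+.$$ The Weinstein kernel is $\Lambda^d_\alpha(\lambda,x)=e^{-i\langle x',\lambda'\rangle}j_\alpha(x_{d+1}\lambda_{d+1})$, where $j_\alpha(t)=\Gamma(\alpha+1)\sum_{k\ge0}\frac{(-1)^k t^{2k}}{2^{2k}k!\,\Gamma(\alpha+k+1)}$ is the normalized Bessel function. The Weinstein transform is $\mathcal{F}_{W,\alpha}(\varphi)(\lambda)=\int_{\mathbb{R}^{d+1}_+}\varphi(x)\Lambda^d_\alpha(\lambda,x)\,d\mu_\alpha(x)$ for $\varphi\in L^1_\alpha(\mathbb{R}^{d+1}_+)$. It extends uniquely from $L^1_\alpha\cap L^2_\alpha$ to an isometric isomorphism of $L^2_\alpha(\mathbb{R}^{d+1}_+)$ onto itself (Plancherel theorem), still denoted $\mathcal{F}_{W,\alpha}$. Its inverse is $\mathcal{F}^{-1}_{W,\alpha}g(\lambda)=\mathcal{F}_{W,\alpha}g(-\lambda)$; for $g\in L^1_\alpha$ this formula (i.e. $\int g(x)\Lambda^d_\alpha(-\lambda,x)d\mu_\alpha(x)$)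 is taken as the definition of $\mathcal{F}^{-1}_{W,\alpha}g$. Multiplier operators: for a measurable function $m$ on $\mathbb{R}^{d+1}_+$ and $\sigma>0$, put $m_\sigma(x)=m(\sigma x)$ and $\mathcal{T}_{w,m,\sigma}\varphi=\mathcal{F}^{-1}_{W,\alpha}\big(m_\sigma\,\mathcal{F}_{W,\alpha}(\varphi)\big)$ whenever $m_\sigma\mathcal{F}_{W,\alpha}(\varphi)$ belongs to $L^1_\alpha(\mathbb{R}^{d+1}_+)$ or $L^2_\alpha(\mathbb{R}^{d+1}_+)$. For a measurable function $g$, $\|g\|_{\alpha,2}$ is understood in $[0,\infty]$. Translation: for $\varphi$ continuous and even in the last variable and $x,y\in\mathbb{R}^{d+1}_+$, $$\tau^\alpha_x\varphi(y)=\frac{\Gamma(\alpha+1)}{\sqrt\pi\,\Gamma(\alpha+1/2)}\int_0^\pi\varphi\Big(x'+y',\sqrt{x_{d+1}^2+y_{d+1}^2+2x_{d+1}y_{d+1}\cos\theta}\Big)(\sin\theta)^{2\alpha}\,d\theta;$$ it extends to a contraction of $L^p_\alpha(\mathbb{R}^{d+1}_+)$, in particular of $L^2_\alpha$. Convolution: $(\varphi*_W\psi)(x)=\int_{\mathbb{R}^{d+1}_+}\tau^\alpha_x\varphi(-y)\,\psi(y)\,d\mu_\alpha(y)$, defined in particular for every $x$ when $\varphi,\psi\in L^2_\alpha$. *)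

theory Defs
  imports "HOL-Analysis.Analysis"
begin

type_synonym 'd space = "(real ^ 'd) \<times> real"

definition half_space :: "('d::finite) space set" where
  "half_space = {x. 0 < snd x}"

definition reflect :: "('d::finite) space \<Rightarrow> 'd space" where
  "reflect x = (- fst x, snd x)"

definition weinstein_measure :: "real \<Rightarrow> ('d::finite) space measure" where
  "weinstein_measure \<alpha> =
     density (restrict_space lborel half_space)
       (\<lambda>x. ennreal (snd x powr (2 * \<alpha> + 1) /
          ((2 * pi) powr (real CARD('d) / 2) * 2 powr \<alpha> * Gamma (\<alpha> + 1))))"

text \<open>The measure \<open>d\<sigma>/\<sigma>\<close> on \<open>(0,\<infinity>)\<close>.\<close>

definition dilation_measure :: "real measure" where
  "dilation_measure = density (restrict_space lborel {0<..}) (\<lambda>\<sigma>. ennreal (1 / \<sigma>))"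

text \<open>The square of the \<open>L\<^sup>2\<close> norm, with values in \<open>[0,\<infinity>]\<close>.\<close>

definition L2_norm_sq :: "'a measure \<Rightarrow> ('a \<Rightarrow> complex) \<Rightarrow> ennreal" where
  "L2_norm_sq M f = (\<integral>\<^sup>+ x. ennreal ((cmod (f x))\<^sup>2) \<partial>M)"

definition L2 :: "'a measure \<Rightarrow> ('a \<Rightarrow> complex) set" where
  "L2 M = {f \<in> borel_measurable M. L2_norm_sq M f < \<infinity>}"

text \<open>
  Extension by continuity to \<open>L\<^sup>2\<close> of an operator \<open>T\<close> given on a set \<open>D\<close> of functions that is
  dense in \<open>L\<^sup>2\<close>: the value at \<open>f\<close> is the \<open>L\<^sup>2\<close> limit of \<open>T (u n)\<close> for \<open>u n \<in> D\<close> converging to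
  \<open>f\<close> in \<open>L\<^sup>2\<close>.  If \<open>T\<close> is linear and bounded on \<open>D\<close>, the limit exists and is unique
  up to a null set; the choice operator only selects a representative.
\<close>

definition L2_extension ::
    "'a measure \<Rightarrow> ('a \<Rightarrow> complex) set \<Rightarrow> (('a \<Rightarrow> complex) \<Rightarrow> 'a \<Rightarrow> complex)
      \<Rightarrow> ('a \<Rightarrow> complex) \<Rightarrow> 'a \<Rightarrow> complex" where
  "L2_extension M D T f =
     (SOME g. g \<in> L2 M \<and>
        (\<exists>u. (\<forall>n. u n \<in> D \<inter> L2 M) \<and>
             (\<lambda>n. L2_norm_sq M (\<lambda>x. u n x - f x)) \<longlonglongrightarrow> 0 \<and>
             (\<lambda>n. L2_norm_sq M (\<lambda>x. T (u n) x - g x)) \<longlonglongrightarrow> 0))"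

definition norm_bessel :: "real \<Rightarrow> real \<Rightarrow> real" where
  "norm_bessel \<alpha> t =
     Gamma (\<alpha> + 1) *
       (\<Sum>k. (-1) ^ k * t ^ (2 * k) / (2 ^ (2 * k) * fact k * Gamma (\<alpha> + real k + 1)))"

definition weinstein_kernel ::
    "real \<Rightarrow> ('d::finite) space \<Rightarrow> 'd space \<Rightarrow> complex" where
  "weinstein_kernel \<alpha> l x =
     exp (- \<i> * complex_of_real (fst x \<bullet> fst l)) *
       complex_of_real (norm_bessel \<alpha> (snd x * snd l))"

definition weinstein_integral ::
    "real \<Rightarrow> (('d::finite) space \<Rightarrow> complex) \<Rightarrow> 'd space \<Rightarrow> complex" where
  "weinstein_integral \<alpha> f l =
     (LINT x|weinstein_measure \<alpha>. f x * weinstein_kernel \<alpha> l x)"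

text \<open>
  The Weinstein transform on \<open>L\<^sup>1 \<union> L\<^sup>2\<close>: the defining integral on \<open>L\<^sup>1\<close>, and otherwise
  the continuous extension from \<open>L\<^sup>1 \<inter> L\<^sup>2\<close>.
\<close>

definition weinstein ::
    "real \<Rightarrow> (('d::finite) space \<Rightarrow> complex) \<Rightarrow> 'd space \<Rightarrow> complex" where
  "weinstein \<alpha> f =
     (if integrable (weinstein_measure \<alpha>) f then weinstein_integral \<alpha> f
      else L2_extension (weinstein_measure \<alpha>)
             {u. integrable (weinstein_measure \<alpha>) u} (weinstein_integral \<alpha>) f)"

definition weinstein_inv ::
    "real \<Rightarrow> (('d::finite) space \<Rightarrow> complex) \<Rightarrow> 'd space \<Rightarrow> complex" where
  "weinstein_inv \<alpha> g l = weinstein \<alpha> g (reflect l)"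

definition dilate ::
    "real \<Rightarrow> (('d::finite) space \<Rightarrow> complex) \<Rightarrow> 'd space \<Rightarrow> complex" where
  "dilate \<sigma> m x = m (\<sigma> *\<^sub>R x)"

definition multiplier_op ::
    "real \<Rightarrow> (('d::finite) space \<Rightarrow> complex) \<Rightarrow> real \<Rightarrow> ('d space \<Rightarrow> complex)
      \<Rightarrow> 'd space \<Rightarrow> complex" where
  "multiplier_op \<alpha> m \<sigma> f = weinstein_inv \<alpha> (\<lambda>x. dilate \<sigma> m x * weinstein \<alpha> f x)"

definition cont_even :: "(('d::finite) space \<Rightarrow> complex) set" where
  "cont_even = {f. continuous_on UNIV f \<and> (\<forall>x' t. f (x', - t) = f (x', t))}"

definition translation_integral ::
    "real \<Rightarrow> ('d::finite) space \<Rightarrow> ('d space \<Rightarrow> complex) \<Rightarrow> 'd space \<Rightarrow> complex" where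
  "translation_integral \<alpha> x f y =
     complex_of_real (Gamma (\<alpha> + 1) / (sqrt pi * Gamma (\<alpha> + 1 / 2))) *
       (LINT \<theta>:{0..pi}|lborel.
          f (fst x + fst y,
             sqrt ((snd x)\<^sup>2 + (snd y)\<^sup>2 + 2 * snd x * snd y * cos \<theta>)) *
          complex_of_real (sin \<theta> powr (2 * \<alpha>)))"

text \<open>
  The translation: the defining integral for continuous functions even in the last variable,
  and otherwise the continuous extension to \<open>L\<^sup>2\<close>.
\<close>

definition translation ::
    "real \<Rightarrow> ('d::finite) space \<Rightarrow> ('d space \<Rightarrow> complex) \<Rightarrow> 'd space \<Rightarrow> complex" where
  "translation \<alpha> x f =
     (if f \<in> cont_even then translation_integral \<alpha> x f
      else L2_extension (weinstein_measure \<alpha>) cont_even (translation_integral \<alpha> x) f)"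

definition weinstein_conv ::
    "real \<Rightarrow> (('d::finite) space \<Rightarrow> complex) \<Rightarrow> ('d space \<Rightarrow> complex)
      \<Rightarrow> 'd space \<Rightarrow> complex" where
  "weinstein_conv \<alpha> f g x =
     (LINT y|weinstein_measure \<alpha>. translation \<alpha> x f (reflect y) * g y)"

end

theory Submission
  imports Defs "HOL-Probability.Characteristic_Functions"
begin

text \<open>
  The Plancherel theorem for the Weinstein transform is obtained by Gaussian regularization: the
  Gauss--Weierstrass kernel \<open>\<integral> exp (-\<epsilon>|\<lambda>|\<^sup>2/2) \<Lambda>(\<lambda>,x) \<Lambda>(-\<lambda>,y) d\<mu>(\<lambda>)\<close> is explicit and positive (by the
  product formula for Bessel functions, which follows from the Chu--Vandermonde identity), has total
  mass \<open>1\<close> and concentrates on the diagonal, so it is an approximate identity in \<open>L\<^sup>1\<close>. This gives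
  inversion, and the equality of the norms of \<open>h\<close> and of its transform in \<open>[0,\<infinity>]\<close> for every
  \<open>h \<in> L\<^sup>1\<close>. The last point matters: \<open>m\<^sub>\<sigma> \<F>\<phi>\<close> is always in \<open>L\<^sup>1\<close> by the Cauchy--Schwarz inequality,
  but possibly not in \<open>L\<^sup>2\<close>, and part (i) is then Tonelli's theorem. For part (ii), the product
  formula turns the translate of \<open>T\<^sub>\<sigma>\<phi>\<close> into a transform; Parseval's identity identifies the convolution
  at \<open>x\<close> with \<open>\<integral> |m\<^sub>\<sigma>|\<^sup>2 \<F>\<phi>(\<lambda>) \<Lambda>(-\<lambda>,x) d\<mu>(\<lambda>)\<close>, and Fubini's theorem, the admissibility condition
  and inversion conclude.
\<close>

section \<open>The Poisson integral and the product formula for the normalized Bessel function\<close>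

text \<open>Outside L1 and outside \<open>cont_even\<close>, the transform and the translation are
  representatives picked by \<open>L2_extension\<close>, of which only the L2 class is known,
  whereas a convolution is evaluated at single points. The difficulty is avoided because the product
  of \<open>dilate \<sigma> m\<close> and \<open>weinstein \<alpha> \<phi>\<close> is a product of
  two L2 functions: \<open>multiplier_op\<close> is then a genuine integral, its value is continuous
  and even in the last variable, and \<open>translation\<close> takes its integral branch. In (ii)
  the transform of the conjugate of \<open>dilate \<sigma> m\<close> may still be a picked
  representative, but it only enters under an integral against an L2 function. The harmonic analysis
  is carried out for an abstract bounded symmetric kernel in \<open>kernel_transform\<close>.
  Positivity, symmetry and unit mass make smoothing an L1 contraction, which carries convergence
  from indicators of open sets to all of L1. For the half space the smoothing kernel splits into a
  Euclidean and a one-dimensional Bessel factor whose integrals against Gaussians are explicit, so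
  concentration is read off from limits of elementary functions.\<close>

definition bessel_coeff :: "real \<Rightarrow> nat \<Rightarrow> real" where
  "bessel_coeff \<alpha> k = (- 1) ^ k / (4 ^ k * fact k * pochhammer (\<alpha> + 1) k)"

text \<open>The normalized Bessel function as a series in the square of its argument. Negative
  values of w are then meaningful and give the modified Bessel function that appears in the heat
  kernel.\<close>

definition bessel_series :: "real \<Rightarrow> real \<Rightarrow> real" where
  "bessel_series \<alpha> w = (\<Sum>k. bessel_coeff \<alpha> k * w ^ k)"

text \<open>The weight of the translation, with the same constant; this constant makes it a
  probability density.\<close>

definition gegenbauer_density :: "real \<Rightarrow> real \<Rightarrow> real" where
  "gegenbauer_density \<alpha> \<theta> = indicator {0..pi} \<theta> *
     (Gamma (\<alpha> + 1) / (sqrt pi * Gamma (\<alpha> + 1 / 2)) * sin \<theta> powr (2 * \<alpha>))"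

definition gegenbauer_measure :: "real \<Rightarrow> real measure" where
  "gegenbauer_measure \<alpha> = density lborel (\<lambda>\<theta>. ennreal (gegenbauer_density \<alpha> \<theta>))"

section \<open>Convergence and continuity of the Bessel series\<close>

lemma pochhammer_ge_half_power:
  fixes \<alpha> :: real
  assumes "\<alpha> > - 1 / 2"
  shows "(1 / 2) ^ k \<le> pochhammer (\<alpha> + 1) k"
proof (induction k)
  case (Suc k)
  have "(1 / 2) * (1 / 2) ^ k \<le> (\<alpha> + 1 + real k) * pochhammer (\<alpha> + 1) k"
    using Suc assms by (intro mult_mono) auto
  then show ?case
    by (simp add: pochhammer_Suc algebra_simps)
qed simp

lemma pochhammer_alpha_pos:
  fixes \<alpha> :: real
  assumes "\<alpha> > - 1 / 2"
  shows "pochhammer (\<alpha> + 1) k > 0"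
  using assms by (intro pochhammer_pos) auto

lemma abs_bessel_coeff:
  assumes "\<alpha> > - 1 / 2"
  shows "\<bar>bessel_coeff \<alpha> k\<bar> = 1 / (4 ^ k * fact k * pochhammer (\<alpha> + 1) k)"
  using pochhammer_alpha_pos[OF assms, of k] by (simp add: bessel_coeff_def abs_mult)

text \<open>Every factor of \<open>pochhammer (\<alpha> + 1) k\<close> exceeds 1/2, and this crude
  bound already dominates the series by that of \<open>exp (\<bar>w\<bar> / 2)\<close>.\<close>

lemma abs_bessel_coeff_le:
  assumes "\<alpha> > - 1 / 2"
  shows "\<bar>bessel_coeff \<alpha> k\<bar> \<le> (1 / 2) ^ k / fact k"
proof -
  have "\<bar>bessel_coeff \<alpha> k\<bar> = 1 / (4 ^ k * fact k * pochhammer (\<alpha> + 1) k)"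
    by (rule abs_bessel_coeff[OF assms])
  also have "\<dots> \<le> 1 / (4 ^ k * fact k * (1 / 2) ^ k)"
    using pochhammer_ge_half_power[OF assms, of k] pochhammer_alpha_pos[OF assms, of k]
    by (intro divide_left_mono mult_left_mono mult_pos_pos) auto
  also have "\<dots> = (1 / 2) ^ k / fact k"
    using power_mult_distrib[of "4 :: real" "1 / 2" k] by (simp add: power_one_over mult.commute mult.left_commute)
  finally show ?thesis .
qed

lemma summable_abs_bessel_series:
  assumes "\<alpha> > - 1 / 2"
  shows "summable (\<lambda>k. \<bar>bessel_coeff \<alpha> k\<bar> * \<bar>w\<bar> ^ k)"
proof (rule summable_comparison_test')
  show "summable (\<lambda>k. (\<bar>w\<bar> / 2) ^ k / fact k)"
    using summable_exp[of "\<bar>w\<bar> / 2"] by (simp add: field_simps)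
  fix k
  have "\<bar>bessel_coeff \<alpha> k\<bar> * \<bar>w\<bar> ^ k \<le> (1 / 2) ^ k / fact k * \<bar>w\<bar> ^ k"
    using abs_bessel_coeff_le[OF assms, of k] by (intro mult_right_mono) auto
  then show "norm (\<bar>bessel_coeff \<alpha> k\<bar> * \<bar>w\<bar> ^ k) \<le> (\<bar>w\<bar> / 2) ^ k / fact k"
    by (simp add: power_divide)
qed

lemma summable_bessel_series:
  assumes "\<alpha> > - 1 / 2"
  shows "summable (\<lambda>k. bessel_coeff \<alpha> k * w ^ k)"
proof (rule summable_rabs_cancel)
  show "summable (\<lambda>k. \<bar>bessel_coeff \<alpha> k * w ^ k\<bar>)"
    using summable_abs_bessel_series[OF assms, of w] by (simp add: abs_mult power_abs)
qed

lemma continuous_bessel_series: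
  assumes "\<alpha> > - 1 / 2"
  shows "continuous_on UNIV (bessel_series \<alpha>)"
  unfolding continuous_on_eq_continuous_at[OF open_UNIV]
proof
  fix w
  show "isCont (bessel_series \<alpha>) w"
    unfolding bessel_series_def[abs_def]
    by (rule isCont_powser[where K = "\<bar>w\<bar> + 1", OF summable_bessel_series[OF assms]]) auto
qed

lemma norm_bessel_eq:
  assumes "\<alpha> > - 1 / 2"
  shows "norm_bessel \<alpha> t = bessel_series \<alpha> (t\<^sup>2)"
proof -
  have nn: "\<alpha> + 1 \<notin> \<int>\<^sub>\<le>\<^sub>0"
    using assms by (auto dest: nonpos_Ints_nonpos)
  have G: "Gamma (\<alpha> + 1) > 0"
    using assms by (intro Gamma_real_pos) auto
  have eq: "(- 1) ^ k * t ^ (2 * k) / (2 ^ (2 * k) * fact k * Gamma (\<alpha> + real k + 1)) =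
      bessel_coeff \<alpha> k * (t\<^sup>2) ^ k / Gamma (\<alpha> + 1)" for k
    using G pochhammer_Gamma[OF nn, of k] by (simp add: bessel_coeff_def power_mult add.assoc add.commute[of 1 "real k"])
  show ?thesis
    unfolding norm_bessel_def eq bessel_series_def
    using G by (subst suminf_divide[OF summable_bessel_series[OF assms]]) auto
qed

section \<open>Moments of the Gegenbauer weight\<close>

lemma nn_integral_Beta:
  fixes a b :: real
  assumes "a > 0" "b > 0"
  shows "(\<integral>\<^sup>+ t. ennreal (t powr (a - 1) * (1 - t) powr (b - 1) * indicator {0..1} t) \<partial>lborel) = Beta a b"
  using nn_integral_has_integral_lebesgue[OF _ has_integral_Beta_real[OF assms]]
  by (simp add: mult_ac)

lemma gegenbauer_density_nonneg: "\<alpha> > - 1 / 2 \<Longrightarrow> gegenbauer_density \<alpha> \<theta> \<ge> 0"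
  by (auto simp: gegenbauer_density_def indicator_def intro!: mult_nonneg_nonneg divide_nonneg_nonneg)

lemma gegenbauer_density_reflect: "gegenbauer_density \<alpha> (pi - \<theta>) = gegenbauer_density \<alpha> \<theta>"
  by (auto simp: gegenbauer_density_def indicator_def sin_pi_minus)

lemma measurable_gegenbauer_density [measurable]: "gegenbauer_density \<alpha> \<in> borel_measurable borel"
  unfolding gegenbauer_density_def[abs_def] by measurable

lemma sets_gegenbauer_measure [measurable_cong, simp]: "sets (gegenbauer_measure \<alpha>) = sets borel"
  by (simp add: gegenbauer_measure_def)

lemma space_gegenbauer_measure [simp]: "space (gegenbauer_measure \<alpha>) = UNIV"
  by (simp add: gegenbauer_measure_def)

text \<open>The extra factor s comes from the derivative of a quadratic substitution (sin squared,
  cos squared or t squared).\<close>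

lemma square_powr_mult:
  fixes s :: real assumes "s > 0" shows "(s\<^sup>2) powr (b - 1 / 2) * s = s powr (2 * b)"
proof -
  have "(s\<^sup>2) powr (b - 1 / 2) * s = s powr (2 * (b - 1 / 2)) * s powr 1"
    using powr_powr[of s 2 "b - 1 / 2"] assms by simp
  also have "\<dots> = s powr (2 * b)"
    by (subst powr_add[symmetric]) simp
  finally show ?thesis .
qed

text \<open>Solves for an integral in \<open>[0,\<infinity>]\<close> whose finiteness is itself a
  consequence of the equation.\<close>

lemma ennreal_mult_eq_imp_eq:
  assumes eq: "ennreal b = ennreal c * x" and "c > 0" "b \<ge> 0"
  shows "x = ennreal (b / c)"
proof (cases x rule: ennreal_cases)
  case (real r)
  with eq \<open>c > 0\<close> have "ennreal b = ennreal (c * r)"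
    by (simp add: ennreal_mult)
  then have "b = c * r"
    using real assms(2,3) by (subst (asm) ennreal_inj) auto
  then show ?thesis
    using real \<open>c > 0\<close> by simp
next
  case top
  with eq \<open>c > 0\<close> show ?thesis by (simp add: ennreal_mult_top)
qed

lemma sin_cos_integrand:
  assumes "0 < \<theta>" "\<theta> < pi / 2" 
  shows "((sin \<theta>)\<^sup>2 powr (\<alpha> - 1 / 2) * (1 - (sin \<theta>)\<^sup>2) powr (real l - 1 / 2)) * (2 * sin \<theta> * cos \<theta>)
    = 2 * (sin \<theta> powr (2 * \<alpha>) * cos \<theta> ^ (2 * l))"
proof -
  have s: "sin \<theta> > 0" and c: "cos \<theta> > 0"
    using assms by (auto intro!: sin_gt_zero cos_gt_zero)
  have "1 - (sin \<theta>)\<^sup>2 = (cos \<theta>)\<^sup>2"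
    by (simp add: cos_squared_eq)
  then have "((sin \<theta>)\<^sup>2 powr (\<alpha> - 1 / 2) * (1 - (sin \<theta>)\<^sup>2) powr (real l - 1 / 2)) * (2 * sin \<theta> * cos \<theta>) =
     2 * (((sin \<theta>)\<^sup>2 powr (\<alpha> - 1 / 2) * sin \<theta>) * ((cos \<theta>)\<^sup>2 powr (real l - 1 / 2) * cos \<theta>))"
    by simp
  also have "\<dots> = 2 * (sin \<theta> powr (2 * \<alpha>) * cos \<theta> powr (2 * real l))"
    unfolding square_powr_mult[OF s] square_powr_mult[OF c] ..
  also have "cos \<theta> powr (2 * real l) = cos \<theta> ^ (2 * l)"
    using powr_realpow[OF c, of "2 * l"] by simp
  finally show ?thesis .
qed
text \<open>The substitution t = sin^2 \<theta> in the Beta integral. It is increasing only up to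
  \<open>pi / 2\<close>, hence the half range.\<close>

lemma nn_integral_sin_cos_half:
  assumes "\<alpha> > - 1 / 2"
  shows "(\<integral>\<^sup>+ \<theta>. ennreal (sin \<theta> powr (2 * \<alpha>) * cos \<theta> ^ (2 * l)) * indicator {0..pi / 2} \<theta> \<partial>lborel)
    = ennreal (Beta (\<alpha> + 1 / 2) (real l + 1 / 2) / 2)"
proof -
  let ?f = "\<lambda>t. t powr (\<alpha> - 1 / 2) * (1 - t) powr (real l - 1 / 2)"
  let ?B = "Beta (\<alpha> + 1 / 2) (real l + 1 / 2)"
  have B: "?B > 0"
    using assms by (auto simp: Beta_def intro!: divide_pos_pos mult_pos_pos Gamma_real_pos)
  have "ennreal (Beta (\<alpha> + 1 / 2) (real l + 1 / 2)) = (\<integral>\<^sup>+ t. ennreal (?f t * indicator {0..1} t) \<partial>lborel)"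
    using nn_integral_Beta[of "\<alpha> + 1 / 2" "real l + 1 / 2"] assms by (simp add: algebra_simps)
  also have "\<dots> = (\<integral>\<^sup>+ t. ennreal (?f t * indicator {(sin 0)\<^sup>2..(sin (pi / 2))\<^sup>2} t) \<partial>lborel)"
    by simp
  also have "\<dots> = (\<integral>\<^sup>+ \<theta>. ennreal (?f ((sin \<theta>)\<^sup>2) * (2 * sin \<theta> * cos \<theta>) * indicator {0..pi / 2} \<theta>) \<partial>lborel)"
  proof (rule nn_integral_substitution)
    show "set_borel_measurable borel {(sin 0)\<^sup>2..(sin (pi / 2))\<^sup>2} ?f"
      unfolding set_borel_measurable_def by measurable
    show "((\<lambda>\<theta>. (sin \<theta>)\<^sup>2) has_real_derivative 2 * sin x * cos x) (at x)" for x
      by (auto intro!: derivative_eq_intros)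
    show "continuous_on {0..pi / 2} (\<lambda>x. 2 * sin x * cos x)"
      by (intro continuous_intros)
    show "0 \<le> 2 * sin x * cos x" if "x \<in> {0..pi / 2}" for x
      using that by (auto intro!: mult_nonneg_nonneg sin_ge_zero cos_ge_zero)
  qed simp
  also have "\<dots> = (\<integral>\<^sup>+ \<theta>. 2 * (ennreal (sin \<theta> powr (2 * \<alpha>) * cos \<theta> ^ (2 * l)) * indicator {0..pi / 2} \<theta>) \<partial>lborel)"
  proof (rule nn_integral_cong_AE)
    \<comment> \<open>The endpoints have to be left out: at \<open>pi / 2\<close> with
      \<open>l = 0\<close> the left side vanishes with the derivative of sin^2, while
      \<open>cos \<theta> ^ 0\<close> is 1.\<close>
    have "AE \<theta> in lborel. \<theta> \<noteq> 0 \<and> \<theta> \<noteq> pi / 2"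
      using AE_lborel_singleton[of "0 :: real"] AE_lborel_singleton[of "pi / 2"] by eventually_elim auto
    then show "AE \<theta> in lborel. ennreal (?f ((sin \<theta>)\<^sup>2) * (2 * sin \<theta> * cos \<theta>) * indicator {0..pi / 2} \<theta>) =
      2 * (ennreal (sin \<theta> powr (2 * \<alpha>) * cos \<theta> ^ (2 * l)) * indicator {0..pi / 2} \<theta>)"
    proof eventually_elim
      case (elim \<theta>)
      show ?case
      proof (cases "\<theta> \<in> {0..pi / 2}")
        case True
        with elim have "0 < \<theta>" "\<theta> < pi / 2" by auto
        note eq = sin_cos_integrand[OF this, of \<alpha> l]
        show ?thesis
          unfolding indicator_simps(1)[OF True] eq mult_1_right by (simp only: ennreal_mult' ennreal_numeral zero_le_numeral)
      next
        case False
        show ?thesis unfolding indicator_simps(2)[OF False] by simp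
      qed
    qed
  qed
  also have "\<dots> = 2 * (\<integral>\<^sup>+ \<theta>. ennreal (sin \<theta> powr (2 * \<alpha>) * cos \<theta> ^ (2 * l)) * indicator {0..pi / 2} \<theta> \<partial>lborel)"
    by (rule nn_integral_cmult) measurable
  finally have *: "ennreal (Beta (\<alpha> + 1 / 2) (real l + 1 / 2)) =
    2 * (\<integral>\<^sup>+ \<theta>. ennreal (sin \<theta> powr (2 * \<alpha>) * cos \<theta> ^ (2 * l)) * indicator {0..pi / 2} \<theta> \<partial>lborel)" .
  show ?thesis
    using ennreal_mult_eq_imp_eq[of ?B 2] * B by simp
qed

text \<open>The reflection of \<theta> to \<open>pi - \<theta>\<close> doubles the half-range Beta
  integral, and Gamma(1/2) cancels the root of pi in the constant. The case \<open>l = 0\<close> is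
  the total mass 1.\<close>

lemma nn_integral_gegenbauer_cos_power:
  assumes "\<alpha> > - 1 / 2"
  shows "(\<integral>\<^sup>+ \<theta>. ennreal (cos \<theta> ^ (2 * l)) \<partial>gegenbauer_measure \<alpha>) =
    ennreal (pochhammer (1 / 2) l / pochhammer (\<alpha> + 1) l)"
proof -
  let ?C = "Gamma (\<alpha> + 1) / (sqrt pi * Gamma (\<alpha> + 1 / 2))"
  let ?h = "\<lambda>\<theta>. ennreal (sin \<theta> powr (2 * \<alpha>) * cos \<theta> ^ (2 * l))"
  let ?B = "Beta (\<alpha> + 1 / 2) (real l + 1 / 2)"
  have G: "Gamma (\<alpha> + 1) > 0" "Gamma (\<alpha> + 1 / 2) > 0"
    using assms by (auto intro!: Gamma_real_pos)
  have C: "?C > 0" using G by simp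
  have B: "?B > 0"
    using assms by (auto simp: Beta_def intro!: divide_pos_pos mult_pos_pos Gamma_real_pos)
  have "(\<integral>\<^sup>+ \<theta>. ennreal (cos \<theta> ^ (2 * l)) \<partial>gegenbauer_measure \<alpha>) =
    (\<integral>\<^sup>+ \<theta>. ennreal (gegenbauer_density \<alpha> \<theta>) * ennreal (cos \<theta> ^ (2 * l)) \<partial>lborel)"
    unfolding gegenbauer_measure_def by (rule nn_integral_density) measurable
  also have "\<dots> = (\<integral>\<^sup>+ \<theta>. ennreal ?C * (?h \<theta> * indicator {0..pi} \<theta>) \<partial>lborel)"
  proof (intro nn_integral_cong)
    fix \<theta>
    show "ennreal (gegenbauer_density \<alpha> \<theta>) * ennreal (cos \<theta> ^ (2 * l)) = ennreal ?C * (?h \<theta> * indicator {0..pi} \<theta>)"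
    proof (cases "\<theta> \<in> {0..pi}")
      case True
      show ?thesis
        using C unfolding gegenbauer_density_def indicator_simps(1)[OF True]
        by (simp only: mult_1_left mult_1_right mult.assoc ennreal_mult''[symmetric] ennreal_mult'[symmetric]
            zero_le_even_power' less_imp_le)
    next
      case False
      show ?thesis unfolding gegenbauer_density_def indicator_simps(2)[OF False] by simp
    qed
  qed
  also have "\<dots> = ennreal ?C * (\<integral>\<^sup>+ \<theta>. ?h \<theta> * indicator {0..pi} \<theta> \<partial>lborel)"
    by (rule nn_integral_cmult) measurable
  also have "(\<integral>\<^sup>+ \<theta>. ?h \<theta> * indicator {0..pi} \<theta> \<partial>lborel) =
     (\<integral>\<^sup>+ \<theta>. ?h \<theta> * indicator {0..pi / 2} \<theta> + ?h \<theta> * indicator {pi / 2..pi} \<theta> \<partial>lborel)"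
  proof (rule nn_integral_cong_AE)
    show "AE \<theta> in lborel. ?h \<theta> * indicator {0..pi} \<theta> =
        ?h \<theta> * indicator {0..pi / 2} \<theta> + ?h \<theta> * indicator {pi / 2..pi} \<theta>"
      using AE_lborel_singleton[of "pi / 2"]
    proof eventually_elim
      case (elim \<theta>)
      have "pi / 2 \<le> pi" by simp
      with elim show ?case by (auto simp: indicator_def)
    qed
  qed
  also have "\<dots> = (\<integral>\<^sup>+ \<theta>. ?h \<theta> * indicator {0..pi / 2} \<theta> \<partial>lborel) + (\<integral>\<^sup>+ \<theta>. ?h \<theta> * indicator {pi / 2..pi} \<theta> \<partial>lborel)"
    by (rule nn_integral_add) measurable
  also have "(\<integral>\<^sup>+ \<theta>. ?h \<theta> * indicator {pi / 2..pi} \<theta> \<partial>lborel) =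
    (\<integral>\<^sup>+ \<theta>. ?h \<theta> * indicator {0..pi / 2} \<theta> \<partial>lborel)"
  proof (subst nn_integral_real_affine[where t = pi and c = "-1"])
    have "?h (pi + - 1 * \<theta>) * indicator {pi / 2..pi} (pi + - 1 * \<theta>) = ?h \<theta> * indicator {0..pi / 2} \<theta>" for \<theta>
      by (auto simp: indicator_def)
    then show "ennreal \<bar>- 1\<bar> * (\<integral>\<^sup>+ x. ?h (pi + - 1 * x) * indicator {pi / 2..pi} (pi + - 1 * x) \<partial>lborel) =
      (\<integral>\<^sup>+ \<theta>. ?h \<theta> * indicator {0..pi / 2} \<theta> \<partial>lborel)"
      by simp
  qed measurable
  also have "ennreal ?C * ((\<integral>\<^sup>+ \<theta>. ?h \<theta> * indicator {0..pi / 2} \<theta> \<partial>lborel) +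
     (\<integral>\<^sup>+ \<theta>. ?h \<theta> * indicator {0..pi / 2} \<theta> \<partial>lborel)) = ennreal (?C * ?B)"
    unfolding nn_integral_sin_cos_half[OF assms] using C B
    by (simp flip: ennreal_plus ennreal_mult')
  also have "?C * ?B = pochhammer (1 / 2) l / pochhammer (\<alpha> + 1) l"
  proof -
    have 1: "pochhammer (1 / 2) l = Gamma (1 / 2 + real l) / Gamma (1 / 2)"
      by (rule pochhammer_Gamma) (auto dest: nonpos_Ints_nonpos)
    have 2: "pochhammer (\<alpha> + 1) l = Gamma (\<alpha> + 1 + real l) / Gamma (\<alpha> + 1)"
      by (rule pochhammer_Gamma) (use assms in \<open>auto dest: nonpos_Ints_nonpos\<close>)
    have e: "\<alpha> + 1 / 2 + (real l + 1 / 2) = \<alpha> + 1 + real l" "1 / 2 + real l = real l + 1 / 2"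
      by simp_all
    have aux: "a / (s * b) * (b * c / d) = c / s / (d / a)" if "b > 0" for a b c d s :: real
      using that by simp
    show ?thesis
      unfolding 1 2 Beta_def Gamma_one_half_real e by (rule aux[OF G(2)])
  qed
  finally show ?thesis .
qed

lemma prob_space_gegenbauer_measure:
  assumes "\<alpha> > - 1 / 2"
  shows "prob_space (gegenbauer_measure \<alpha>)"
  using nn_integral_gegenbauer_cos_power[OF assms, of 0] by (intro prob_spaceI) simp

lemma integral_gegenbauer_measure:
  fixes f :: "real \<Rightarrow> 'b :: {banach, second_countable_topology}"
  assumes "\<alpha> > - 1 / 2" "f \<in> borel_measurable borel"
  shows "integral\<^sup>L (gegenbauer_measure \<alpha>) f = (LINT \<theta>|lborel. gegenbauer_density \<alpha> \<theta> *\<^sub>R f \<theta>)"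
  unfolding gegenbauer_measure_def using assms gegenbauer_density_nonneg[of \<alpha>]
  by (subst integral_density) auto

text \<open>The reflection of \<theta> to \<open>pi - \<theta>\<close> preserves the density and
  reverses the sign of cos.\<close>

lemma integral_gegenbauer_cos_odd_power:
  assumes "\<alpha> > - 1 / 2" "odd n"
  shows "(LINT \<theta>|gegenbauer_measure \<alpha>. cos \<theta> ^ n) = 0"
proof -
  have "(LINT \<theta>|gegenbauer_measure \<alpha>. cos \<theta> ^ n) = (LINT \<theta>|lborel. gegenbauer_density \<alpha> \<theta> * cos \<theta> ^ n)"
    by (subst integral_gegenbauer_measure[OF assms(1)]) auto
  also have "\<dots> = (LINT \<theta>|lborel. gegenbauer_density \<alpha> (pi - \<theta>) * cos (pi - \<theta>) ^ n)"
    by (subst lborel_integral_real_affine[where t = pi and c = "-1"]) auto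
  also have "\<dots> = (LINT \<theta>|lborel. - (gegenbauer_density \<alpha> \<theta> * cos \<theta> ^ n))"
    using assms(2) by (simp add: gegenbauer_density_reflect cos_pi_minus)
  also have "\<dots> = - (LINT \<theta>|gegenbauer_measure \<alpha>. cos \<theta> ^ n)"
    by (subst integral_gegenbauer_measure[OF assms(1)]) auto
  finally show ?thesis by simp
qed

lemma integral_gegenbauer_cos_even_power:
  assumes "\<alpha> > - 1 / 2"
  shows "(LINT \<theta>|gegenbauer_measure \<alpha>. cos \<theta> ^ (2 * l)) = fact (2 * l) / (4 ^ l * fact l * pochhammer (\<alpha> + 1) l)"
proof -
  have "(LINT \<theta>|gegenbauer_measure \<alpha>. cos \<theta> ^ (2 * l)) =
     enn2real (\<integral>\<^sup>+ \<theta>. ennreal (cos \<theta> ^ (2 * l)) \<partial>gegenbauer_measure \<alpha>)"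
    by (rule integral_eq_nn_integral) auto
  also have "\<dots> = pochhammer (1 / 2) l / pochhammer (\<alpha> + 1) l"
    unfolding nn_integral_gegenbauer_cos_power[OF assms]
    using pochhammer_alpha_pos[OF assms, of l] pochhammer_pos[of "1 / 2 :: real" l]
    by (intro enn2real_ennreal divide_nonneg_pos) auto
  also have "pochhammer (1 / 2 :: real) l = fact (2 * l) / (4 ^ l * fact l)"
    using fact_double[of l, where 'a = real] by (simp add: power_mult)
  finally show ?thesis by simp
qed

text \<open>On a finite measure space the bound R makes the integrals of the norms summable, so sum
  and integral may be exchanged. This one exchange serves the expansions of cos, of exp and of the
  Bessel series.\<close>

lemma (in finite_measure) integral_power_series:
  fixes c :: "nat \<Rightarrow> real"
  assumes P[measurable]: "P \<in> borel_measurable M" and R: "\<And>x. x \<in> space M \<Longrightarrow> \<bar>P x\<bar> \<le> R"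
    and s: "summable (\<lambda>k. \<bar>c k\<bar> * R ^ k)" and "0 \<le> R"
  shows "(LINT x|M. (\<Sum>k. c k * P x ^ k)) = (\<Sum>k. c k * (LINT x|M. P x ^ k))"
proof -
  have bnd: "\<bar>c k * P x ^ k\<bar> \<le> \<bar>c k\<bar> * R ^ k" if "x \<in> space M" for k x
    using R[OF that] by (auto simp: abs_mult power_abs intro!: mult_left_mono power_mono)
  have int: "integrable M (\<lambda>x. c k * P x ^ k)" for k
    by (rule integrable_const_bound[where B = "\<bar>c k\<bar> * R ^ k"]) (use bnd in auto)
  have "(LINT x|M. (\<Sum>k. c k * P x ^ k)) = (\<Sum>k. LINT x|M. c k * P x ^ k)"
  proof (rule integral_suminf[OF int])
    show "AE x in M. summable (\<lambda>k. norm (c k * P x ^ k))"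
      using bnd by (intro AE_I2 summable_comparison_test'[OF s]) auto
    show "summable (\<lambda>k. LINT x|M. norm (c k * P x ^ k))"
    proof (rule summable_comparison_test'[where N = 0])
      show "summable (\<lambda>k. measure M (space M) * (\<bar>c k\<bar> * R ^ k))"
        by (intro summable_mult s)
      fix k
      have "(LINT x|M. norm (c k * P x ^ k)) \<le> (LINT x|M. \<bar>c k\<bar> * R ^ k)"
        using bnd int by (intro integral_mono) auto
      then show "norm (LINT x|M. norm (c k * P x ^ k)) \<le> measure M (space M) * (\<bar>c k\<bar> * R ^ k)"
        by simp
    qed
  qed
  then show ?thesis by simp
qed

text \<open>Poisson's integral: the factor \<open>fact (2 * l)\<close> of the even moment cancels
  the one in the cosine series and leaves \<open>bessel_coeff\<close>. Its use is the bound 1 for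
  the Bessel function.\<close>

lemma bessel_series_eq_integral_cos:
  assumes "\<alpha> > - 1 / 2"
  shows "bessel_series \<alpha> (t\<^sup>2) = (LINT \<theta>|gegenbauer_measure \<alpha>. cos (t * cos \<theta>))"
proof -
  interpret prob_space "gegenbauer_measure \<alpha>"
    by (rule prob_space_gegenbauer_measure[OF assms])
  let ?c = "\<lambda>k. (- 1) ^ k / fact (2 * k) * (t\<^sup>2) ^ k :: real"
  have s: "(\<lambda>k. (- 1) ^ k / fact (2 * k) * u ^ (2 * k)) sums cos u" for u :: real
    using cos_paired[of u] by simp
  have "(LINT \<theta>|gegenbauer_measure \<alpha>. cos (t * cos \<theta>)) =
     (LINT \<theta>|gegenbauer_measure \<alpha>. (\<Sum>k. ?c k * ((cos \<theta>)\<^sup>2) ^ k))"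
  proof (rule Bochner_Integration.integral_cong[OF refl])
    fix \<theta>
    show "cos (t * cos \<theta>) = (\<Sum>k. ?c k * ((cos \<theta>)\<^sup>2) ^ k)"
      using sums_unique[OF s[of "t * cos \<theta>"]] by (simp add: power_mult_distrib power_mult mult.assoc)
  qed
  also have "\<dots> = (\<Sum>k. ?c k * (LINT \<theta>|gegenbauer_measure \<alpha>. ((cos \<theta>)\<^sup>2) ^ k))"
  proof (rule integral_power_series[where R = 1])
    have *: "summable (\<lambda>k. \<bar>cos_coeff k * t ^ k\<bar>)"
      using summable_norm_cos[of t] by simp
    have "summable (\<lambda>k. \<bar>cos_coeff (2 * k) * t ^ (2 * k)\<bar>)"
      using summable_reindex[OF *, of "\<lambda>k. 2 * k"] by (simp add: inj_on_def o_def)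
    then show "summable (\<lambda>k. \<bar>?c k\<bar> * 1 ^ k)"
      by (simp add: cos_coeff_def power_mult)
  qed (auto simp: abs_square_le_1)
  also have "\<dots> = bessel_series \<alpha> (t\<^sup>2)"
    unfolding bessel_series_def
  proof (intro suminf_cong)
    fix k
    show "?c k * (LINT \<theta>|gegenbauer_measure \<alpha>. ((cos \<theta>)\<^sup>2) ^ k) = bessel_coeff \<alpha> k * (t\<^sup>2) ^ k"
      using integral_gegenbauer_cos_even_power[OF assms, of k]
      by (simp add: power_mult bessel_coeff_def)
  qed
  finally show ?thesis by simp
qed

lemma abs_norm_bessel_le_1:
  assumes "\<alpha> > - 1 / 2"
  shows "\<bar>norm_bessel \<alpha> t\<bar> \<le> 1"
proof -
  interpret prob_space "gegenbauer_measure \<alpha>"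
    by (rule prob_space_gegenbauer_measure[OF assms])
  have "\<bar>LINT \<theta>|gegenbauer_measure \<alpha>. cos (t * cos \<theta>)\<bar> \<le> (LINT \<theta>|gegenbauer_measure \<alpha>. \<bar>cos (t * cos \<theta>)\<bar>)"
    by (rule integral_abs_bound)
  also have "\<dots> \<le> (LINT \<theta>|gegenbauer_measure \<alpha>. 1)"
    by (intro integral_mono integrable_const_bound[where B = 1]) auto
  finally show ?thesis
    using prob_space by (simp add: norm_bessel_eq[OF assms] bessel_series_eq_integral_cos[OF assms])
qed

text \<open>Chu-Vandermonde for the upper parameters \<open>real i\<close> and
  \<open>\<alpha> + real j\<close>. The conditional expresses that \<open>i choose l\<close> is zero
  for l > i, where the truncated difference \<open>i - l\<close> would contribute
  \<open>fact 0\<close>.\<close>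

lemma pochhammer_Vandermonde:
  fixes \<alpha> :: real
  assumes "\<alpha> > - 1 / 2"
  shows "(\<Sum>l\<le>j. 1 / (fact l * fact (j - l) * pochhammer (\<alpha> + 1) l) * (if l \<le> i then 1 / fact (i - l) else 0))
    = pochhammer (\<alpha> + 1) (i + j) / (fact i * fact j * pochhammer (\<alpha> + 1) i * pochhammer (\<alpha> + 1) j)"
proof -
  note pos = pochhammer_alpha_pos[OF assms]
  have summand: "(real i gchoose l) * ((\<alpha> + real j) gchoose (j - l)) = fact i * pochhammer (\<alpha> + 1) j *
      (1 / (fact l * fact (j - l) * pochhammer (\<alpha> + 1) l) * (if l \<le> i then 1 / fact (i - l) else 0))"
    if "l \<le> j" for l
  proof -
    have "((\<alpha> + real j) gchoose (j - l)) = pochhammer (\<alpha> + 1 + real l) (j - l) / fact (j - l)"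
      using that by (simp add: gbinomial_pochhammer' of_nat_diff algebra_simps)
    moreover have "pochhammer (\<alpha> + 1) j = pochhammer (\<alpha> + 1) l * pochhammer (\<alpha> + 1 + real l) (j - l)"
      using that by (rule pochhammer_product)
    moreover have "(real i gchoose l) = (if l \<le> i then fact i / (fact l * fact (i - l)) else 0)"
      by (simp add: binomial_gbinomial[symmetric] binomial_fact)
    ultimately show ?thesis
      using pos[of l] by simp
  qed
  have "fact i * pochhammer (\<alpha> + 1) j *
     (\<Sum>l\<le>j. 1 / (fact l * fact (j - l) * pochhammer (\<alpha> + 1) l) * (if l \<le> i then 1 / fact (i - l) else 0)) =
     (\<Sum>l = 0..j. (real i gchoose l) * ((\<alpha> + real j) gchoose (j - l)))"
    unfolding sum_distrib_left atLeast0AtMost by (intro sum.cong refl) (simp only: summand atMost_iff)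
  also have "\<dots> = (real i + (\<alpha> + real j)) gchoose j"
    by (rule gbinomial_Vandermonde)
  also have "\<dots> = pochhammer (\<alpha> + 1 + real i) j / fact j"
    by (simp add: gbinomial_pochhammer' algebra_simps)
  also have "pochhammer (\<alpha> + 1 + real i) j = pochhammer (\<alpha> + 1) (i + j) / pochhammer (\<alpha> + 1) i"
    using pos[of i] by (simp add: pochhammer_product')
  finally show ?thesis
    using pos[of i] pos[of j] by (simp add: field_simps)
qed

text \<open>Compare the coefficients of X^i Y^(k-i). After expanding in powers of cos and then of X
  + Y, only even powers of cos survive, and the hypothesis turns \<open>c ^ (2 * l)\<close> into 4^l
  X^l Y^l. The remaining sum over l is \<open>pochhammer_Vandermonde\<close> with j = k - i.
  Prescribing the square of c, rather than taking a root of 4 X Y, leaves its sign free.\<close>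

lemma bessel_coeff_product:
  fixes \<alpha> X Y c :: real
  assumes "\<alpha> > - 1 / 2" and c: "c\<^sup>2 = 4 * X * Y"
  shows "bessel_coeff \<alpha> k * (LINT \<theta>|gegenbauer_measure \<alpha>. (X + Y + c * cos \<theta>) ^ k) =
    (\<Sum>i\<le>k. (bessel_coeff \<alpha> i * X ^ i) * (bessel_coeff \<alpha> (k - i) * Y ^ (k - i)))"
proof -
  interpret prob_space "gegenbauer_measure \<alpha>"
    by (rule prob_space_gegenbauer_measure[OF assms(1)])
  note pos = pochhammer_alpha_pos[OF assms(1)]
  let ?m = "\<lambda>n. LINT \<theta>|gegenbauer_measure \<alpha>. cos \<theta> ^ n"
  let ?t = "\<lambda>n r. real (k choose n) * real ((k - n) choose r) * c ^ n * ?m n * X ^ r * Y ^ (k - n - r)"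
  let ?w = "\<lambda>i l. 1 / (fact l * fact (k - i - l) * pochhammer (\<alpha> + 1) l) * (if l \<le> i then 1 / fact (i - l) else 0) :: real"
  have int: "integrable (gegenbauer_measure \<alpha>) (\<lambda>\<theta>. a * cos \<theta> ^ n)" for n a
    by (rule integrable_const_bound[where B = "\<bar>a\<bar>"])
      (auto simp: abs_mult power_abs intro!: mult_left_le power_le_one)
  have "(LINT \<theta>|gegenbauer_measure \<alpha>. (X + Y + c * cos \<theta>) ^ k) =
     (LINT \<theta>|gegenbauer_measure \<alpha>. (\<Sum>n\<le>k. (real (k choose n) * c ^ n * (X + Y) ^ (k - n)) * cos \<theta> ^ n))"
    by (intro Bochner_Integration.integral_cong refl, subst add.commute, subst binomial_ring)
      (simp add: power_mult_distrib mult_ac)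
  also have "\<dots> = (\<Sum>n\<le>k. real (k choose n) * c ^ n * (X + Y) ^ (k - n) * ?m n)"
    by (subst Bochner_Integration.integral_sum) (rule int, simp)
  also have "\<dots> = (\<Sum>n\<le>k. \<Sum>r\<le>k - n. ?t n r)"
    by (intro sum.cong refl, subst binomial_ring)
      (simp add: sum_distrib_left sum_distrib_right mult_ac)
  also have "\<dots> = (\<Sum>(n, r)\<in>(SIGMA n:{..k}. {..k - n}). ?t n r)"
    by (rule sum.Sigma) auto
  also have "\<dots> = (\<Sum>(n, r)\<in>{(n, r). even n \<and> n + r \<le> k}. ?t n r)"
  proof (rule sum.mono_neutral_right)
    show "\<forall>i\<in>(SIGMA n:{..k}. {..k - n}) - {(n, r). even n \<and> n + r \<le> k}. (case i of (n, r) \<Rightarrow> ?t n r) = 0"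
    proof
      fix p assume "p \<in> (SIGMA n:{..k}. {..k - n}) - {(n, r). even n \<and> n + r \<le> k}"
      then obtain n r where "p = (n, r)" "odd n"
        by (cases p) auto
      then show "(case p of (n, r) \<Rightarrow> ?t n r) = 0"
        by (simp add: integral_gegenbauer_cos_odd_power[OF assms(1)])
    qed
  qed auto
  \<comment> \<open>The exponent of cos is n = 2 l, and i = r + l is the total exponent of X once
    c^(2l) has contributed X^l.\<close>
  also have "\<dots> = (\<Sum>(i, l)\<in>{(i, l). i \<le> k \<and> l \<le> i \<and> l \<le> k - i}. ?t (2 * l) (i - l))"
    by (rule sum.reindex_bij_witness[where i = "\<lambda>(i, l). (2 * l, i - l)" and j = "\<lambda>(n, r). (r + n div 2, n div 2)"])
      auto
  also have "\<dots> = (\<Sum>(i, l)\<in>{(i, l). i \<le> k \<and> l \<le> i \<and> l \<le> k - i}. fact k * X ^ i * Y ^ (k - i) * ?w i l)"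
  proof (intro sum.cong refl)
    fix p assume "p \<in> {(i, l). i \<le> k \<and> l \<le> i \<and> l \<le> k - i}"
    then obtain i l where p: "p = (i, l)" and il: "i \<le> k" "l \<le> i" "l \<le> k - i"
      by (cases p) auto
    have b1: "real (k choose (2 * l)) = fact k / (fact (2 * l) * fact (k - 2 * l))"
      using il by (intro binomial_fact) auto
    have b2: "real ((k - 2 * l) choose (i - l)) = fact (k - 2 * l) / (fact (i - l) * fact (k - i - l))"
    proof -
      have "real ((k - 2 * l) choose (i - l)) = fact (k - 2 * l) / (fact (i - l) * fact (k - 2 * l - (i - l)))"
        using il by (intro binomial_fact) auto
      moreover have "k - 2 * l - (i - l) = k - i - l" using il by auto
      ultimately show ?thesis by simp
    qed
    have c': "c ^ (2 * l) = 4 ^ l * X ^ l * Y ^ l"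
      by (simp add: power_mult c power_mult_distrib)
    have e: "X ^ i = X ^ l * X ^ (i - l)" "Y ^ (k - i) = Y ^ l * Y ^ (k - i - l)" "k - 2 * l - (i - l) = k - i - l"
      using il by (auto simp flip: power_add)
    have "?t (2 * l) (i - l) = fact k * X ^ i * Y ^ (k - i) / (fact l * fact (k - i - l) * pochhammer (\<alpha> + 1) l * fact (i - l))"
      unfolding b1 b2 c' integral_gegenbauer_cos_even_power[OF assms(1)] e using pos[of l]
      by (simp add: mult_ac)
    then show "(case p of (i, l) \<Rightarrow> ?t (2 * l) (i - l)) = (case p of (i, l) \<Rightarrow> fact k * X ^ i * Y ^ (k - i) * ?w i l)"
      using il by (simp add: p)
  qed
  \<comment> \<open>The pairs added here have l > i, where \<open>?w\<close> is zero.\<close>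
  also have "\<dots> = (\<Sum>(i, l)\<in>(SIGMA i:{..k}. {..k - i}). fact k * X ^ i * Y ^ (k - i) * ?w i l)"
    by (rule sum.mono_neutral_left) (auto split: if_splits)
  also have "\<dots> = (\<Sum>i\<le>k. \<Sum>l\<le>k - i. fact k * X ^ i * Y ^ (k - i) * ?w i l)"
    by (rule sum.Sigma[symmetric]) auto
  also have "\<dots> = (\<Sum>i\<le>k. fact k * X ^ i * Y ^ (k - i) * (\<Sum>l\<le>k - i. ?w i l))"
    by (simp only: sum_distrib_left)
  finally have *: "(LINT \<theta>|gegenbauer_measure \<alpha>. (X + Y + c * cos \<theta>) ^ k) =
     (\<Sum>i\<le>k. fact k * X ^ i * Y ^ (k - i) * (\<Sum>l\<le>k - i. ?w i l))" .
  have "bessel_coeff \<alpha> k * (LINT \<theta>|gegenbauer_measure \<alpha>. (X + Y + c * cos \<theta>) ^ k) =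
    (\<Sum>i\<le>k. bessel_coeff \<alpha> k * (fact k * X ^ i * Y ^ (k - i) * (\<Sum>l\<le>k - i. ?w i l)))"
    unfolding * by (rule sum_distrib_left)
  also have "\<dots> = (\<Sum>i\<le>k. (bessel_coeff \<alpha> i * X ^ i) * (bessel_coeff \<alpha> (k - i) * Y ^ (k - i)))"
  proof (intro sum.cong refl)
    fix i assume "i \<in> {..k}"
    then have i: "i + (k - i) = k" by simp
    have s: "(- 1 :: real) ^ k = (- 1) ^ i * (- 1) ^ (k - i)" "(4 :: real) ^ k = 4 ^ i * 4 ^ (k - i)"
      using i by (simp_all flip: power_add)
    show "bessel_coeff \<alpha> k * (fact k * X ^ i * Y ^ (k - i) * (\<Sum>l\<le>k - i. ?w i l)) =
      bessel_coeff \<alpha> i * X ^ i * (bessel_coeff \<alpha> (k - i) * Y ^ (k - i))"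
      unfolding pochhammer_Vandermonde[OF assms(1)] i bessel_coeff_def s
      using pos[of k] pos[of i] pos[of "k - i"] by (simp add: mult_ac)
  qed
  finally show ?thesis .
qed

text \<open>The left side is a Cauchy product, and \<open>bessel_coeff_product\<close> matches it
  with the integrated series degree by degree.\<close>

lemma bessel_series_product:
  fixes \<alpha> X Y c :: real
  assumes "\<alpha> > - 1 / 2" and c: "c\<^sup>2 = 4 * X * Y"
  shows "bessel_series \<alpha> X * bessel_series \<alpha> Y =
    (LINT \<theta>|gegenbauer_measure \<alpha>. bessel_series \<alpha> (X + Y + c * cos \<theta>))"
proof -
  interpret prob_space "gegenbauer_measure \<alpha>"
    by (rule prob_space_gegenbauer_measure[OF assms(1)])
  have "(LINT \<theta>|gegenbauer_measure \<alpha>. bessel_series \<alpha> (X + Y + c * cos \<theta>)) =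
    (\<Sum>k. bessel_coeff \<alpha> k * (LINT \<theta>|gegenbauer_measure \<alpha>. (X + Y + c * cos \<theta>) ^ k))"
    unfolding bessel_series_def
  proof (rule integral_power_series[where R = "\<bar>X\<bar> + \<bar>Y\<bar> + \<bar>c\<bar>"])
    show "\<bar>X + Y + c * cos \<theta>\<bar> \<le> \<bar>X\<bar> + \<bar>Y\<bar> + \<bar>c\<bar>" for \<theta>
    proof -
      have "\<bar>c * cos \<theta>\<bar> \<le> \<bar>c\<bar>"
        by (auto simp: abs_mult intro!: mult_left_le)
      then show ?thesis by linarith
    qed
    show "summable (\<lambda>k. \<bar>bessel_coeff \<alpha> k\<bar> * (\<bar>X\<bar> + \<bar>Y\<bar> + \<bar>c\<bar>) ^ k)"
      using summable_abs_bessel_series[OF assms(1), of "\<bar>X\<bar> + \<bar>Y\<bar> + \<bar>c\<bar>"] by simp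
  qed auto
  also have "\<dots> = (\<Sum>k. \<Sum>i\<le>k. (bessel_coeff \<alpha> i * X ^ i) * (bessel_coeff \<alpha> (k - i) * Y ^ (k - i)))"
    by (simp only: bessel_coeff_product[OF assms])
  also have "\<dots> = bessel_series \<alpha> X * bessel_series \<alpha> Y"
    unfolding bessel_series_def
    using summable_abs_bessel_series[OF assms(1), of X] summable_abs_bessel_series[OF assms(1), of Y]
    by (intro Cauchy_product[symmetric]) (simp_all add: abs_mult power_abs)
  finally show ?thesis by simp
qed

text \<open>The product formula in the geometry of the translation: X = (l x)^2, Y = (l y)^2 and c =
  2 l^2 x y.\<close>

lemma norm_bessel_product:
  assumes "\<alpha> > - 1 / 2"
  shows "norm_bessel \<alpha> (l * x) * norm_bessel \<alpha> (l * y) =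
    (LINT \<theta>|gegenbauer_measure \<alpha>. norm_bessel \<alpha> (l * sqrt (x\<^sup>2 + y\<^sup>2 + 2 * x * y * cos \<theta>)))"
proof -
  have nn: "0 \<le> x\<^sup>2 + y\<^sup>2 + 2 * x * y * cos \<theta>" for \<theta>
  proof -
    \<comment> \<open>Writing the law of cosines as a sum of two squares shows that the radicand is
      nonnegative, so squaring the root returns it.\<close>
    have "x\<^sup>2 + y\<^sup>2 + 2 * x * y * cos \<theta> = (x + y * cos \<theta>)\<^sup>2 + (y * sin \<theta>)\<^sup>2"
      using sin_cos_squared_add[of \<theta>] by algebra
    then show ?thesis by simp
  qed
  have "(l * sqrt (x\<^sup>2 + y\<^sup>2 + 2 * x * y * cos \<theta>))\<^sup>2 = (l * x)\<^sup>2 + (l * y)\<^sup>2 + 2 * l\<^sup>2 * x * y * cos \<theta>" for \<theta>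
    using nn[of \<theta>] by (simp add: power_mult_distrib algebra_simps)
  moreover have "(2 * l\<^sup>2 * x * y)\<^sup>2 = 4 * (l * x)\<^sup>2 * (l * y)\<^sup>2"
    by algebra
  ultimately show ?thesis
    by (simp only: norm_bessel_eq[OF assms] bessel_series_product[OF assms])
qed

section \<open>Gaussian integrals of Bessel functions\<close>

text \<open>The last-coordinate factor of the Weinstein measure; the power of 2 pi is left to
  \<open>fourier_measure\<close>. It is extended by zero so that the measure lives on the whole
  line.\<close>

definition bessel_density :: "real \<Rightarrow> real \<Rightarrow> real" where
  "bessel_density \<alpha> t = indicator {0<..} t * (t powr (2 * \<alpha> + 1) / (2 powr \<alpha> * Gamma (\<alpha> + 1)))"

definition bessel_measure :: "real \<Rightarrow> real measure" where
  "bessel_measure \<alpha> = density lborel (\<lambda>t. ennreal (bessel_density \<alpha> t))"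

lemma bessel_density_nonneg: "\<alpha> > - 1 / 2 \<Longrightarrow> 0 \<le> bessel_density \<alpha> t"
  by (auto simp: bessel_density_def indicator_def intro!: divide_nonneg_nonneg mult_nonneg_nonneg)

lemma measurable_bessel_density [measurable]: "bessel_density \<alpha> \<in> borel_measurable borel"
  unfolding bessel_density_def[abs_def] by measurable

lemma sets_bessel_measure [measurable_cong, simp]: "sets (bessel_measure \<alpha>) = sets borel"
  by (simp add: bessel_measure_def)

lemma space_bessel_measure [simp]: "space (bessel_measure \<alpha>) = UNIV"
  by (simp add: bessel_measure_def)

lemma sigma_finite_bessel_measure: "sigma_finite_measure (bessel_measure \<alpha>)"
  unfolding bessel_measure_def
  by (subst sigma_finite_measure.sigma_finite_iff_density_finite[OF sigma_finite_lborel]) auto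

text \<open>The substitution u = p t^2 / 2 in the Gamma integral.\<close>

lemma nn_integral_gaussian_powr:
  fixes p z :: real
  assumes p: "p > 0" and z: "z > 0"
  shows "(\<integral>\<^sup>+ t. ennreal (indicator {0<..} t * (t powr (2 * z - 1) * exp (- p * t\<^sup>2 / 2))) \<partial>lborel) =
    ennreal (Gamma z / (2 * (p / 2) powr z))"
proof -
  let ?f = "\<lambda>u::real. u powr (z - 1) / exp u" and ?g = "\<lambda>t::real. p * t\<^sup>2 / 2"
  have "((\<lambda>t. if t \<in> {0<..} then ?f t else 0) has_integral Gamma z) {0..}"
    by (rule has_integral_spike [of "{0}", rotated 2, OF Gamma_integral_real[OF z]]) auto
  then have f: "(?f has_integral Gamma z) {0<..}"
    by (subst (asm) has_integral_restrict) auto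
  have img: "?g ` {0<..} = {0<..}"
  proof (intro equalityI subsetI)
    fix u :: real assume "u \<in> {0<..}"
    then have "u = ?g (sqrt (2 * u / p))" "sqrt (2 * u / p) \<in> {0<..}"
      using p by auto
    then show "u \<in> ?g ` {0<..}" by blast
  qed (use p in auto)
  have "?f absolutely_integrable_on (?g ` {0<..}) \<and> integral (?g ` {0<..}) ?f = Gamma z"
    unfolding img using f by (auto intro!: nonnegative_absolutely_integrable_1 simp: has_integral_iff)
  moreover have "inj_on ?g {0<..}"
    using p by (auto simp: inj_on_def power2_eq_iff)
  ultimately have "(\<lambda>t. \<bar>p * t\<bar> * ?f (?g t)) absolutely_integrable_on {0<..} \<and>
     integral {0<..} (\<lambda>t. \<bar>p * t\<bar> * ?f (?g t)) = Gamma z"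
    by (subst has_absolute_integral_change_of_variables_1')
      (auto intro!: derivative_eq_intros)
  then have "((\<lambda>t. \<bar>p * t\<bar> * ?f (?g t)) has_integral Gamma z) {0<..}"
    by (auto simp: has_integral_iff set_lebesgue_integral_eq_integral(1))
  then have "ennreal (Gamma z) = (\<integral>\<^sup>+ t. ennreal (indicator {0<..} t * (\<bar>p * t\<bar> * ?f (?g t))) \<partial>lborel)"
    by (intro nn_integral_has_integral_lebesgue[symmetric]) auto
  also have "\<dots> = (\<integral>\<^sup>+ t. ennreal (2 * (p / 2) powr z) *
      ennreal (indicator {0<..} t * (t powr (2 * z - 1) * exp (- p * t\<^sup>2 / 2))) \<partial>lborel)"
  proof (intro nn_integral_cong)
    fix t :: real
    show "ennreal (indicator {0<..} t * (\<bar>p * t\<bar> * ?f (?g t))) = ennreal (2 * (p / 2) powr z) *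
      ennreal (indicator {0<..} t * (t powr (2 * z - 1) * exp (- p * t\<^sup>2 / 2)))"
    proof (cases "t > 0")
      case True
      have a: "?g t powr (z - 1) = (p / 2) powr (z - 1) * (t\<^sup>2) powr (z - 1)"
        using p by (simp add: powr_mult flip: times_divide_eq_left)
      have b: "(t\<^sup>2) powr (z - 1) * t = t powr (2 * z - 1)"
        using square_powr_mult[OF True, of "z - 1 / 2"] by simp
      have c: "(p / 2) powr (z - 1) * p = 2 * (p / 2) powr z"
        using p by (simp add: powr_diff)
      have e: "exp (- p * t\<^sup>2 / 2) = 1 / exp (?g t)"
        by (simp add: exp_minus inverse_eq_divide)
      have pt: "\<bar>p * t\<bar> = p * t"
        using p True by simp
      have "\<bar>p * t\<bar> * ?f (?g t) = ((p / 2) powr (z - 1) * p) * ((t\<^sup>2) powr (z - 1) * t) * exp (- p * t\<^sup>2 / 2)"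
        unfolding a e pt by (simp only: times_divide_eq_right mult_1_right mult_ac)
      then have "\<bar>p * t\<bar> * ?f (?g t) = 2 * (p / 2) powr z * (t powr (2 * z - 1) * exp (- p * t\<^sup>2 / 2))"
        unfolding b c by (simp only: mult.assoc)
      then show ?thesis using True by (simp flip: ennreal_mult')
    qed simp
  qed
  also have "\<dots> = ennreal (2 * (p / 2) powr z) *
      (\<integral>\<^sup>+ t. ennreal (indicator {0<..} t * (t powr (2 * z - 1) * exp (- p * t\<^sup>2 / 2))) \<partial>lborel)"
    by (rule nn_integral_cmult) measurable
  finally have *: "ennreal (Gamma z) = ennreal (2 * (p / 2) powr z) *
      (\<integral>\<^sup>+ t. ennreal (indicator {0<..} t * (t powr (2 * z - 1) * exp (- p * t\<^sup>2 / 2))) \<partial>lborel)" .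
  have c: "2 * (p / 2) powr z > 0" using p by simp
  show ?thesis
    by (rule ennreal_mult_eq_imp_eq[OF * c]) (use z in \<open>auto intro: Gamma_real_nonneg\<close>)
qed

lemma nn_integral_bessel_measure:
  assumes "f \<in> borel_measurable borel"
  shows "(\<integral>\<^sup>+ t. f t \<partial>bessel_measure \<alpha>) = (\<integral>\<^sup>+ t. ennreal (bessel_density \<alpha> t) * f t \<partial>lborel)"
  unfolding bessel_measure_def using assms by (intro nn_integral_density) auto

lemma nn_integral_bessel_gaussian:
  assumes \<alpha>: "\<alpha> > - 1 / 2" and p: "p > 0"
  shows "(\<integral>\<^sup>+ t. ennreal (exp (- p * t\<^sup>2 / 2) * t ^ (2 * k)) \<partial>bessel_measure \<alpha>) =
    ennreal (2 ^ k * pochhammer (\<alpha> + 1) k / p ^ k * p powr - (\<alpha> + 1))"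
proof -
  let ?z = "\<alpha> + 1 + real k"
  let ?C = "1 / (2 powr \<alpha> * Gamma (\<alpha> + 1))"
  have G: "Gamma (\<alpha> + 1) > 0" using \<alpha> by (intro Gamma_real_pos) auto
  have z: "?z > 0" using \<alpha> by auto
  have "(\<integral>\<^sup>+ t. ennreal (exp (- p * t\<^sup>2 / 2) * t ^ (2 * k)) \<partial>bessel_measure \<alpha>) =
    (\<integral>\<^sup>+ t. ennreal (bessel_density \<alpha> t) * ennreal (exp (- p * t\<^sup>2 / 2) * t ^ (2 * k)) \<partial>lborel)"
    by (rule nn_integral_bessel_measure) measurable
  also have "\<dots> = (\<integral>\<^sup>+ t. ennreal ?C * ennreal (indicator {0<..} t * (t powr (2 * ?z - 1) * exp (- p * t\<^sup>2 / 2))) \<partial>lborel)"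
  proof (intro nn_integral_cong)
    fix t :: real
    show "ennreal (bessel_density \<alpha> t) * ennreal (exp (- p * t\<^sup>2 / 2) * t ^ (2 * k)) =
       ennreal ?C * ennreal (indicator {0<..} t * (t powr (2 * ?z - 1) * exp (- p * t\<^sup>2 / 2)))"
    proof (cases "t > 0")
      case True
      have "t ^ (2 * k) = t powr (2 * real k)"
        using powr_realpow[OF True, of "2 * k"] by simp
      then have "t powr (2 * \<alpha> + 1) * t ^ (2 * k) = t powr (2 * \<alpha> + 1 + 2 * real k)"
        by (simp only: powr_add)
      also have "2 * \<alpha> + 1 + 2 * real k = 2 * ?z - 1" by simp
      finally have "t powr (2 * \<alpha> + 1) * t ^ (2 * k) = t powr (2 * ?z - 1)" .
      then have "bessel_density \<alpha> t * (exp (- p * t\<^sup>2 / 2) * t ^ (2 * k)) = ?C * (t powr (2 * ?z - 1) * exp (- p * t\<^sup>2 / 2))"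
        using True by (simp add: bessel_density_def mult_ac)
      then show ?thesis
        using True G by (simp add: bessel_density_nonneg[OF \<alpha>] flip: ennreal_mult')
    qed (simp add: bessel_density_def)
  qed
  also have "\<dots> = ennreal ?C * ennreal (Gamma ?z / (2 * (p / 2) powr ?z))"
    unfolding nn_integral_gaussian_powr[OF p z, symmetric] by (rule nn_integral_cmult) measurable
  also have "\<dots> = ennreal (?C * (Gamma ?z / (2 * (p / 2) powr ?z)))"
    using G by (intro ennreal_mult'[symmetric]) simp
  also have "?C * (Gamma ?z / (2 * (p / 2) powr ?z)) = 2 ^ k * pochhammer (\<alpha> + 1) k / p ^ k * p powr - (\<alpha> + 1)"
  proof -
    have 1: "pochhammer (\<alpha> + 1) k = Gamma ?z / Gamma (\<alpha> + 1)"
      by (rule pochhammer_Gamma) (use \<alpha> in \<open>auto dest: nonpos_Ints_nonpos\<close>)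
    have "(p / 2) powr ?z = p powr (\<alpha> + 1) * p ^ k / (2 powr \<alpha> * 2 * 2 ^ k)"
      using p by (simp add: powr_divide powr_add powr_realpow)
    then show ?thesis
      unfolding 1 powr_minus using p G by (simp add: field_simps)
  qed
  finally show ?thesis .
qed

text \<open>Weber's Gaussian integral, by termwise integration:
  \<open>pochhammer (\<alpha> + 1) k\<close> from the Gaussian moment cancels the one in
  \<open>bessel_coeff\<close>, and the exponential series at \<open>- w / (2 * p)\<close> remains.
  Both signs of w are used, the positive one for the Bessel function and the negative one for the
  heat kernel.\<close>

lemma
  assumes \<alpha>: "\<alpha> > - 1 / 2" and p: "p > 0"
  shows integrable_bessel_gaussian:
      "integrable (bessel_measure \<alpha>) (\<lambda>t. exp (- p * t\<^sup>2 / 2) * bessel_series \<alpha> (w * t\<^sup>2))"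
    and integral_bessel_gaussian:
      "(LINT t|bessel_measure \<alpha>. exp (- p * t\<^sup>2 / 2) * bessel_series \<alpha> (w * t\<^sup>2)) =
        p powr - (\<alpha> + 1) * exp (- w / (2 * p))"
proof -
  let ?M = "bessel_measure \<alpha>"
  let ?b = "\<lambda>k. 2 ^ k * pochhammer (\<alpha> + 1) k / p ^ k * p powr - (\<alpha> + 1)"
  let ?e = "\<lambda>k t. exp (- p * t\<^sup>2 / 2) * t ^ (2 * k)"
  let ?c = "\<lambda>k. bessel_coeff \<alpha> k * w ^ k"
  let ?t = "\<lambda>k t. ?c k * ?e k t"
  note pos = pochhammer_alpha_pos[OF \<alpha>]
  have b0: "0 \<le> ?b k" for k
    using pos[of k] p by auto
  have int_e: "integrable ?M (?e k)" for k
    using nn_integral_bessel_gaussian[OF \<alpha> p, of k] by (intro integrableI_nonneg) auto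
  have I: "(LINT t|?M. ?e k t) = ?b k" for k
    using nn_integral_bessel_gaussian[OF \<alpha> p, of k] b0[of k]
    by (simp add: integral_eq_nn_integral)
  have int: "integrable ?M (?t k)" for k
    by (intro integrable_mult_right int_e)
  have cb: "?c k * ?b k = p powr - (\<alpha> + 1) * ((- w / (2 * p)) ^ k / fact k)" for k
  proof -
    have "(4 :: real) ^ k = 2 ^ k * 2 ^ k" by (simp flip: power_mult_distrib)
    moreover have "(- w / (2 * p)) ^ k = (- 1) ^ k * (w ^ k / (2 ^ k * p ^ k))"
      using power_minus[of "w / (2 * p)" k] by (simp add: power_divide power_mult_distrib)
    ultimately show ?thesis
      unfolding bessel_coeff_def using pos[of k] p by (simp only:) (simp add: mult_ac)
  qed
  have abs_cb: "\<bar>?c k\<bar> * ?b k = p powr - (\<alpha> + 1) * ((\<bar>w\<bar> / (2 * p)) ^ k / fact k)" for k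
  proof -
    have "\<bar>?c k\<bar> * ?b k = \<bar>?c k * ?b k\<bar>" by (simp only: abs_mult[of "?c k"] abs_of_nonneg[OF b0])
    then show ?thesis unfolding cb using p by (simp add: abs_mult power_abs)
  qed
  have sum: "(\<Sum>k. ?t k t) = exp (- p * t\<^sup>2 / 2) * bessel_series \<alpha> (w * t\<^sup>2)"
    and summ: "summable (\<lambda>k. norm (?t k t))" for t
  proof -
    have eq: "?t k t = exp (- p * t\<^sup>2 / 2) * (bessel_coeff \<alpha> k * (w * t\<^sup>2) ^ k)" for k
      by (simp add: power_mult_distrib power_mult)
    show "(\<Sum>k. ?t k t) = exp (- p * t\<^sup>2 / 2) * bessel_series \<alpha> (w * t\<^sup>2)"
      unfolding eq bessel_series_def by (rule suminf_mult[OF summable_bessel_series[OF \<alpha>]])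
    show "summable (\<lambda>k. norm (?t k t))"
      unfolding eq using summable_abs_bessel_series[OF \<alpha>, of "w * t\<^sup>2"]
      by (simp add: abs_mult power_abs summable_mult)
  qed
  have summI: "summable (\<lambda>k. LINT t|?M. norm (?t k t))"
  proof -
    have "(LINT t|?M. norm (?t k t)) = \<bar>?c k\<bar> * ?b k" for k
      unfolding I[symmetric] by (simp add: abs_mult flip: integral_mult_right_zero)
    moreover have "summable (\<lambda>k. p powr - (\<alpha> + 1) * ((\<bar>w\<bar> / (2 * p)) ^ k / fact k))"
      using summable_exp[of "\<bar>w\<bar> / (2 * p)"] by (intro summable_mult) (simp add: field_simps)
    ultimately show ?thesis by (simp only: abs_cb)
  qed
  note su = integrable_suminf[OF int AE_I2[OF summ] summI] integral_suminf[OF int AE_I2[OF summ] summI]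
  show "integrable ?M (\<lambda>t. exp (- p * t\<^sup>2 / 2) * bessel_series \<alpha> (w * t\<^sup>2))"
    using su(1) by (simp only: sum)
  have "(LINT t|?M. exp (- p * t\<^sup>2 / 2) * bessel_series \<alpha> (w * t\<^sup>2)) = (\<Sum>k. LINT t|?M. ?t k t)"
    using su(2) by (simp only: sum)
  also have "\<dots> = (\<Sum>k. ?c k * ?b k)"
    by (simp only: integral_mult_right_zero I)
  also have "\<dots> = (\<Sum>k. p powr - (\<alpha> + 1) * ((- w / (2 * p)) ^ k /\<^sub>R fact k))"
    by (simp only: cb) (simp add: field_simps)
  also have "\<dots> = p powr - (\<alpha> + 1) * exp (- w / (2 * p))"
    using exp_converges[of "- w / (2 * p)"] by (subst suminf_mult) (auto simp: sums_iff)
  finally show "(LINT t|?M. exp (- p * t\<^sup>2 / 2) * bessel_series \<alpha> (w * t\<^sup>2)) = p powr - (\<alpha> + 1) * exp (- w / (2 * p))" .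
qed

text \<open>Poisson's integral at an imaginary argument. Its integrand is positive, which is how the
  heat kernel is seen to be nonnegative.\<close>

lemma bessel_series_neg_eq_integral_exp:
  assumes "\<alpha> > - 1 / 2"
  shows "bessel_series \<alpha> (- u\<^sup>2) = (LINT \<theta>|gegenbauer_measure \<alpha>. exp (- u * cos \<theta>))"
proof -
  interpret prob_space "gegenbauer_measure \<alpha>"
    by (rule prob_space_gegenbauer_measure[OF assms])
  let ?c = "\<lambda>n. (- u) ^ n / fact n"
  have "(LINT \<theta>|gegenbauer_measure \<alpha>. exp (- u * cos \<theta>)) = (LINT \<theta>|gegenbauer_measure \<alpha>. (\<Sum>n. ?c n * cos \<theta> ^ n))"
  proof (intro Bochner_Integration.integral_cong refl)
    fix \<theta>
    show "exp (- u * cos \<theta>) = (\<Sum>n. ?c n * cos \<theta> ^ n)"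
      unfolding exp_def power_mult_distrib by (intro suminf_cong) (simp add: field_simps)
  qed
  also have "\<dots> = (\<Sum>n. ?c n * (LINT \<theta>|gegenbauer_measure \<alpha>. cos \<theta> ^ n))"
  proof (rule integral_power_series[where R = 1])
    show "summable (\<lambda>k. \<bar>?c k\<bar> * 1 ^ k)"
      using summable_exp[of "\<bar>u\<bar>"] by (simp add: power_abs field_simps)
  qed auto
  also have "\<dots> = (\<Sum>l. ?c (2 * l) * (LINT \<theta>|gegenbauer_measure \<alpha>. cos \<theta> ^ (2 * l)))"
  proof (rule suminf_mono_reindex[symmetric])
    show "strict_mono ((*) 2 :: nat \<Rightarrow> nat)" by (simp add: strict_mono_def)
    fix n :: nat assume "n \<notin> range ((*) 2)"
    then have "odd n" by (auto elim!: evenE)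
    then show "?c n * (LINT \<theta>|gegenbauer_measure \<alpha>. cos \<theta> ^ n) = 0"
      by (simp add: integral_gegenbauer_cos_odd_power[OF assms])
  qed
  also have "\<dots> = bessel_series \<alpha> (- u\<^sup>2)"
    unfolding bessel_series_def
  proof (intro suminf_cong)
    fix l
    have "(- (u\<^sup>2)) ^ l = (- 1) ^ l * (u\<^sup>2) ^ l" by (rule power_minus)
    then show "?c (2 * l) * (LINT \<theta>|gegenbauer_measure \<alpha>. cos \<theta> ^ (2 * l)) = bessel_coeff \<alpha> l * (- u\<^sup>2) ^ l"
      unfolding integral_gegenbauer_cos_even_power[OF assms] bessel_coeff_def
      by (simp add: power_mult)
  qed
  finally show ?thesis by simp
qed

text \<open>The heat kernel of the Bessel operator at time \<epsilon> / 2; the last factor is the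
  normalized modified Bessel function of \<open>x * y / \<epsilon>\<close>.\<close>

definition bessel_heat :: "real \<Rightarrow> real \<Rightarrow> real \<Rightarrow> real \<Rightarrow> real" where
  "bessel_heat \<alpha> \<epsilon> x y = \<epsilon> powr - (\<alpha> + 1) * exp (- (x\<^sup>2 + y\<^sup>2) / (2 * \<epsilon>)) * bessel_series \<alpha> (- (x * y / \<epsilon>)\<^sup>2)"

lemma bessel_heat_nonneg:
  assumes "\<alpha> > - 1 / 2"
  shows "0 \<le> bessel_heat \<alpha> \<epsilon> x y"
  unfolding bessel_heat_def bessel_series_neg_eq_integral_exp[OF assms]
  by (intro mult_nonneg_nonneg integral_nonneg_AE AE_I2) auto

lemma measurable_bessel_series [measurable]: "\<alpha> > - 1 / 2 \<Longrightarrow> bessel_series \<alpha> \<in> borel_measurable borel"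
  by (intro borel_measurable_continuous_onI continuous_bessel_series)

text \<open>As a function of y the kernel is a Gaussian times a Bessel series, so one more Gaussian
  only changes p to \<open>s + 1 / \<epsilon>\<close> in \<open>integral_bessel_gaussian\<close>.
  The case s = 0 gives the total mass; positive s gives the test integrals behind
  concentration.\<close>

lemma
  assumes \<alpha>: "\<alpha> > - 1 / 2" and \<epsilon>: "\<epsilon> > 0" and s: "s \<ge> 0"
  shows integrable_bessel_heat: "integrable (bessel_measure \<alpha>) (\<lambda>y. exp (- s * y\<^sup>2 / 2) * bessel_heat \<alpha> \<epsilon> x y)"
    and integral_bessel_heat: "(LINT y|bessel_measure \<alpha>. exp (- s * y\<^sup>2 / 2) * bessel_heat \<alpha> \<epsilon> x y) =
      (1 + s * \<epsilon>) powr - (\<alpha> + 1) * exp (- s * x\<^sup>2 / (2 * (1 + s * \<epsilon>)))"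
proof -
  let ?p = "s + 1 / \<epsilon>" and ?w = "- (x / \<epsilon>)\<^sup>2"
  let ?C = "\<epsilon> powr - (\<alpha> + 1) * exp (- x\<^sup>2 / (2 * \<epsilon>))"
  have p: "?p > 0" using \<epsilon> s by (simp add: add_nonneg_pos)
  have se: "1 + s * \<epsilon> > 0" using \<epsilon> s by (simp add: add_pos_nonneg)
  have eq: "exp (- s * y\<^sup>2 / 2) * bessel_heat \<alpha> \<epsilon> x y = ?C * (exp (- ?p * y\<^sup>2 / 2) * bessel_series \<alpha> (?w * y\<^sup>2))" for y
  proof -
    have "- (x * y / \<epsilon>)\<^sup>2 = ?w * y\<^sup>2" by (simp add: power_mult_distrib power_divide)
    moreover have "exp (- s * y\<^sup>2 / 2) * exp (- (x\<^sup>2 + y\<^sup>2) / (2 * \<epsilon>)) = exp (- x\<^sup>2 / (2 * \<epsilon>)) * exp (- ?p * y\<^sup>2 / 2)"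
      using \<epsilon> by (simp add: field_simps flip: exp_add)
    ultimately show ?thesis
      unfolding bessel_heat_def by (simp add: mult_ac)
  qed
  show "integrable (bessel_measure \<alpha>) (\<lambda>y. exp (- s * y\<^sup>2 / 2) * bessel_heat \<alpha> \<epsilon> x y)"
    unfolding eq by (intro integrable_mult_right integrable_bessel_gaussian \<alpha> p)
  have "(LINT y|bessel_measure \<alpha>. exp (- s * y\<^sup>2 / 2) * bessel_heat \<alpha> \<epsilon> x y) =
     ?C * (?p powr - (\<alpha> + 1) * exp (- ?w / (2 * ?p)))"
    unfolding eq integral_mult_right_zero integral_bessel_gaussian[OF \<alpha> p] ..
  also have "\<dots> = (\<epsilon> powr - (\<alpha> + 1) * ?p powr - (\<alpha> + 1)) * (exp (- x\<^sup>2 / (2 * \<epsilon>)) * exp (- ?w / (2 * ?p)))"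
    by (simp add: mult_ac)
  also have "\<epsilon> powr - (\<alpha> + 1) * ?p powr - (\<alpha> + 1) = (1 + s * \<epsilon>) powr - (\<alpha> + 1)"
    using \<epsilon> p by (simp add: distrib_left mult.commute add.commute flip: powr_mult)
  also have "exp (- x\<^sup>2 / (2 * \<epsilon>)) * exp (- ?w / (2 * ?p)) = exp (- s * x\<^sup>2 / (2 * (1 + s * \<epsilon>)))"
  proof -
    have pe: "?p = (1 + s * \<epsilon>) / \<epsilon>" using \<epsilon> by (simp add: field_simps)
    define D where "D = 1 + s * \<epsilon>"
    have "D > 0" and s': "s = (D - 1) / \<epsilon>" using se \<epsilon> by (simp_all add: D_def)
    then have "- x\<^sup>2 / (2 * \<epsilon>) + - ?w / (2 * ?p) = - s * x\<^sup>2 / (2 * (1 + s * \<epsilon>))"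
      unfolding pe D_def[symmetric] s' using \<epsilon> by (simp add: field_simps power2_eq_square)
    then show ?thesis by (simp flip: exp_add)
  qed
  finally show "(LINT y|bessel_measure \<alpha>. exp (- s * y\<^sup>2 / 2) * bessel_heat \<alpha> \<epsilon> x y) =
      (1 + s * \<epsilon>) powr - (\<alpha> + 1) * exp (- s * x\<^sup>2 / (2 * (1 + s * \<epsilon>)))" .
qed

lemma measurable_norm_bessel [measurable]: "\<alpha> > - 1 / 2 \<Longrightarrow> norm_bessel \<alpha> \<in> borel_measurable borel"
  by (simp add: norm_bessel_eq cong: measurable_cong)

lemma integrable_gaussian_bessel_measure:
  assumes "\<alpha> > - 1 / 2" "\<epsilon> > 0"
  shows "integrable (bessel_measure \<alpha>) (\<lambda>t. exp (- \<epsilon> * t\<^sup>2 / 2))"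
proof -
  have "bessel_series \<alpha> 0 = 1"
    unfolding bessel_series_def by (subst powser_zero) (simp add: bessel_coeff_def)
  then show ?thesis
    using integrable_bessel_gaussian[OF assms, of 0] by simp
qed

text \<open>The product formula replaces the two Bessel factors by an average of a single one; its
  Gaussian integral is an exponential of the law-of-cosines distance, and averaging that exponential
  produces the modified Bessel function.\<close>

lemma bessel_heat_eq_integral:
  assumes \<alpha>: "\<alpha> > - 1 / 2" and \<epsilon>: "\<epsilon> > 0"
  shows "(LINT t|bessel_measure \<alpha>. exp (- \<epsilon> * t\<^sup>2 / 2) * (norm_bessel \<alpha> (x * t) * norm_bessel \<alpha> (y * t))) = bessel_heat \<alpha> \<epsilon> x y"
proof -
  interpret G: prob_space "gegenbauer_measure \<alpha>"
    by (rule prob_space_gegenbauer_measure[OF \<alpha>])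
  interpret B: sigma_finite_measure "bessel_measure \<alpha>"
    by (rule sigma_finite_bessel_measure)
  interpret P: pair_sigma_finite "bessel_measure \<alpha>" "gegenbauer_measure \<alpha>" ..
  let ?Q = "\<lambda>\<theta>. x\<^sup>2 + y\<^sup>2 + 2 * x * y * cos \<theta>"
  let ?h = "\<lambda>t \<theta>. exp (- \<epsilon> * t\<^sup>2 / 2) * norm_bessel \<alpha> (t * sqrt (?Q \<theta>))"
  have Q: "?Q \<theta> \<ge> 0" for \<theta>
  proof -
    have "?Q \<theta> = (x + y * cos \<theta>)\<^sup>2 + (y * sin \<theta>)\<^sup>2"
      using sin_cos_squared_add[of \<theta>] by algebra
    then show ?thesis by simp
  qed
  have [measurable]: "norm_bessel \<alpha> \<in> borel_measurable borel"
    by (rule measurable_norm_bessel[OF \<alpha>])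
  have int: "integrable (bessel_measure \<alpha> \<Otimes>\<^sub>M gegenbauer_measure \<alpha>) (\<lambda>(t, \<theta>). ?h t \<theta>)"
  proof (rule P.Fubini_integrable)
    have le: "norm (?h t \<theta>) \<le> exp (- \<epsilon> * t\<^sup>2 / 2)" for t \<theta>
      using abs_norm_bessel_le_1[OF \<alpha>] by (simp add: abs_mult)
    show *: "(\<lambda>(t, \<theta>). ?h t \<theta>) \<in> borel_measurable (bessel_measure \<alpha> \<Otimes>\<^sub>M gegenbauer_measure \<alpha>)"
      by measurable
    show "AE t in bessel_measure \<alpha>. integrable (gegenbauer_measure \<alpha>) (\<lambda>\<theta>. case (t, \<theta>) of (t, \<theta>) \<Rightarrow> ?h t \<theta>)"
      using le by (intro AE_I2 G.integrable_const_bound[where B = "exp (- \<epsilon> * _\<^sup>2 / 2)"]) auto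
    show "integrable (bessel_measure \<alpha>) (\<lambda>t. LINT \<theta>|gegenbauer_measure \<alpha>. norm (case (t, \<theta>) of (t, \<theta>) \<Rightarrow> ?h t \<theta>))"
    proof (rule Bochner_Integration.integrable_bound[OF integrable_gaussian_bessel_measure[OF \<alpha> \<epsilon>]])
      show "(\<lambda>t. LINT \<theta>|gegenbauer_measure \<alpha>. norm (case (t, \<theta>) of (t, \<theta>) \<Rightarrow> ?h t \<theta>)) \<in> borel_measurable (bessel_measure \<alpha>)"
        using * by measurable
      have "(LINT \<theta>|gegenbauer_measure \<alpha>. norm (?h t \<theta>)) \<le> (LINT \<theta>|gegenbauer_measure \<alpha>. exp (- \<epsilon> * t\<^sup>2 / 2))" for t
        using le by (intro integral_mono G.integrable_const_bound[where B = "exp (- \<epsilon> * t\<^sup>2 / 2)"]) auto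
      then show "AE t in bessel_measure \<alpha>. norm (LINT \<theta>|gegenbauer_measure \<alpha>. norm (case (t, \<theta>) of (t, \<theta>) \<Rightarrow> ?h t \<theta>))
          \<le> norm (exp (- \<epsilon> * t\<^sup>2 / 2))"
        using G.prob_space by simp
    qed
  qed
  have "(LINT t|bessel_measure \<alpha>. exp (- \<epsilon> * t\<^sup>2 / 2) * (norm_bessel \<alpha> (x * t) * norm_bessel \<alpha> (y * t))) =
     (LINT t|bessel_measure \<alpha>. (LINT \<theta>|gegenbauer_measure \<alpha>. ?h t \<theta>))"
    by (simp add: mult.commute[of x] mult.commute[of y] norm_bessel_product[OF \<alpha>])
  also have "\<dots> = (LINT \<theta>|gegenbauer_measure \<alpha>. (LINT t|bessel_measure \<alpha>. ?h t \<theta>))"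
    by (rule P.Fubini_integral[OF int, symmetric])
  also have "\<dots> = (LINT \<theta>|gegenbauer_measure \<alpha>. \<epsilon> powr - (\<alpha> + 1) * exp (- (x\<^sup>2 + y\<^sup>2) / (2 * \<epsilon>)) * exp (- (x * y / \<epsilon>) * cos \<theta>))"
  proof (intro Bochner_Integration.integral_cong refl)
    fix \<theta>
    have "(LINT t|bessel_measure \<alpha>. ?h t \<theta>) = (LINT t|bessel_measure \<alpha>. exp (- \<epsilon> * t\<^sup>2 / 2) * bessel_series \<alpha> (?Q \<theta> * t\<^sup>2))"
      using Q[of \<theta>] by (simp add: norm_bessel_eq[OF \<alpha>] power_mult_distrib mult.commute)
    also have "\<dots> = \<epsilon> powr - (\<alpha> + 1) * exp (- ?Q \<theta> / (2 * \<epsilon>))"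
      by (rule integral_bessel_gaussian[OF \<alpha> \<epsilon>])
    also have "- ?Q \<theta> / (2 * \<epsilon>) = - (x\<^sup>2 + y\<^sup>2) / (2 * \<epsilon>) + - (x * y / \<epsilon>) * cos \<theta>"
      using \<epsilon> by (simp add: field_simps)
    finally show "(LINT t|bessel_measure \<alpha>. ?h t \<theta>) = \<epsilon> powr - (\<alpha> + 1) * exp (- (x\<^sup>2 + y\<^sup>2) / (2 * \<epsilon>)) * exp (- (x * y / \<epsilon>) * cos \<theta>)"
      by (simp only: exp_add mult.assoc)
  qed
  also have "\<dots> = bessel_heat \<alpha> \<epsilon> x y"
    unfolding integral_mult_right_zero bessel_series_neg_eq_integral_exp[OF \<alpha>, symmetric] bessel_heat_def ..
  finally show ?thesis .
qed

section \<open>Gaussian integrals of characters\<close>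

lemma
  fixes f :: "'a::euclidean_space \<Rightarrow> real \<Rightarrow> complex"
  assumes int: "\<And>b. b \<in> Basis \<Longrightarrow> integrable lborel (f b)"
  shows integrable_lborel_prod: "integrable lborel (\<lambda>x. \<Prod>b\<in>Basis. f b (x \<bullet> b))" (is ?th1)
    and integral_lborel_prod: "(LINT x|lborel. (\<Prod>b\<in>Basis. f b (x \<bullet> b))) = (\<Prod>b\<in>Basis. LINT t|lborel. f b t)" (is ?th2)
proof -
  interpret product_sigma_finite "\<lambda>b::'a. lborel :: real measure" ..
  have [measurable]: "f b \<in> borel_measurable borel" if "b \<in> Basis" for b
    using borel_measurable_integrable[OF int[OF that]] by simp
  have m: "(\<lambda>x::'a. \<Prod>b\<in>Basis. f b (x \<bullet> b)) \<in> borel_measurable borel"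
    by (intro borel_measurable_prod) measurable
  let ?g = "\<lambda>h. \<Sum>b\<in>Basis. h b *\<^sub>R (b::'a)"
  have g: "?g \<in> (\<Pi>\<^sub>M b\<in>Basis. lborel) \<rightarrow>\<^sub>M borel" by measurable
  have eq: "(\<Prod>b\<in>Basis. f b (?g h \<bullet> b)) = (\<Prod>b\<in>Basis. f b (h b))" for h
    by (intro prod.cong refl) (simp add: inner_sum_left inner_Basis if_distrib sum.delta cong: if_cong)
  show ?th1
    unfolding lborel_eq[where 'a = 'a]
    by (subst integrable_distr_eq[OF g m], unfold eq) (intro product_integrable_prod int; simp)
  show ?th2
    unfolding lborel_eq[where 'a = 'a]
    by (subst integral_distr[OF g m], unfold eq) (intro product_integral_prod int; simp)
qed

text \<open>Rescaling by the root of \<epsilon> reduces the integral to the characteristic function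
  of the standard normal distribution at \<open>- z / sqrt \<epsilon>\<close>.\<close>

lemma
  fixes z \<epsilon> :: real
  assumes \<epsilon>: "\<epsilon> > 0"
  shows integrable_gaussian_char: "integrable lborel (\<lambda>u. complex_of_real (exp (- \<epsilon> * u\<^sup>2 / 2)) * exp (- \<i> * complex_of_real (z * u)))" (is ?th1)
    and integral_gaussian_char: "(LINT u|lborel. complex_of_real (exp (- \<epsilon> * u\<^sup>2 / 2)) * exp (- \<i> * complex_of_real (z * u))) =
        complex_of_real (sqrt (2 * pi / \<epsilon>) * exp (- z\<^sup>2 / (2 * \<epsilon>)))" (is ?th2)
proof -
  let ?f = "\<lambda>u. complex_of_real (exp (- \<epsilon> * u\<^sup>2 / 2)) * exp (- \<i> * complex_of_real (z * u))"
  let ?c = "1 / sqrt \<epsilon>" and ?t = "- z / sqrt \<epsilon>"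
  let ?g = "\<lambda>x. complex_of_real (std_normal_density x) * iexp (?t * x)"
  have g: "?f (0 + ?c * x) = complex_of_real (sqrt (2 * pi)) * ?g x" for x
  proof -
    have "- \<epsilon> * (0 + ?c * x)\<^sup>2 / 2 = - x\<^sup>2 / 2"
      using \<epsilon> by (simp add: power_divide power_mult_distrib)
    moreover have "z * (0 + ?c * x) = - (?t * x)" by simp
    ultimately show ?thesis
      by (simp add: std_normal_density_def real_sqrt_mult)
  qed
  have int_g: "integrable lborel ?g"
  proof (rule Bochner_Integration.integrable_bound[OF integrable_std_normal_moment[of 0]])
    show "?g \<in> borel_measurable lborel" by measurable
  qed (auto simp: norm_mult)
  have "integrable lborel (\<lambda>x. ?f (0 + ?c * x))"
    unfolding g by (intro integrable_mult_right int_g)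
  then show ?th1
    using \<epsilon> by (subst (asm) lborel_integrable_real_affine_iff) auto
  have "(LINT x|lborel. ?g x) = char std_normal_distribution ?t"
    unfolding char_def by (subst integral_density) (auto simp: scaleR_conv_of_real normal_density_nonneg)
  also have "\<dots> = complex_of_real (exp (- z\<^sup>2 / (2 * \<epsilon>)))"
    unfolding char_std_normal_distribution using \<epsilon> by (simp add: power_divide)
  finally have G: "(LINT x|lborel. ?g x) = complex_of_real (exp (- z\<^sup>2 / (2 * \<epsilon>)))" .
  have "(LINT u|lborel. ?f u) = \<bar>?c\<bar> *\<^sub>R (LINT x|lborel. ?f (0 + ?c * x))"
    using \<epsilon> by (intro lborel_integral_real_affine) auto
  also have "\<dots> = \<bar>?c\<bar> *\<^sub>R (complex_of_real (sqrt (2 * pi)) * complex_of_real (exp (- z\<^sup>2 / (2 * \<epsilon>))))"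
    unfolding g integral_mult_right_zero G ..
  finally show ?th2
    using \<epsilon> by (simp add: scaleR_conv_of_real real_sqrt_divide)
qed

text \<open>This normalization makes the Fourier transform unitary; its product with
  \<open>bessel_measure\<close> carries exactly the constant of the Weinstein measure.\<close>

definition fourier_measure :: "'a::euclidean_space measure" where
  "fourier_measure = density lborel (\<lambda>_. ennreal ((2 * pi) powr - (real DIM('a) / 2)))"

lemma sets_fourier_measure [measurable_cong, simp]: "sets fourier_measure = sets borel"
  by (simp add: fourier_measure_def)

lemma space_fourier_measure [simp]: "space fourier_measure = UNIV"
  by (simp add: fourier_measure_def)

lemma sigma_finite_fourier_measure: "sigma_finite_measure (fourier_measure :: 'a::euclidean_space measure)"
  unfolding fourier_measure_def
  by (subst sigma_finite_measure.sigma_finite_iff_density_finite[OF sigma_finite_lborel]) auto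

lemma
  fixes z :: "'a::euclidean_space"
  assumes \<epsilon>: "\<epsilon> > 0"
  shows integrable_fourier_gaussian: "integrable fourier_measure
        (\<lambda>l. complex_of_real (exp (- \<epsilon> * (norm l)\<^sup>2 / 2)) * exp (- \<i> * complex_of_real (z \<bullet> l)))" (is ?th1)
    and integral_fourier_gaussian: "(LINT l|fourier_measure.
        complex_of_real (exp (- \<epsilon> * (norm l)\<^sup>2 / 2)) * exp (- \<i> * complex_of_real (z \<bullet> l))) =
        complex_of_real (\<epsilon> powr - (real DIM('a) / 2) * exp (- (norm z)\<^sup>2 / (2 * \<epsilon>)))" (is ?th2)
proof -
  let ?f = "\<lambda>l. complex_of_real (exp (- \<epsilon> * (norm l)\<^sup>2 / 2)) * exp (- \<i> * complex_of_real (z \<bullet> l))"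
  let ?h = "\<lambda>b u. complex_of_real (exp (- \<epsilon> * u\<^sup>2 / 2)) * exp (- \<i> * complex_of_real ((z \<bullet> b) * u))"
  have nsq: "(norm l)\<^sup>2 = (\<Sum>b\<in>Basis. (l \<bullet> b)\<^sup>2)" for l :: 'a
    unfolding power2_norm_eq_inner euclidean_inner[of l l] by (simp only: power2_eq_square)
  have f: "?f l = (\<Prod>b\<in>Basis. ?h b (l \<bullet> b))" for l
  proof -
    have "- \<epsilon> * (norm l)\<^sup>2 / 2 = (\<Sum>b\<in>Basis. - \<epsilon> * (l \<bullet> b)\<^sup>2 / 2)"
      unfolding nsq by (simp add: sum_distrib_left sum_divide_distrib sum_negf)
    then have 1: "complex_of_real (exp (- \<epsilon> * (norm l)\<^sup>2 / 2)) = (\<Prod>b\<in>Basis. complex_of_real (exp (- \<epsilon> * (l \<bullet> b)\<^sup>2 / 2)))"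
      by (simp only: exp_sum finite_Basis of_real_prod)
    have "- \<i> * complex_of_real (z \<bullet> l) = (\<Sum>b\<in>Basis. - \<i> * complex_of_real ((z \<bullet> b) * (l \<bullet> b)))"
      unfolding euclidean_inner[of z l] by (simp add: sum_distrib_left sum_negf)
    then have 2: "exp (- \<i> * complex_of_real (z \<bullet> l)) = (\<Prod>b\<in>Basis. exp (- \<i> * complex_of_real ((z \<bullet> b) * (l \<bullet> b))))"
      by (simp only: exp_sum finite_Basis)
    show ?thesis unfolding 1 2 by (simp only: prod.distrib)
  qed
  have int: "integrable lborel ?f"
    unfolding f by (intro integrable_lborel_prod integrable_gaussian_char \<epsilon>)
  have I: "(LINT l|lborel. ?f l) = complex_of_real ((2 * pi / \<epsilon>) powr (real DIM('a) / 2) * exp (- (norm z)\<^sup>2 / (2 * \<epsilon>)))"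
  proof -
    have "(LINT l|lborel. ?f l) = (\<Prod>b\<in>(Basis :: 'a set). complex_of_real (sqrt (2 * pi / \<epsilon>) * exp (- (z \<bullet> b)\<^sup>2 / (2 * \<epsilon>))))"
      unfolding f by (simp only: integral_lborel_prod[OF integrable_gaussian_char[OF \<epsilon>]] integral_gaussian_char[OF \<epsilon>])
    also have "\<dots> = complex_of_real ((\<Prod>b\<in>(Basis :: 'a set). sqrt (2 * pi / \<epsilon>)) * (\<Prod>b\<in>Basis. exp (- (z \<bullet> b)\<^sup>2 / (2 * \<epsilon>))))"
      by (simp only: prod.distrib of_real_prod of_real_mult)
    also have "(\<Prod>b\<in>(Basis :: 'a set). sqrt (2 * pi / \<epsilon>)) = (2 * pi / \<epsilon>) powr (real DIM('a) / 2)"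
    proof -
      have "(\<Prod>b\<in>(Basis :: 'a set). sqrt (2 * pi / \<epsilon>)) = ((2 * pi / \<epsilon>) powr (1 / 2)) powr real DIM('a)"
        using \<epsilon> by (simp add: powr_realpow powr_half_sqrt)
      then show ?thesis by (simp add: powr_powr)
    qed
    also have "(\<Prod>b\<in>(Basis :: 'a set). exp (- (z \<bullet> b)\<^sup>2 / (2 * \<epsilon>))) = exp (- (norm z)\<^sup>2 / (2 * \<epsilon>))"
      unfolding nsq by (simp add: sum_negf sum_divide_distrib flip: exp_sum)
    finally show ?thesis .
  qed
  have [measurable]: "?f \<in> borel_measurable borel"
    using borel_measurable_integrable[OF int] by simp
  show ?th1
    unfolding fourier_measure_def using int by (subst integrable_density) auto
  have "(LINT l|fourier_measure. ?f l) = (LINT l|lborel. (2 * pi) powr - (real DIM('a) / 2) *\<^sub>R ?f l)"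
    unfolding fourier_measure_def by (subst integral_density) auto
  also have "\<dots> = (2 * pi) powr - (real DIM('a) / 2) *\<^sub>R (LINT l|lborel. ?f l)"
    by (rule integral_scaleR_right)
  also have "\<dots> = complex_of_real ((2 * pi) powr - (real DIM('a) / 2) * (2 * pi / \<epsilon>) powr (real DIM('a) / 2) * exp (- (norm z)\<^sup>2 / (2 * \<epsilon>)))"
    unfolding I by (simp add: scaleR_conv_of_real)
  also have "(2 * pi) powr - (real DIM('a) / 2) * (2 * pi / \<epsilon>) powr (real DIM('a) / 2) = \<epsilon> powr - (real DIM('a) / 2)"
    using \<epsilon> by (simp add: powr_divide powr_minus field_simps)
  finally show ?th2 .
qed

lemma
  assumes \<epsilon>: "\<epsilon> > 0"
  shows integrable_fourier_gaussian_real: "integrable (fourier_measure :: 'a::euclidean_space measure) (\<lambda>l. exp (- \<epsilon> * (norm l)\<^sup>2 / 2))"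
    and integral_fourier_gaussian_real: "(LINT l|(fourier_measure :: 'a measure). exp (- \<epsilon> * (norm l)\<^sup>2 / 2)) = \<epsilon> powr - (real DIM('a) / 2)"
proof -
  show "integrable (fourier_measure :: 'a::euclidean_space measure) (\<lambda>l. exp (- \<epsilon> * (norm l)\<^sup>2 / 2))"
    using integrable_Re[OF integrable_fourier_gaussian[OF \<epsilon>, of "0 :: 'a"]] by simp
  have "complex_of_real (LINT l|(fourier_measure :: 'a measure). exp (- \<epsilon> * (norm l)\<^sup>2 / 2)) = complex_of_real (\<epsilon> powr - (real DIM('a) / 2))"
    unfolding integral_complex_of_real[symmetric] using integral_fourier_gaussian[OF \<epsilon>, of "0 :: 'a"] by simp
  then show "(LINT l|(fourier_measure :: 'a measure). exp (- \<epsilon> * (norm l)\<^sup>2 / 2)) = \<epsilon> powr - (real DIM('a) / 2)"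
    by (simp only: of_real_eq_iff)
qed

definition fourier_heat :: "real \<Rightarrow> 'a::euclidean_space \<Rightarrow> 'a \<Rightarrow> real" where
  "fourier_heat \<epsilon> x y = \<epsilon> powr - (real DIM('a) / 2) * exp (- (norm (x - y))\<^sup>2 / (2 * \<epsilon>))"

lemma fourier_heat_nonneg: "0 \<le> fourier_heat \<epsilon> x y"
  by (simp add: fourier_heat_def)

text \<open>Translation invariance moves x to the origin, where the integrand is a Gaussian with
  parameter \<open>s + 1 / \<epsilon>\<close>. The test Gaussian can therefore be centred at x,
  unlike the one in \<open>integral_bessel_heat\<close>.\<close>

lemma
  fixes x :: "'a::euclidean_space"
  assumes \<epsilon>: "\<epsilon> > 0" and s: "s \<ge> 0"
  shows integrable_fourier_heat: "integrable fourier_measure (\<lambda>y. exp (- s * (norm (y - x))\<^sup>2 / 2) * fourier_heat \<epsilon> x y)" (is ?th1)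
    and integral_fourier_heat: "(LINT y|fourier_measure. exp (- s * (norm (y - x))\<^sup>2 / 2) * fourier_heat \<epsilon> x y) =
      (1 + s * \<epsilon>) powr - (real DIM('a) / 2)" (is ?th2)
proof -
  let ?p = "s + 1 / \<epsilon>" and ?C = "\<epsilon> powr - (real DIM('a) / 2)"
  let ?g = "\<lambda>v::'a. ?C * exp (- ?p * (norm v)\<^sup>2 / 2)"
  have p: "?p > 0" using \<epsilon> s by (simp add: add_nonneg_pos)
  have eq: "exp (- s * (norm (y - x))\<^sup>2 / 2) * fourier_heat \<epsilon> x y = ?g (y - x)" for y
  proof -
    have "- s * (norm (y - x))\<^sup>2 / 2 + - (norm (y - x))\<^sup>2 / (2 * \<epsilon>) = - ?p * (norm (y - x))\<^sup>2 / 2"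
      using \<epsilon> by (simp add: field_simps)
    then have "exp (- s * (norm (y - x))\<^sup>2 / 2) * exp (- (norm (y - x))\<^sup>2 / (2 * \<epsilon>)) = exp (- ?p * (norm (y - x))\<^sup>2 / 2)"
      by (simp only: exp_add[symmetric])
    then show ?thesis
      unfolding fourier_heat_def norm_minus_commute[of x y] by (simp only: mult.left_commute)
  qed
  have T: "(fourier_measure :: 'a measure) = distr fourier_measure borel (\<lambda>v. x + v)"
  proof -
    have "distr fourier_measure borel (\<lambda>v. x + v) = density (distr lborel borel (\<lambda>v. x + v)) (\<lambda>_. ennreal ((2 * pi) powr - (real DIM('a) / 2)))"
      unfolding fourier_measure_def by (subst density_distr) auto
    also have "distr lborel borel (\<lambda>v. x + v) = lborel" by (rule lborel_distr_plus)
    finally show ?thesis by (simp add: fourier_measure_def)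
  qed
  have m: "(\<lambda>y. ?g (y - x)) \<in> borel_measurable borel" by measurable
  have a: "(\<lambda>v. x + v) \<in> fourier_measure \<rightarrow>\<^sub>M borel" by measurable
  show ?th1
    unfolding eq by (subst T, subst integrable_distr_eq[OF a m]) (simp add: integrable_fourier_gaussian_real[OF p, simplified])
  have "(LINT y|fourier_measure. exp (- s * (norm (y - x))\<^sup>2 / 2) * fourier_heat \<epsilon> x y) = (LINT v|fourier_measure. ?g v)"
    unfolding eq by (subst T, subst integral_distr[OF a m]) simp
  also have "\<dots> = ?C * ?p powr - (real DIM('a) / 2)"
    unfolding integral_mult_right_zero integral_fourier_gaussian_real[OF p] ..
  also have "\<dots> = (1 + s * \<epsilon>) powr - (real DIM('a) / 2)"
    using \<epsilon> p by (simp add: distrib_left mult.commute add.commute flip: powr_mult)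
  finally show ?th2 .
qed

section \<open>Square-integrable functions\<close>

lemma borel_measurable_cnj' [measurable (raw)]:
  "f \<in> borel_measurable M \<Longrightarrow> (\<lambda>x. cnj (f x)) \<in> borel_measurable M"
  by (rule measurable_compose[OF _ borel_measurable_continuous_onI]) (auto intro!: continuous_intros)

lemma norm_integral_le:
  fixes f :: "'a \<Rightarrow> 'b :: {banach, second_countable_topology}"
  assumes "integrable M f" "integrable M g" "\<And>x. x \<in> space M \<Longrightarrow> norm (f x) \<le> g x"
  shows "norm (LINT x|M. f x) \<le> (LINT x|M. g x)"
proof -
  have "norm (LINT x|M. f x) \<le> (LINT x|M. norm (f x))"
    by (rule integral_norm_bound)
  also have "\<dots> \<le> (LINT x|M. g x)"
    by (intro integral_mono integrable_norm assms)
  finally show ?thesis .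
qed

lemma L2_norm_sq_cong_AE:
  assumes "AE x in M. f x = g x"
  shows "L2_norm_sq M f = L2_norm_sq M g"
  unfolding L2_norm_sq_def by (rule nn_integral_cong_AE) (use assms in eventually_elim, simp)

lemma L2_norm_sq_cong:
  assumes "\<And>x. x \<in> space M \<Longrightarrow> f x = g x"
  shows "L2_norm_sq M f = L2_norm_sq M g"
  using assms by (intro L2_norm_sq_cong_AE AE_I2)

lemma L2_norm_sq_minus_commute: "L2_norm_sq M (\<lambda>x. f x - g x) = L2_norm_sq M (\<lambda>x. g x - f x)"
  by (simp add: L2_norm_sq_def norm_minus_commute)

lemma L2_I:
  "f \<in> borel_measurable M \<Longrightarrow> L2_norm_sq M f < \<infinity> \<Longrightarrow> f \<in> L2 M"
  by (simp add: L2_def)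

lemma L2_measurable: "f \<in> L2 M \<Longrightarrow> f \<in> borel_measurable M"
  and L2_finite: "f \<in> L2 M \<Longrightarrow> L2_norm_sq M f < \<infinity>"
  by (auto simp: L2_def)

lemma L2_integrable_square: "f \<in> L2 M \<Longrightarrow> integrable M (\<lambda>x. (cmod (f x))\<^sup>2)"
  unfolding L2_def L2_norm_sq_def by (auto intro!: integrableI_nonneg)

lemma L2_norm_sq_eq_integral: "f \<in> L2 M \<Longrightarrow> L2_norm_sq M f = ennreal (LINT x|M. (cmod (f x))\<^sup>2)"
  unfolding L2_norm_sq_def by (intro nn_integral_eq_integral L2_integrable_square) auto

lemma L2_iff_integrable_square:
  "f \<in> L2 M \<longleftrightarrow> f \<in> borel_measurable M \<and> integrable M (\<lambda>x. (cmod (f x))\<^sup>2)"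
proof
  assume "f \<in> borel_measurable M \<and> integrable M (\<lambda>x. (cmod (f x))\<^sup>2)"
  then show "f \<in> L2 M"
    by (intro L2_I) (auto simp: L2_norm_sq_def nn_integral_eq_integral)
qed (auto intro: L2_integrable_square L2_measurable)

lemma L2_norm_sq_add_le:
  assumes [measurable]: "f \<in> borel_measurable M" "g \<in> borel_measurable M"
  shows "L2_norm_sq M (\<lambda>x. f x + g x) \<le> 2 * L2_norm_sq M f + 2 * L2_norm_sq M g"
proof -
  have "L2_norm_sq M (\<lambda>x. f x + g x) \<le> (\<integral>\<^sup>+ x. 2 * ennreal ((cmod (f x))\<^sup>2) + 2 * ennreal ((cmod (g x))\<^sup>2) \<partial>M)"
    unfolding L2_norm_sq_def
  proof (intro nn_integral_mono)
    fix x
    have "(cmod (f x + g x))\<^sup>2 \<le> (cmod (f x) + cmod (g x))\<^sup>2"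
      by (intro power_mono norm_triangle_ineq) auto
    also have "\<dots> \<le> 2 * (cmod (f x))\<^sup>2 + 2 * (cmod (g x))\<^sup>2"
      using sum_squares_bound[of "cmod (f x)" "cmod (g x)"] by (simp add: power2_sum)
    finally have "ennreal ((cmod (f x + g x))\<^sup>2) \<le> ennreal (2 * (cmod (f x))\<^sup>2 + 2 * (cmod (g x))\<^sup>2)"
      by (rule ennreal_leI)
    then show "ennreal ((cmod (f x + g x))\<^sup>2) \<le> 2 * ennreal ((cmod (f x))\<^sup>2) + 2 * ennreal ((cmod (g x))\<^sup>2)"
      by (simp add: ennreal_mult')
  qed
  also have "\<dots> = 2 * L2_norm_sq M f + 2 * L2_norm_sq M g"
    unfolding L2_norm_sq_def by (subst nn_integral_add) (auto simp: nn_integral_cmult)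
  finally show ?thesis .
qed

lemma L2_norm_sq_cmult:
  assumes [measurable]: "f \<in> borel_measurable M"
  shows "L2_norm_sq M (\<lambda>x. c * f x) = ennreal ((cmod c)\<^sup>2) * L2_norm_sq M f"
  unfolding L2_norm_sq_def
  by (subst nn_integral_cmult[symmetric]) (auto simp: norm_mult power_mult_distrib ennreal_mult')

lemma L2_cmult: "f \<in> L2 M \<Longrightarrow> (\<lambda>x. c * f x) \<in> L2 M"
  by (auto simp: L2_def L2_norm_sq_cmult ennreal_mult_less_top)

lemma L2_add:
  assumes "f \<in> L2 M" "g \<in> L2 M"
  shows "(\<lambda>x. f x + g x) \<in> L2 M"
proof (rule L2_I)
  have "L2_norm_sq M (\<lambda>x. f x + g x) \<le> 2 * L2_norm_sq M f + 2 * L2_norm_sq M g"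
    using assms by (intro L2_norm_sq_add_le L2_measurable)
  also have "\<dots> < \<infinity>"
    using assms[THEN L2_finite] by (simp add: ennreal_mult_less_top)
  finally show "L2_norm_sq M (\<lambda>x. f x + g x) < \<infinity>" .
  show "(\<lambda>x. f x + g x) \<in> borel_measurable M"
    using assms[THEN L2_measurable] by auto
qed

lemma L2_diff: "f \<in> L2 M \<Longrightarrow> g \<in> L2 M \<Longrightarrow> (\<lambda>x. f x - g x) \<in> L2 M"
  using L2_add[of f M "\<lambda>x. (-1) * g x"] L2_cmult[of g M "-1"] by simp

lemma L2_cnj: "f \<in> L2 M \<Longrightarrow> (\<lambda>x. cnj (f x)) \<in> L2 M"
  by (auto simp: L2_def L2_norm_sq_def)

lemma L2_mult_integrable:
  assumes "f \<in> L2 M" "g \<in> L2 M"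
  shows "integrable M (\<lambda>x. f x * g x)"
proof (rule Bochner_Integration.integrable_bound)
  show "integrable M (\<lambda>x. (cmod (f x))\<^sup>2 + (cmod (g x))\<^sup>2)"
    using assms by (intro Bochner_Integration.integrable_add L2_integrable_square)
  show "(\<lambda>x. f x * g x) \<in> borel_measurable M"
    using assms[THEN L2_measurable] by auto
  have "a * b \<le> a\<^sup>2 + b\<^sup>2" if "a \<ge> 0" "b \<ge> 0" for a b :: real
    using sum_squares_bound[of a b] mult_nonneg_nonneg[OF that] by linarith
  then show "AE x in M. norm (f x * g x) \<le> norm ((cmod (f x))\<^sup>2 + (cmod (g x))\<^sup>2)"
    by (auto simp: norm_mult)
qed

text \<open>Pointwise, the difference of the squared moduli is at most |u - f|^2 + 2 |f| |u - f|;
  Cauchy-Schwarz controls the integral of the mixed term.\<close>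

lemma L2_norm_sq_tendsto:
  assumes u: "\<And>n. u n \<in> L2 M" and f: "f \<in> L2 M"
    and lim: "(\<lambda>n. L2_norm_sq M (\<lambda>x. u n x - f x)) \<longlonglongrightarrow> 0"
  shows "(\<lambda>n. L2_norm_sq M (u n)) \<longlonglongrightarrow> L2_norm_sq M f"
proof -
  let ?I = "\<lambda>g. LINT x|M. (cmod (g x))\<^sup>2"
  define e where "e n = ?I (\<lambda>x. u n x - f x)" for n
  have d: "(\<lambda>x. u n x - f x) \<in> L2 M" for n
    by (intro L2_diff u f)
  have [measurable]: "u n \<in> borel_measurable M" "f \<in> borel_measurable M" for n
    using u f by (auto intro: L2_measurable)
  have e0: "e n \<ge> 0" for n
    by (simp add: e_def)
  have e: "e \<longlonglongrightarrow> 0"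
    using lim unfolding L2_norm_sq_eq_integral[OF d] e_def[symmetric]
    using e0 by (simp add: ennreal_tendsto_0_iff)
  have cs: "(LINT x|M. cmod (f x) * cmod (u n x - f x)) \<le> sqrt (?I f) * sqrt (e n)" for n
  proof -
    let ?J = "LINT x|M. cmod (f x) * cmod (u n x - f x)"
    have int: "integrable M (\<lambda>x. cmod (f x) * cmod (u n x - f x))"
      using integrable_norm[OF L2_mult_integrable[OF f d[of n]]] by (simp add: norm_mult)
    have J0: "?J \<ge> 0" by simp
    have "(\<integral>\<^sup>+ x. ennreal (cmod (f x)) * ennreal (cmod (u n x - f x)) \<partial>M) = ennreal ?J"
      using int by (simp flip: ennreal_mult' add: nn_integral_eq_integral)
    then have "(ennreal ?J)\<^sup>2 \<le> (\<integral>\<^sup>+ x. (ennreal (cmod (f x)))\<^sup>2 \<partial>M) * (\<integral>\<^sup>+ x. (ennreal (cmod (u n x - f x)))\<^sup>2 \<partial>M)"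
      using Cauchy_Schwarz_nn_integral[of "\<lambda>x. ennreal (cmod (f x))" M "\<lambda>x. ennreal (cmod (u n x - f x))"] by simp
    also have "\<dots> = L2_norm_sq M f * L2_norm_sq M (\<lambda>x. u n x - f x)"
      by (simp add: L2_norm_sq_def ennreal_power)
    also have "\<dots> = ennreal (?I f * e n)"
      unfolding L2_norm_sq_eq_integral[OF f] L2_norm_sq_eq_integral[OF d] e_def by (simp add: ennreal_mult)
    finally have "?J\<^sup>2 \<le> ?I f * e n"
      using J0 e0[of n] by (simp add: ennreal_power)
    then have "?J \<le> sqrt (?I f * e n)"
      by (rule real_le_rsqrt)
    then show ?thesis
      by (simp add: real_sqrt_mult)
  qed
  have "\<bar>?I (u n) - ?I f\<bar> \<le> e n + 2 * (sqrt (?I f) * sqrt (e n))" for n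
  proof -
    have int: "integrable M (\<lambda>x. cmod (f x) * cmod (u n x - f x))"
      using integrable_norm[OF L2_mult_integrable[OF f d[of n]]] by (simp add: norm_mult)
    have "?I (u n) - ?I f = (LINT x|M. (cmod (u n x))\<^sup>2 - (cmod (f x))\<^sup>2)"
      by (rule Bochner_Integration.integral_diff[symmetric]) (intro L2_integrable_square u f)+
    also have "\<bar>\<dots>\<bar> \<le> (LINT x|M. \<bar>(cmod (u n x))\<^sup>2 - (cmod (f x))\<^sup>2\<bar>)"
      by (rule integral_abs_bound)
    also have "\<dots> \<le> (LINT x|M. (cmod (u n x - f x))\<^sup>2 + 2 * (cmod (f x) * cmod (u n x - f x)))"
    proof (rule integral_mono)
      show "integrable M (\<lambda>x. \<bar>(cmod (u n x))\<^sup>2 - (cmod (f x))\<^sup>2\<bar>)"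
        by (intro integrable_abs Bochner_Integration.integrable_diff L2_integrable_square u f)
      show "integrable M (\<lambda>x. (cmod (u n x - f x))\<^sup>2 + 2 * (cmod (f x) * cmod (u n x - f x)))"
        by (intro Bochner_Integration.integrable_add L2_integrable_square d integrable_mult_right int)
      fix x
      let ?a = "cmod (u n x)" and ?b = "cmod (f x)" and ?c = "cmod (u n x - f x)"
      have 1: "\<bar>?a - ?b\<bar> \<le> ?c" by (rule norm_triangle_ineq3)
      have 2: "?a + ?b \<le> ?c + 2 * ?b" using 1 by linarith
      have "\<bar>?a\<^sup>2 - ?b\<^sup>2\<bar> = \<bar>?a - ?b\<bar> * (?a + ?b)"
        by (simp add: power2_eq_square square_diff_square_factored abs_mult)
      also have "\<dots> \<le> ?c * (?c + 2 * ?b)"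
        using 1 2 by (intro mult_mono) auto
      finally show "\<bar>?a\<^sup>2 - ?b\<^sup>2\<bar> \<le> ?c\<^sup>2 + 2 * (?b * ?c)"
        by (simp add: power2_eq_square algebra_simps)
    qed
    also have "\<dots> = e n + 2 * (LINT x|M. cmod (f x) * cmod (u n x - f x))"
      unfolding e_def using L2_integrable_square[OF d[of n]] int by simp
    finally show ?thesis using cs[of n] by linarith
  qed
  then have "\<forall>\<^sub>F n in sequentially. norm (?I (u n) - ?I f) \<le> e n + 2 * (sqrt (?I f) * sqrt (e n))"
    by simp
  moreover have "(\<lambda>n. e n + 2 * (sqrt (?I f) * sqrt (e n))) \<longlonglongrightarrow> 0"
    by (rule tendsto_eq_intros e refl | simp)+
  ultimately have "(\<lambda>n. ?I (u n) - ?I f) \<longlonglongrightarrow> 0"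
    by (rule Lim_null_comparison)
  then have "(\<lambda>n. ?I (u n)) \<longlonglongrightarrow> ?I f"
    by (simp add: LIM_zero_iff)
  then show ?thesis
    unfolding L2_norm_sq_eq_integral[OF u] L2_norm_sq_eq_integral[OF f] by (rule tendsto_ennrealI)
qed

lemma L2_norm_sq_add_expand:
  assumes f: "f \<in> L2 M" and g: "g \<in> L2 M"
  shows "(LINT x|M. (cmod (f x + g x))\<^sup>2) =
    (LINT x|M. (cmod (f x))\<^sup>2) + (LINT x|M. (cmod (g x))\<^sup>2) + 2 * Re (LINT x|M. f x * cnj (g x))"
proof -
  have int: "integrable M (\<lambda>x. f x * cnj (g x))"
    by (intro L2_mult_integrable L2_cnj f g)
  have "(cmod (a + b))\<^sup>2 = (cmod a)\<^sup>2 + (cmod b)\<^sup>2 + 2 * Re (a * cnj b)" for a b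
    by (simp only: cmod_power2) (simp add: power2_eq_square algebra_simps)
  then have "(LINT x|M. (cmod (f x + g x))\<^sup>2) =
    (LINT x|M. (cmod (f x))\<^sup>2 + (cmod (g x))\<^sup>2 + 2 * Re (f x * cnj (g x)))"
    by (simp only:)
  also have "\<dots> = (LINT x|M. (cmod (f x))\<^sup>2) + (LINT x|M. (cmod (g x))\<^sup>2) + (LINT x|M. 2 * Re (f x * cnj (g x)))"
    using int L2_integrable_square[OF f] L2_integrable_square[OF g]
    by (subst Bochner_Integration.integral_add; (intro Bochner_Integration.integrable_add integrable_mult_right integrable_Re)?)+ auto
  also have "(LINT x|M. 2 * Re (f x * cnj (g x))) = 2 * Re (LINT x|M. f x * cnj (g x))"
    by (simp only: integral_mult_right_zero integral_Re[OF int])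
  finally show ?thesis .
qed

text \<open>Polarization: c = 1 gives the real parts of the inner products and c = \<i> the
  imaginary parts.\<close>

lemma L2_inner_eqI:
  assumes L2: "f \<in> L2 M" "g \<in> L2 M" "f' \<in> L2 N" "g' \<in> L2 N"
    and f: "L2_norm_sq M f = L2_norm_sq N f'" and g: "L2_norm_sq M g = L2_norm_sq N g'"
    and fg: "\<And>c. L2_norm_sq M (\<lambda>x. f x + c * g x) = L2_norm_sq N (\<lambda>x. f' x + c * g' x)"
  shows "(LINT x|M. f x * cnj (g x)) = (LINT x|N. f' x * cnj (g' x))"
proof -
  have nn: "ennreal a = ennreal b \<Longrightarrow> a \<ge> 0 \<Longrightarrow> b \<ge> 0 \<Longrightarrow> a = b" for a b
    by simp
  have eq: "(LINT x|M. (cmod (u x))\<^sup>2) = (LINT x|N. (cmod (v x))\<^sup>2)"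
    if "L2_norm_sq M u = L2_norm_sq N v" "u \<in> L2 M" "v \<in> L2 N" for u v
    using that by (intro nn) (auto simp: L2_norm_sq_eq_integral)
  have Re: "Re (LINT x|M. f x * cnj (c * g x)) = Re (LINT x|N. f' x * cnj (c * g' x))" for c
  proof -
    have cg: "(\<lambda>x. c * g x) \<in> L2 M" "(\<lambda>x. c * g' x) \<in> L2 N"
      by (intro L2_cmult L2)+
    have "L2_norm_sq M (\<lambda>x. c * g x) = L2_norm_sq N (\<lambda>x. c * g' x)"
      using g L2 by (simp add: L2_norm_sq_cmult L2_measurable)
    then show ?thesis
      using L2_norm_sq_add_expand[OF L2(1) cg(1)] L2_norm_sq_add_expand[OF L2(3) cg(2)]
        eq[OF fg[of c] L2_add[OF L2(1) cg(1)] L2_add[OF L2(3) cg(2)]] eq[OF f L2(1,3)] eq[OF _ cg]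
      by simp
  qed
  have "(LINT x|M. f x * cnj (\<i> * g x)) = - \<i> * (LINT x|M. f x * cnj (g x))"
    "(LINT x|N. f' x * cnj (\<i> * g' x)) = - \<i> * (LINT x|N. f' x * cnj (g' x))"
    by (simp_all add: mult.left_commute flip: integral_mult_right_zero)
  then show ?thesis
    using Re[of 1] Re[of \<i>] by (simp add: complex_eq_iff)
qed

text \<open>Riesz-Fischer: a rapidly Cauchy subsequence converges almost everywhere, and Fatou's
  lemma turns the pointwise limit into an L2 limit of the whole sequence.\<close>

lemma L2_complete:
  assumes v: "\<And>n. v n \<in> L2 M"
    and Cauchy: "\<And>e. e > 0 \<Longrightarrow> \<exists>N. \<forall>m\<ge>N. \<forall>n\<ge>N. L2_norm_sq M (\<lambda>x. v m x - v n x) \<le> ennreal e"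
  shows "\<exists>g\<in>L2 M. (\<lambda>n. L2_norm_sq M (\<lambda>x. v n x - g x)) \<longlonglongrightarrow> 0"
proof -
  have [measurable]: "v n \<in> borel_measurable M" for n
    by (rule L2_measurable[OF v])
  obtain N where N: "\<And>k m n. m \<ge> N k \<Longrightarrow> n \<ge> N k \<Longrightarrow> L2_norm_sq M (\<lambda>x. v m x - v n x) \<le> ennreal ((1 / 4) ^ k)"
  proof -
    have "\<exists>N. \<forall>m\<ge>N. \<forall>n\<ge>N. L2_norm_sq M (\<lambda>x. v m x - v n x) \<le> ennreal ((1 / 4) ^ k)" for k
      by (rule Cauchy) simp
    then have "\<exists>N. \<forall>k. \<forall>m\<ge>N k. \<forall>n\<ge>N k. L2_norm_sq M (\<lambda>x. v m x - v n x) \<le> ennreal ((1 / 4) ^ k)"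
      by (intro choice allI)
    then show thesis using that by blast
  qed
  \<comment> \<open>A cumulative sum dominates \<open>N k\<close> at every later index, which makes
    all the thresholds passed so far available at once.\<close>
  define r where "r k = (\<Sum>j\<le>k. N j)" for k
  have rN: "r l \<ge> N k" if "l \<ge> k" for k l
    using that unfolding r_def by (intro member_le_sum) auto
  define d where "d k x = v (r (Suc k)) x - v (r k) x" for k x
  have [measurable]: "d k \<in> borel_measurable M" for k
    unfolding d_def[abs_def] by measurable
  \<comment> \<open>The weight 2^k is affordable because the squared gaps are at most 4^(-k); it
    yields summability of the increments themselves in the next step.\<close>
  have "(\<integral>\<^sup>+ x. (\<Sum>k. ennreal (2 ^ k * (cmod (d k x))\<^sup>2)) \<partial>M) = (\<Sum>k. \<integral>\<^sup>+ x. ennreal (2 ^ k * (cmod (d k x))\<^sup>2) \<partial>M)"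
    by (rule nn_integral_suminf) measurable
  also have "\<dots> \<le> (\<Sum>k. ennreal ((1 / 2) ^ k))"
  proof (intro suminf_le summableI)
    fix k
    have "(\<integral>\<^sup>+ x. ennreal (2 ^ k * (cmod (d k x))\<^sup>2) \<partial>M) = ennreal (2 ^ k) * L2_norm_sq M (d k)"
      unfolding L2_norm_sq_def by (subst nn_integral_cmult[symmetric]) (auto simp: ennreal_mult')
    also have "\<dots> \<le> ennreal (2 ^ k) * ennreal ((1 / 4) ^ k)"
      unfolding d_def[abs_def] by (intro mult_left_mono N rN) auto
    also have "\<dots> = ennreal ((1 / 2) ^ k)"
      by (simp flip: ennreal_mult' power_mult_distrib)
    finally show "(\<integral>\<^sup>+ x. ennreal (2 ^ k * (cmod (d k x))\<^sup>2) \<partial>M) \<le> ennreal ((1 / 2) ^ k)" .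
  qed
  also have "\<dots> = ennreal (\<Sum>k. (1 / 2) ^ k)"
    by (intro suminf_ennreal2) auto
  also have "\<dots> < \<infinity>" by simp
  finally have "(\<integral>\<^sup>+ x. (\<Sum>k. ennreal (2 ^ k * (cmod (d k x))\<^sup>2)) \<partial>M) \<noteq> \<infinity>" by simp
  then have "AE x in M. (\<Sum>k. ennreal (2 ^ k * (cmod (d k x))\<^sup>2)) \<noteq> \<infinity>"
    by (intro nn_integral_PInf_AE) measurable
  then have conv: "AE x in M. convergent (\<lambda>k. v (r k) x)"
  proof eventually_elim
    case (elim x)
    have s: "summable (\<lambda>k. 2 ^ k * (cmod (d k x))\<^sup>2)"
      using elim by (intro summable_suminf_not_top) auto
    have "summable (\<lambda>k. cmod (d k x))"
    proof (rule summable_comparison_test')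
      show "summable (\<lambda>k. 2 ^ k * (cmod (d k x))\<^sup>2 + (1 / 2) ^ k)"
        by (intro summable_add s summable_geometric) auto
      fix k
      \<comment> \<open>The arithmetic-geometric inequality, with the weight 2^k on the increment
        balanced by 2^(-k) on the constant.\<close>
      have "2 * (sqrt (2 ^ k) * cmod (d k x)) * sqrt ((1 / 2) ^ k) \<le> (sqrt (2 ^ k) * cmod (d k x))\<^sup>2 + (sqrt ((1 / 2) ^ k))\<^sup>2"
        by (rule sum_squares_bound)
      moreover have "sqrt (2 ^ k) * sqrt ((1 / 2) ^ k) = 1"
        by (simp flip: real_sqrt_mult power_mult_distrib)
      ultimately have "2 * cmod (d k x) \<le> 2 ^ k * (cmod (d k x))\<^sup>2 + (1 / 2) ^ k"
        by (simp add: power_mult_distrib mult.assoc mult.left_commute mult.commute)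
      then show "norm (cmod (d k x)) \<le> 2 ^ k * (cmod (d k x))\<^sup>2 + (1 / 2) ^ k"
        by (smt (verit) norm_ge_zero real_norm_def)
    qed
    then have "summable (\<lambda>k. d k x)"
      by (rule summable_norm_cancel)
    then have "convergent (\<lambda>n. \<Sum>k<n. d k x)"
      by (simp add: summable_iff_convergent)
    moreover have "(\<Sum>k<n. d k x) = v (r n) x - v (r 0) x" for n
      unfolding d_def by (rule sum_lessThan_telescope)
    ultimately have "convergent (\<lambda>n. (v (r n) x - v (r 0) x) + v (r 0) x)"
      by (intro convergent_add convergent_const) simp
    then show ?case by simp
  qed
  define g where "g x = lim (\<lambda>k. v (r k) x)" for x
  have [measurable]: "g \<in> borel_measurable M"
    unfolding g_def[abs_def] by measurable
  have lim: "AE x in M. (\<lambda>k. v (r k) x) \<longlonglongrightarrow> g x"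
    using conv by eventually_elim (simp add: g_def convergent_LIMSEQ_iff)
  have bound: "L2_norm_sq M (\<lambda>x. v n x - g x) \<le> ennreal ((1 / 4) ^ k)" if "n \<ge> N k" for n k
  proof -
    have "L2_norm_sq M (\<lambda>x. v n x - g x) = (\<integral>\<^sup>+ x. liminf (\<lambda>j. ennreal ((cmod (v n x - v (r j) x))\<^sup>2)) \<partial>M)"
      unfolding L2_norm_sq_def
    proof (rule nn_integral_cong_AE)
      show "AE x in M. ennreal ((cmod (v n x - g x))\<^sup>2) = liminf (\<lambda>j. ennreal ((cmod (v n x - v (r j) x))\<^sup>2))"
        using lim
      proof eventually_elim
        case (elim x)
        have "(\<lambda>j. ennreal ((cmod (v n x - v (r j) x))\<^sup>2)) \<longlonglongrightarrow> ennreal ((cmod (v n x - g x))\<^sup>2)"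
          by (intro tendsto_intros elim)
        then show ?case by (rule lim_imp_Liminf[OF trivial_limit_sequentially, symmetric])
      qed
    qed
    also have "\<dots> \<le> liminf (\<lambda>j. \<integral>\<^sup>+ x. ennreal ((cmod (v n x - v (r j) x))\<^sup>2) \<partial>M)"
      by (rule nn_integral_liminf) measurable
    also have "\<dots> \<le> ennreal ((1 / 4) ^ k)"
    proof (rule Liminf_le)
      show "\<forall>\<^sub>F j in sequentially. (\<integral>\<^sup>+ x. ennreal ((cmod (v n x - v (r j) x))\<^sup>2) \<partial>M) \<le> ennreal ((1 / 4) ^ k)"
        using eventually_ge_at_top[of k]
      proof eventually_elim
        case (elim j)
        then show ?case
          using N[OF that rN[OF elim]] by (simp add: L2_norm_sq_def)
      qed
    qed simp
    finally show ?thesis .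
  qed
  have "(\<lambda>x. v (N 0) x - g x) \<in> L2 M"
    using bound[of 0 "N 0"] by (intro L2_I) (auto intro: le_less_trans)
  then have "(\<lambda>x. v (N 0) x - (v (N 0) x - g x)) \<in> L2 M"
    by (rule L2_diff[OF v])
  then have "g \<in> L2 M" by simp
  moreover have "(\<lambda>n. L2_norm_sq M (\<lambda>x. v n x - g x)) \<longlonglongrightarrow> 0"
  proof (rule order_tendstoI)
    fix a :: ennreal assume "0 < a"
    have "(\<lambda>k. ennreal ((1 / 4) ^ k)) \<longlonglongrightarrow> ennreal 0"
      by (intro tendsto_ennrealI LIMSEQ_power_zero) simp
    then have "\<forall>\<^sub>F k in sequentially. ennreal ((1 / 4) ^ k) < a"
      using \<open>0 < a\<close> by (intro order_tendstoD) auto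
    then obtain k where "ennreal ((1 / 4) ^ k) < a"
      by (auto simp: eventually_sequentially)
    then show "\<forall>\<^sub>F n in sequentially. L2_norm_sq M (\<lambda>x. v n x - g x) < a"
      using bound[of k] by (auto simp: eventually_sequentially intro!: exI[of _ "N k"] intro: le_less_trans)
  qed simp
  ultimately show ?thesis by blast
qed

section \<open>Approximate identities from a bounded kernel\<close>

text \<open>E is the kernel of the transform, \<open>\<gamma> n\<close> an integrable weight tending
  to 1, and \<open>H n\<close> the kernel of the composition of transform, weight and adjoint.
  Concentration is imposed on a generating pi-system G only, and \<Omega> is an exhaustion by
  members of G of finite measure.\<close>

locale kernel_transform = sigma_finite_measure M
  for M :: "'a measure" +
  fixes E :: "'a \<Rightarrow> 'a \<Rightarrow> complex" and \<gamma> :: "nat \<Rightarrow> 'a \<Rightarrow> real" and H :: "nat \<Rightarrow> 'a \<Rightarrow> 'a \<Rightarrow> real"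
    and G :: "'a set set" and \<Omega> :: "nat \<Rightarrow> 'a set"
  assumes measurable_E: "case_prod E \<in> borel_measurable (M \<Otimes>\<^sub>M M)"
    and E_commute: "E x y = E y x"
    and norm_E_le: "cmod (E x y) \<le> 1"
    and integrable_\<gamma>: "integrable M (\<gamma> n)"
    and \<gamma>_nonneg: "0 \<le> \<gamma> n x" and \<gamma>_le_1: "\<gamma> n x \<le> 1"
    and \<gamma>_tendsto: "(\<lambda>n. \<gamma> n x) \<longlonglongrightarrow> 1"
    and measurable_H: "case_prod (H n) \<in> borel_measurable (M \<Otimes>\<^sub>M M)"
    and H_nonneg: "0 \<le> H n x y"
    and H_eq: "x \<in> space M \<Longrightarrow> y \<in> space M \<Longrightarrow>
      complex_of_real (H n x y) = (LINT l|M. complex_of_real (\<gamma> n l) * E l x * cnj (E l y))"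
    and H_mass: "x \<in> space M \<Longrightarrow> (LINT y|M. H n x y) = 1"
    and Int_stable_G: "Int_stable G" and G_sub: "G \<subseteq> Pow (space M)"
    and sets_eq_G: "sets M = sigma_sets (space M) G"
    and H_concentrated: "A \<in> G \<Longrightarrow> x \<in> A \<Longrightarrow> (\<lambda>n. LINT y|M. indicator A y * H n x y) \<longlonglongrightarrow> 1"
    and \<Omega>_G: "\<Omega> k \<in> G" and \<Omega>_finite: "emeasure M (\<Omega> k) < \<infinity>"
    and \<Omega>_inc: "incseq \<Omega>" and \<Omega>_UN: "(\<Union>k. \<Omega> k) = space M"
begin

interpretation MM: pair_sigma_finite M M ..

lemma measurable_E' [measurable (raw)]:
  "f \<in> N \<rightarrow>\<^sub>M M \<Longrightarrow> g \<in> N \<rightarrow>\<^sub>M M \<Longrightarrow> (\<lambda>x. E (f x) (g x)) \<in> borel_measurable N"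
  using measurable_compose[OF measurable_Pair measurable_E] by simp

lemma measurable_H' [measurable (raw)]:
  "f \<in> N \<rightarrow>\<^sub>M M \<Longrightarrow> g \<in> N \<rightarrow>\<^sub>M M \<Longrightarrow> (\<lambda>x. H n (f x) (g x)) \<in> borel_measurable N"
  using measurable_compose[OF measurable_Pair measurable_H] by simp

lemma measurable_\<gamma> [measurable]: "\<gamma> n \<in> borel_measurable M"
  using integrable_\<gamma>[of n] by (rule borel_measurable_integrable)

section \<open>The transform, its adjoint and the smoothing operator\<close>

definition transform :: "('a \<Rightarrow> complex) \<Rightarrow> 'a \<Rightarrow> complex" where
  "transform f l = (LINT x|M. f x * E l x)"

definition transform_adj :: "('a \<Rightarrow> complex) \<Rightarrow> 'a \<Rightarrow> complex" where
  "transform_adj g x = (LINT l|M. g l * cnj (E l x))"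

definition mollify :: "nat \<Rightarrow> ('a \<Rightarrow> complex) \<Rightarrow> 'a \<Rightarrow> complex" where
  "mollify n f x = (LINT y|M. complex_of_real (H n x y) * f y)"

lemma H_commute:
  assumes "x \<in> space M" "y \<in> space M"
  shows "H n x y = H n y x"
proof -
  have "complex_of_real (H n x y) = cnj (complex_of_real (H n x y))" by simp
  also have "\<dots> = (LINT l|M. cnj (complex_of_real (\<gamma> n l) * E l x * cnj (E l y)))"
    unfolding H_eq[OF assms] by (simp only: Bochner_Integration.integral_cnj)
  also have "\<dots> = complex_of_real (H n y x)"
    unfolding H_eq[OF assms(2,1)] by (simp add: mult_ac)
  finally show ?thesis by simp
qed

lemma H_le:
  assumes "x \<in> space M" "y \<in> space M"
  shows "H n x y \<le> (LINT l|M. \<gamma> n l)"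
proof -
  have "H n x y = cmod (LINT l|M. complex_of_real (\<gamma> n l) * E l x * cnj (E l y))"
    using H_nonneg[of n x y] by (simp flip: H_eq[OF assms])
  also have "\<dots> \<le> (LINT l|M. \<gamma> n l)"
  proof (rule norm_integral_le)
    show "integrable M (\<lambda>l. complex_of_real (\<gamma> n l) * E l x * cnj (E l y))"
    proof (rule Bochner_Integration.integrable_bound[OF integrable_\<gamma>[of n]])
      show "(\<lambda>l. complex_of_real (\<gamma> n l) * E l x * cnj (E l y)) \<in> borel_measurable M"
        using assms by measurable
    qed (auto simp: norm_mult mult.assoc abs_mult intro!: mult_left_le mult_le_one norm_E_le)
    fix l
    show "cmod (complex_of_real (\<gamma> n l) * E l x * cnj (E l y)) \<le> \<gamma> n l"
      using \<gamma>_nonneg[of n l] by (auto simp: norm_mult mult.assoc intro!: mult_left_le mult_le_one norm_E_le)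
  qed (rule integrable_\<gamma>)
  finally show ?thesis .
qed

text \<open>A non-integrable function has Bochner integral 0, so the value 1 in
  \<open>H_mass\<close> forces integrability.\<close>

lemma integrable_H: "x \<in> space M \<Longrightarrow> integrable M (H n x)"
  using H_mass[of x n] not_integrable_integral_eq by fastforce

lemma nn_integral_H: "x \<in> space M \<Longrightarrow> (\<integral>\<^sup>+ y. ennreal (H n x y) \<partial>M) = 1"
  using nn_integral_eq_integral[OF integrable_H, of x n] by (simp add: H_nonneg H_mass)

lemma nn_integral_H': "y \<in> space M \<Longrightarrow> (\<integral>\<^sup>+ x. ennreal (H n x y) \<partial>M) = 1"
  using nn_integral_cong[of M "\<lambda>x. ennreal (H n x y)" "\<lambda>x. ennreal (H n y x)"]
  by (simp add: H_commute nn_integral_H)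

lemma integrable_mollify_integrand:
  fixes f :: "'a \<Rightarrow> complex"
  assumes f: "integrable M f" and x: "x \<in> space M"
  shows "integrable M (\<lambda>y. complex_of_real (H n x y) * f y)"
proof (rule Bochner_Integration.integrable_bound)
  have [measurable]: "f \<in> borel_measurable M" using f by auto
  show "integrable M (\<lambda>y. complex_of_real (LINT l|M. \<gamma> n l) * f y)"
    using f by simp
  show "(\<lambda>y. complex_of_real (H n x y) * f y) \<in> borel_measurable M"
    using x by measurable
  show "AE y in M. cmod (complex_of_real (H n x y) * f y) \<le> cmod (complex_of_real (LINT l|M. \<gamma> n l) * f y)"
  proof (rule AE_I2)
    fix y assume y: "y \<in> space M"
    have "\<bar>H n x y\<bar> \<le> \<bar>LINT l|M. \<gamma> n l\<bar>"
      using H_le[OF x y, of n] H_nonneg[of n x y] by linarith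
    then show "cmod (complex_of_real (H n x y) * f y) \<le> cmod (complex_of_real (LINT l|M. \<gamma> n l) * f y)"
      by (auto simp: norm_mult intro!: mult_right_mono)
  qed
qed

lemma measurable_mollify [measurable]:
  assumes [measurable]: "f \<in> borel_measurable M"
  shows "mollify n f \<in> borel_measurable M"
  unfolding mollify_def[abs_def] by measurable

text \<open>By symmetry the kernel has mass 1 in each variable, so Tonelli's theorem makes smoothing
  an L1 contraction.\<close>

lemma nn_integral_mollify_le:
  fixes f :: "'a \<Rightarrow> complex"
  assumes f: "integrable M f"
  shows "(\<integral>\<^sup>+ x. ennreal (cmod (mollify n f x)) \<partial>M) \<le> (\<integral>\<^sup>+ x. ennreal (cmod (f x)) \<partial>M)"
proof -
  have [measurable]: "f \<in> borel_measurable M" using f by auto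
  have "(\<integral>\<^sup>+ x. ennreal (cmod (mollify n f x)) \<partial>M) \<le>
     (\<integral>\<^sup>+ x. (\<integral>\<^sup>+ y. ennreal (H n x y) * ennreal (cmod (f y)) \<partial>M) \<partial>M)"
  proof (rule nn_integral_mono)
    fix x assume x: "x \<in> space M"
    have "ennreal (cmod (mollify n f x)) \<le> (\<integral>\<^sup>+ y. ennreal (cmod (complex_of_real (H n x y) * f y)) \<partial>M)"
      unfolding mollify_def by (rule integral_norm_bound_ennreal[OF integrable_mollify_integrand[OF f x]])
    then show "ennreal (cmod (mollify n f x)) \<le> (\<integral>\<^sup>+ y. ennreal (H n x y) * ennreal (cmod (f y)) \<partial>M)"
      by (simp add: norm_mult ennreal_mult' H_nonneg)
  qed
  also have "\<dots> = (\<integral>\<^sup>+ y. (\<integral>\<^sup>+ x. ennreal (H n x y) * ennreal (cmod (f y)) \<partial>M) \<partial>M)"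
    by (rule MM.Fubini'[symmetric]) measurable
  also have "\<dots> = (\<integral>\<^sup>+ y. ennreal (cmod (f y)) \<partial>M)"
    by (intro nn_integral_cong) (simp add: nn_integral_multc nn_integral_H')
  finally show ?thesis .
qed

lemma integrable_mollify:
  assumes f: "integrable M f"
  shows "integrable M (mollify n f)"
proof (rule integrableI_bounded)
  have "(\<integral>\<^sup>+ x. ennreal (cmod (f x)) \<partial>M) < \<infinity>"
    using f by (simp add: integrable_iff_bounded)
  then show "(\<integral>\<^sup>+ x. ennreal (cmod (mollify n f x)) \<partial>M) < \<infinity>"
    using nn_integral_mollify_le[OF f, of n] by (rule le_less_trans[rotated])
qed (use f in measurable)

lemma integral_mollify_le:
  assumes f: "integrable M f"
  shows "(LINT x|M. cmod (mollify n f x)) \<le> (LINT x|M. cmod (f x))"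
  using nn_integral_mollify_le[OF f, of n] f integrable_mollify[OF f, of n]
  by (simp add: nn_integral_eq_integral)

lemma mollify_add:
  assumes "integrable M f" "integrable M g" "x \<in> space M"
  shows "mollify n (\<lambda>x. f x + g x) x = mollify n f x + mollify n g x"
  unfolding mollify_def distrib_left
  using assms by (intro Bochner_Integration.integral_add integrable_mollify_integrand)

lemma mollify_cmult: "mollify n (\<lambda>x. c * f x) x = c * mollify n f x"
  unfolding mollify_def by (simp add: mult.left_commute)

section \<open>The class of functions that their smoothings approximate in L1\<close>

definition mollify_dist :: "nat \<Rightarrow> ('a \<Rightarrow> complex) \<Rightarrow> real" where
  "mollify_dist n f = (LINT x|M. cmod (mollify n f x - f x))"

definition approximable :: "('a \<Rightarrow> complex) \<Rightarrow> bool" where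
  "approximable f \<longleftrightarrow> integrable M f \<and> (\<lambda>n. mollify_dist n f) \<longlonglongrightarrow> 0"

lemma mollify_dist_nonneg: "0 \<le> mollify_dist n f"
  by (simp add: mollify_dist_def)

lemma mollify_dist_add_le:
  assumes f: "integrable M f" and g: "integrable M g"
  shows "mollify_dist n (\<lambda>x. f x + g x) \<le> mollify_dist n f + mollify_dist n g"
proof -
  note int = Bochner_Integration.integrable_diff[OF integrable_mollify[OF f] f, of n]
    Bochner_Integration.integrable_diff[OF integrable_mollify[OF g] g, of n]
  have "mollify_dist n (\<lambda>x. f x + g x) = (LINT x|M. cmod ((mollify n f x - f x) + (mollify n g x - g x)))"
    unfolding mollify_dist_def
    by (intro Bochner_Integration.integral_cong refl) (simp add: mollify_add[OF f g] algebra_simps)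
  also have "\<dots> \<le> (LINT x|M. cmod (mollify n f x - f x) + cmod (mollify n g x - g x))"
    using int by (intro integral_mono norm_triangle_ineq integrable_norm Bochner_Integration.integrable_add)
  also have "\<dots> = mollify_dist n f + mollify_dist n g"
    unfolding mollify_dist_def using int by (intro Bochner_Integration.integral_add integrable_norm)
  finally show ?thesis .
qed

lemma mollify_dist_cmult: "mollify_dist n (\<lambda>x. c * f x) = cmod c * mollify_dist n f"
  unfolding mollify_dist_def mollify_cmult by (simp flip: right_diff_distrib add: norm_mult)

lemma mollify_dist_le:
  assumes f: "integrable M f"
  shows "mollify_dist n f \<le> 2 * (LINT x|M. cmod (f x))"
proof -
  have "mollify_dist n f \<le> (LINT x|M. cmod (mollify n f x) + cmod (f x))"
    unfolding mollify_dist_def using f integrable_mollify[OF f, of n]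
    by (intro integral_mono norm_triangle_ineq4) auto
  also have "\<dots> \<le> 2 * (LINT x|M. cmod (f x))"
    using f integrable_mollify[OF f, of n] integral_mollify_le[OF f, of n] by simp
  finally show ?thesis .
qed

lemma approximable_add: "approximable f \<Longrightarrow> approximable g \<Longrightarrow> approximable (\<lambda>x. f x + g x)"
proof -
  assume *: "approximable f" "approximable g"
  then have int: "integrable M f" "integrable M g" by (auto simp: approximable_def)
  have "(\<lambda>n. mollify_dist n f + mollify_dist n g) \<longlonglongrightarrow> 0 + 0"
    using * by (intro tendsto_add) (auto simp: approximable_def)
  then have lim: "(\<lambda>n. mollify_dist n f + mollify_dist n g) \<longlonglongrightarrow> 0"
    by simp
  have "\<forall>n. norm (mollify_dist n (\<lambda>x. f x + g x)) \<le> mollify_dist n f + mollify_dist n g"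
    using mollify_dist_add_le[OF int] mollify_dist_nonneg by simp
  then have "(\<lambda>n. mollify_dist n (\<lambda>x. f x + g x)) \<longlonglongrightarrow> 0"
    by (rule Lim_null_comparison[OF always_eventually lim])
  then show ?thesis
    using int by (simp add: approximable_def)
qed

lemma approximable_cmult: "approximable f \<Longrightarrow> approximable (\<lambda>x. c * f x)"
  unfolding approximable_def mollify_dist_cmult
  by (auto intro: tendsto_mult_right_zero)

text \<open>The smoothing error is at most twice the L1 norm, uniformly in n, so replacing f by some
  \<open>u k\<close> within e/4 costs at most e/2.\<close>

lemma approximable_limit:
  assumes u: "\<And>k. approximable (u k)" and f: "integrable M f"
    and lim: "(\<lambda>k. LINT x|M. cmod (u k x - f x)) \<longlonglongrightarrow> 0"
  shows "approximable f"
proof -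
  have iu: "integrable M (u k)" for k using u by (auto simp: approximable_def)
  have "(\<lambda>n. mollify_dist n f) \<longlonglongrightarrow> 0"
  proof (rule LIMSEQ_I)
    fix e :: real assume e: "e > 0"
    obtain k where k: "(LINT x|M. cmod (u k x - f x)) < e / 4"
      using order_tendstoD(2)[OF lim, of "e / 4"] e by (auto simp: eventually_sequentially)
    obtain N where N: "\<And>n. n \<ge> N \<Longrightarrow> mollify_dist n (u k) < e / 2"
      using order_tendstoD(2)[of "\<lambda>n. mollify_dist n (u k)" 0 sequentially "e / 2"] u[of k] e
      by (auto simp: approximable_def eventually_sequentially)
    have "mollify_dist n f < e" if "n \<ge> N" for n
    proof -
      have i: "integrable M (\<lambda>x. f x - u k x)" using f iu by simp
      have "mollify_dist n f = mollify_dist n (\<lambda>x. u k x + (f x - u k x))" by simp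
      also have "\<dots> \<le> mollify_dist n (u k) + mollify_dist n (\<lambda>x. f x - u k x)"
        by (rule mollify_dist_add_le[OF iu i])
      also have "mollify_dist n (\<lambda>x. f x - u k x) \<le> 2 * (LINT x|M. cmod (u k x - f x))"
        using mollify_dist_le[OF i, of n] by (simp add: norm_minus_commute)
      finally show ?thesis using N[OF that] k by linarith
    qed
    then show "\<exists>N. \<forall>n\<ge>N. norm (mollify_dist n f - 0) < e"
      using mollify_dist_nonneg[of _ f] by auto
  qed
  then show ?thesis using f by (simp add: approximable_def)
qed

text \<open>The form of \<open>approximable_limit\<close> applied below to unions of sets, to
  exhaustions and to simple functions.\<close>

lemma approximable_dominated:
  assumes u: "\<And>k. approximable (u k)" and f: "f \<in> borel_measurable M"
    and w: "integrable M w" and bound: "\<And>k x. x \<in> space M \<Longrightarrow> cmod (u k x) \<le> w x"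
    and lim: "\<And>x. x \<in> space M \<Longrightarrow> (\<lambda>k. u k x) \<longlonglongrightarrow> f x"
  shows "approximable f"
proof (rule approximable_limit[OF u])
  have iu: "integrable M (u k)" for k using u by (auto simp: approximable_def)
  then have [measurable]: "u k \<in> borel_measurable M" for k by auto
  note [measurable] = f
  have fw: "cmod (f x) \<le> w x" if "x \<in> space M" for x
    using bound that by (intro LIMSEQ_le_const2[OF tendsto_norm[OF lim[OF that]]]) auto
  show "integrable M f"
    by (rule Bochner_Integration.integrable_bound[OF w f]) (use fw in \<open>force intro!: AE_I2\<close>)
  have "(\<lambda>k. LINT x|M. cmod (u k x - f x)) \<longlonglongrightarrow> (LINT x|M. 0)"
  proof (rule integral_dominated_convergence[where w = "\<lambda>x. 2 * w x"])
    show "AE x in M. (\<lambda>k. cmod (u k x - f x)) \<longlonglongrightarrow> 0"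
      using lim by (intro AE_I2 tendsto_norm_zero LIM_zero)
    show "AE x in M. norm (cmod (u k x - f x)) \<le> 2 * w x" for k
    proof (rule AE_I2)
      fix x assume x: "x \<in> space M"
      show "norm (cmod (u k x - f x)) \<le> 2 * w x"
        using norm_triangle_ineq4[of "u k x" "f x"] bound[OF x, of k] fw[OF x] by simp
    qed
    show "integrable M (\<lambda>x. 2 * w x)" using w by simp
  qed measurable
  then show "(\<lambda>k. LINT x|M. cmod (u k x - f x)) \<longlonglongrightarrow> 0" by simp
qed

text \<open>
  As the smoothing preserves total mass, the \<open>L\<^sup>1\<close> distance from \<open>indicator A\<close> to its smoothed
  version is twice the mass that leaves \<open>A\<close>.
\<close>

lemma approximable_indicator_G:
  assumes A: "A \<in> G" and fin: "emeasure M A < \<infinity>"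
  shows "approximable (indicator A)"
proof -
  have sA [measurable]: "A \<in> sets M" unfolding sets_eq_G using A by auto
  define p where "p n x = (LINT y|M. indicator A y * H n x y)" for n x
  have [measurable]: "p n \<in> borel_measurable M" for n
    unfolding p_def[abs_def] by measurable
  have int: "integrable M (\<lambda>y. indicator A y * H n x y)" if "x \<in> space M" for n x
    using integrable_mult_indicator[OF sA integrable_H[OF that, of n]] by simp
  have p0: "0 \<le> p n x" for n x
    unfolding p_def by (intro integral_nonneg_AE AE_I2) (simp add: H_nonneg)
  have p1: "p n x \<le> 1" if "x \<in> space M" for n x
  proof -
    have "p n x \<le> (LINT y|M. H n x y)"
      unfolding p_def using that
      by (intro integral_mono int integrable_H) (auto simp: indicator_def H_nonneg)
    then show ?thesis by (simp add: H_mass[OF that])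
  qed
  have ind_real: "integrable M (indicator A :: 'a \<Rightarrow> real)"
    using fin by auto
  have "(indicator A :: 'a \<Rightarrow> complex) = (\<lambda>x. complex_of_real (indicator A x))"
    by (auto simp: indicator_def)
  then have "integrable M (indicator A :: 'a \<Rightarrow> complex)"
    using ind_real by (simp only:) (rule integrable_of_real)
  note ind = this ind_real
  have mol: "mollify n (indicator A) x = complex_of_real (p n x)" for n x
  proof -
    have "mollify n (indicator A) x = (LINT y|M. complex_of_real (indicator A y * H n x y))"
      unfolding mollify_def by (intro Bochner_Integration.integral_cong refl) (simp add: indicator_def)
    then show ?thesis by (simp only: p_def integral_complex_of_real)
  qed
  have pint: "integrable M (p n)" for n
    using integrable_mollify[OF ind(1), of n] integrable_Re[of M "mollify n (indicator A)"] by (simp add: mol)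
  have nnp: "(\<integral>\<^sup>+ y. ennreal (indicator A y * H n x y) \<partial>M) = ennreal (p n x)" if "x \<in> space M" for n x
    unfolding p_def by (intro nn_integral_eq_integral int that) (simp add: H_nonneg)
  have mass: "(LINT x|M. p n x) = (LINT x|M. indicator A x)" for n
  proof -
    have "ennreal (LINT x|M. p n x) = (\<integral>\<^sup>+ x. (\<integral>\<^sup>+ y. ennreal (indicator A y * H n x y) \<partial>M) \<partial>M)"
      using pint[of n] p0[of n] nnp by (simp add: nn_integral_eq_integral cong: nn_integral_cong)
    also have "\<dots> = (\<integral>\<^sup>+ y. (\<integral>\<^sup>+ x. ennreal (indicator A y * H n x y) \<partial>M) \<partial>M)"
      by (rule MM.Fubini'[symmetric]) measurable
    also have "\<dots> = (\<integral>\<^sup>+ y. ennreal (indicator A y) \<partial>M)"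
      by (intro nn_integral_cong) (auto simp: indicator_def nn_integral_H')
    also have "\<dots> = ennreal (LINT x|M. indicator A x)"
      by (rule nn_integral_eq_integral[OF ind(2)]) simp
    finally show ?thesis
      by (subst (asm) ennreal_inj) (auto intro!: integral_nonneg_AE p0)
  qed
  have ind_p: "integrable M (\<lambda>x. indicator A x * (1 - p n x))" for n
    using integrable_mult_indicator[OF sA pint[of n]] ind(2) by (simp add: right_diff_distrib)
  have dist: "mollify_dist n (indicator A) = 2 * (LINT x|M. indicator A x * (1 - p n x))" for n
  proof -
    \<comment> \<open>Since 0 \<le> p \<le> 1, the modulus of p - 1 on A and of p off A both take
      this shape; the first bracket has integral 0 by \<open>mass\<close>.\<close>
    have "mollify_dist n (indicator A) = (LINT x|M. (p n x - indicator A x) + 2 * (indicator A x * (1 - p n x)))"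
      unfolding mollify_dist_def mol
    proof (intro Bochner_Integration.integral_cong refl)
      fix x assume x: "x \<in> space M"
      have "cmod (complex_of_real (p n x) - indicator A x) = \<bar>p n x - indicator A x\<bar>"
        by (metis norm_of_real of_real_diff of_real_indicator)
      then show "cmod (complex_of_real (p n x) - indicator A x) = (p n x - indicator A x) + 2 * (indicator A x * (1 - p n x))"
        using p0[of n x] p1[OF x, of n] by (cases "x \<in> A") auto
    qed
    also have "\<dots> = (LINT x|M. p n x - indicator A x) + (LINT x|M. 2 * (indicator A x * (1 - p n x)))"
      by (intro Bochner_Integration.integral_add Bochner_Integration.integrable_diff pint ind integrable_mult_right ind_p)
    also have "(LINT x|M. p n x - indicator A x) = 0"
      using mass[of n] by (subst Bochner_Integration.integral_diff[OF pint ind(2)]) simp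
    finally show ?thesis by simp
  qed
  have "(\<lambda>n. LINT x|M. indicator A x * (1 - p n x)) \<longlonglongrightarrow> (LINT x|M. 0)"
  proof (rule integral_dominated_convergence[where w = "indicator A"])
    show "AE x in M. (\<lambda>n. indicator A x * (1 - p n x)) \<longlonglongrightarrow> 0"
    proof (rule AE_I2)
      fix x
      show "(\<lambda>n. indicator A x * (1 - p n x)) \<longlonglongrightarrow> 0"
      proof (cases "x \<in> A")
        case True
        have "(\<lambda>n. 1 - p n x) \<longlonglongrightarrow> 1 - 1"
          unfolding p_def by (intro tendsto_intros H_concentrated[OF A True])
        then show ?thesis using True by simp
      qed simp
    qed
    show "AE x in M. norm (indicator A x * (1 - p n x)) \<le> indicator A x" for n
      using p0[of n] p1[of _ n] by (auto simp: indicator_def)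
  qed (use ind in auto)
  then have "(\<lambda>n. mollify_dist n (indicator A)) \<longlonglongrightarrow> 2 * 0"
    unfolding dist by (intro tendsto_intros) simp
  then show ?thesis
    using ind by (simp add: approximable_def)
qed

text \<open>Dynkin's pi-lambda argument inside a fixed \<open>\<Omega> k\<close>: finite measure
  there makes the relative complement a difference of integrable indicators, and it dominates the
  partial sums of a disjoint union.\<close>

lemma approximable_indicator_Int:
  assumes "A \<in> sets M"
  shows "approximable (indicator (A \<inter> \<Omega> k))"
proof -
  have s\<Omega> [measurable]: "\<Omega> k \<in> sets M" unfolding sets_eq_G using \<Omega>_G by auto
  have int\<Omega>: "integrable M (indicator (\<Omega> k) :: 'a \<Rightarrow> real)"
    using \<Omega>_finite[of k] by auto
  have ap\<Omega>: "approximable (indicator (\<Omega> k))"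
    by (intro approximable_indicator_G \<Omega>_G \<Omega>_finite)
  from assms have "A \<in> sigma_sets (space M) G" by (simp add: sets_eq_G)
  with Int_stable_G G_sub show ?thesis
  proof (induction rule: sigma_sets_induct_disjoint)
    case (basic A)
    have "A \<inter> \<Omega> k \<in> G"
      using Int_stable_G basic \<Omega>_G by (auto simp: Int_stable_def)
    moreover have "emeasure M (A \<inter> \<Omega> k) < \<infinity>"
      using emeasure_mono[of "A \<inter> \<Omega> k" "\<Omega> k" M] \<Omega>_finite[of k] by (auto intro: le_less_trans)
    ultimately show ?case by (rule approximable_indicator_G)
  next
    case empty
    show ?case by (simp add: approximable_def mollify_dist_def mollify_def)
  next
    case (compl A)
    have "indicator ((space M - A) \<inter> \<Omega> k) = (\<lambda>x. indicator (\<Omega> k) x + (- 1) * indicator (A \<inter> \<Omega> k) x :: complex)"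
      using sets.sets_into_space[OF s\<Omega>] by (auto simp: indicator_def fun_eq_iff)
    then show ?case
      by (simp only:) (intro approximable_add approximable_cmult ap\<Omega> compl.IH)
  next
    case (union A)
    have sA [measurable]: "A i \<in> sets M" for i
      using union(2) by (auto simp: sets_eq_G)
    have part: "approximable (\<lambda>x. \<Sum>i<n. indicator (A i \<inter> \<Omega> k) x)" for n
    proof (induction n)
      case 0
      show ?case by (simp add: approximable_def mollify_dist_def mollify_def)
    next
      case (Suc n)
      then show ?case using approximable_add[OF Suc union.IH[of n]] by simp
    qed
    have sum: "(\<Sum>i<n. indicator (A i \<inter> \<Omega> k) x) = (indicator ((\<Union>i<n. A i) \<inter> \<Omega> k) x :: complex)" for n x
    proof -
      have "disjoint_family_on (\<lambda>i. A i \<inter> \<Omega> k) {..<n}"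
        using union(1) by (auto simp: disjoint_family_on_def)
      then have "(\<Sum>i<n. indicator (A i \<inter> \<Omega> k) x) = (indicator (\<Union>i<n. A i \<inter> \<Omega> k) x :: complex)"
        by (intro indicator_UN_disjoint[symmetric]) auto
      then show ?thesis by (simp add: Int_UN_distrib2)
    qed
    show ?case
    proof (rule approximable_dominated[OF part _ int\<Omega>])
      show "(indicator ((\<Union>i. A i) \<inter> \<Omega> k) :: 'a \<Rightarrow> complex) \<in> borel_measurable M" by measurable
      show "cmod (\<Sum>i<n. indicator (A i \<inter> \<Omega> k) x) \<le> indicator (\<Omega> k) x" for n x
        unfolding sum by (auto simp: indicator_def)
      show "(\<lambda>n. \<Sum>i<n. indicator (A i \<inter> \<Omega> k) x) \<longlonglongrightarrow> (indicator ((\<Union>i. A i) \<inter> \<Omega> k) x :: complex)" for x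
        unfolding sum
      proof (rule tendsto_eventually)
        show "\<forall>\<^sub>F n in sequentially. indicator ((\<Union>i<n. A i) \<inter> \<Omega> k) x = (indicator ((\<Union>i. A i) \<inter> \<Omega> k) x :: complex)"
        proof (cases "x \<in> (\<Union>i. A i)")
          case True
          then obtain i where "x \<in> A i" by auto
          then show ?thesis
            by (intro eventually_mono[OF eventually_gt_at_top[of i]]) (auto simp: indicator_def)
        qed (auto simp: indicator_def)
      qed
    qed
  qed
qed

lemma approximable_indicator:
  assumes A [measurable]: "A \<in> sets M" and fin: "emeasure M A < \<infinity>"
  shows "approximable (indicator A)"
proof (rule approximable_dominated)
  show "approximable (indicator (A \<inter> \<Omega> k))" for k
    by (rule approximable_indicator_Int[OF A])
  show "integrable M (indicator A :: 'a \<Rightarrow> real)" using fin by auto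
  show "cmod (indicator (A \<inter> \<Omega> k) x) \<le> indicator A x" for k x
    by (auto simp: indicator_def)
  show "(\<lambda>k. indicator (A \<inter> \<Omega> k) x) \<longlonglongrightarrow> (indicator A x :: complex)" if x: "x \<in> space M" for x
  proof (rule tendsto_eventually)
    obtain i where i: "x \<in> \<Omega> i" using x \<Omega>_UN by auto
    show "\<forall>\<^sub>F k in sequentially. indicator (A \<inter> \<Omega> k) x = (indicator A x :: complex)"
      using eventually_ge_at_top[of i]
      by eventually_elim (use \<Omega>_inc i in \<open>auto simp: indicator_def incseq_def\<close>)
  qed
qed measurable

theorem mollify_tendsto_L1:
  fixes f :: "'a \<Rightarrow> complex"
  assumes "integrable M f"
  shows "(\<lambda>n. LINT x|M. cmod (mollify n f x - f x)) \<longlonglongrightarrow> 0"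
proof -
  from assms have "approximable f"
  proof (induction rule: integrable_induct)
    case (base A c)
    have "approximable (\<lambda>x. c * indicator A x)"
      using base by (intro approximable_cmult approximable_indicator)
    also have "(\<lambda>x. c * indicator A x) = (\<lambda>x. indicator A x *\<^sub>R c)"
      by (auto simp: indicator_def)
    finally show ?case .
  next
    case (add f g)
    then show ?case by (intro approximable_add)
  next
    case (lim f s)
    show ?case
    proof (rule approximable_dominated[of s])
      show "approximable (s i)" for i by (rule lim)
      show "integrable M (\<lambda>x. 2 * cmod (f x))" using lim by simp
      show "f \<in> borel_measurable M" using lim by auto
    qed (use lim in auto)
  qed
  then show ?thesis by (simp add: approximable_def mollify_dist_def)
qed

end

section \<open>Plancherel theory of a bounded kernel\<close>

lemma (in pair_sigma_finite) integrable_product: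
  fixes g :: "'a \<Rightarrow> 'c :: {real_normed_field, banach, second_countable_topology}" and h :: "'b \<Rightarrow> 'c"
  assumes g: "integrable M1 g" and h: "integrable M2 h"
  shows "integrable (M1 \<Otimes>\<^sub>M M2) (\<lambda>(x, y). g x * h y)"
proof (rule Fubini_integrable)
  have [measurable]: "g \<in> borel_measurable M1" "h \<in> borel_measurable M2"
    using g h by auto
  show "(\<lambda>(x, y). g x * h y) \<in> borel_measurable (M1 \<Otimes>\<^sub>M M2)" by measurable
  show "integrable M1 (\<lambda>x. LINT y|M2. norm (case (x, y) of (x, y) \<Rightarrow> g x * h y))"
    using g by (simp add: norm_mult)
  show "AE x in M1. integrable M2 (\<lambda>y. case (x, y) of (x, y) \<Rightarrow> g x * h y)"
    using h by simp
qed

lemma (in pair_sigma_finite) integrable_product_kernel: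
  fixes g :: "'a \<Rightarrow> complex" and h :: "'b \<Rightarrow> complex" and K :: "'a \<Rightarrow> 'b \<Rightarrow> complex"
  assumes g: "integrable M1 g" and h: "integrable M2 h"
    and K: "case_prod K \<in> borel_measurable (M1 \<Otimes>\<^sub>M M2)" "\<And>x y. cmod (K x y) \<le> 1"
  shows "integrable (M1 \<Otimes>\<^sub>M M2) (\<lambda>(x, y). g x * h y * K x y)"
proof (rule Bochner_Integration.integrable_bound[OF integrable_product[OF g h]])
  have [measurable]: "g \<in> borel_measurable M1" "h \<in> borel_measurable M2" "case_prod K \<in> borel_measurable (M1 \<Otimes>\<^sub>M M2)"
    using g h K by auto
  show "(\<lambda>(x, y). g x * h y * K x y) \<in> borel_measurable (M1 \<Otimes>\<^sub>M M2)" by measurable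
  show "AE p in M1 \<Otimes>\<^sub>M M2. norm (case p of (x, y) \<Rightarrow> g x * h y * K x y) \<le> norm (case p of (x, y) \<Rightarrow> g x * h y)"
    by (rule AE_I2) (auto simp: norm_mult K intro!: mult_left_le)
qed

context kernel_transform
begin

interpretation MM: pair_sigma_finite M M ..

section \<open>Elementary properties of the transform\<close>

lemma measurable_transform [measurable]:
  assumes [measurable]: "f \<in> borel_measurable M"
  shows "transform f \<in> borel_measurable M"
  unfolding transform_def[abs_def] by measurable

lemma measurable_transform_adj [measurable]:
  assumes [measurable]: "f \<in> borel_measurable M"
  shows "transform_adj f \<in> borel_measurable M"
  unfolding transform_adj_def[abs_def] by measurable

lemma integrable_mult_E:
  assumes "integrable M f" "l \<in> space M"
  shows "integrable M (\<lambda>x. f x * E l x)"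
proof (rule Bochner_Integration.integrable_bound[OF assms(1)])
  have [measurable]: "f \<in> borel_measurable M" using assms by auto
  show "(\<lambda>x. f x * E l x) \<in> borel_measurable M" using assms(2) by measurable
qed (auto simp: norm_mult norm_E_le intro!: mult_left_le)

lemma norm_transform_le:
  assumes "integrable M f" "l \<in> space M"
  shows "cmod (transform f l) \<le> (LINT x|M. cmod (f x))"
  unfolding transform_def using assms
  by (intro norm_integral_le integrable_mult_E integrable_norm) (auto simp: norm_mult norm_E_le intro!: mult_left_le)

text \<open>By symmetry of E, conjugation exchanges the transform and its adjoint; every norm
  statement for one thus passes to the other.\<close>

lemma transform_adj_eq: "transform_adj f x = cnj (transform (\<lambda>l. cnj (f l)) x)"
  unfolding transform_adj_def transform_def Bochner_Integration.integral_cnj[symmetric]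
  by (simp add: E_commute[of x])

lemma transform_add_cmult:
  assumes "integrable M f" "integrable M g" "l \<in> space M"
  shows "transform (\<lambda>x. f x + c * g x) l = transform f l + c * transform g l"
proof -
  have "transform (\<lambda>x. f x + c * g x) l = (LINT x|M. f x * E l x + c * (g x * E l x))"
    unfolding transform_def by (simp add: algebra_simps)
  also have "\<dots> = transform f l + c * transform g l"
    unfolding transform_def using assms
    by (subst Bochner_Integration.integral_add) (simp_all add: integrable_mult_E)
  finally show ?thesis .
qed

lemma integrable_\<gamma>_transform:
  assumes f: "integrable M f"
  shows "integrable M (\<lambda>l. complex_of_real (\<gamma> n l) * transform f l)"
proof (rule Bochner_Integration.integrable_bound)
  have [measurable]: "f \<in> borel_measurable M" using f by auto
  show "integrable M (\<lambda>l. \<gamma> n l * (LINT x|M. cmod (f x)))"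
    using integrable_\<gamma>[of n] by simp
  show "(\<lambda>l. complex_of_real (\<gamma> n l) * transform f l) \<in> borel_measurable M" by measurable
  show "AE l in M. cmod (complex_of_real (\<gamma> n l) * transform f l) \<le> norm (\<gamma> n l * (LINT x|M. cmod (f x)))"
    using norm_transform_le[OF f] \<gamma>_nonneg[of n] by (auto simp: norm_mult intro!: mult_left_mono)
qed

text \<open>The integrable weight makes the double integral absolutely convergent, so Fubini's
  theorem applies although \<open>transform f\<close> is only known to be bounded.\<close>

lemma transform_adj_\<gamma>_transform:
  assumes f: "integrable M f" and y: "y \<in> space M"
  shows "transform_adj (\<lambda>l. complex_of_real (\<gamma> n l) * transform f l) y = mollify n f y"
proof -
  have [measurable]: "f \<in> borel_measurable M" using f by auto
  let ?g = "\<lambda>l. complex_of_real (\<gamma> n l)"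
  let ?K = "\<lambda>l x. E l x * cnj (E l y)"
  have g: "integrable M ?g" by (rule integrable_of_real[OF integrable_\<gamma>])
  have int: "integrable (M \<Otimes>\<^sub>M M) (\<lambda>(l, x). ?g l * f x * ?K l x)"
  proof (rule MM.integrable_product_kernel[OF g f])
    show "(\<lambda>(l, x). ?K l x) \<in> borel_measurable (M \<Otimes>\<^sub>M M)" using y by measurable
    show "cmod (?K l x) \<le> 1" for l x
      by (auto simp: norm_mult intro!: mult_le_one norm_E_le)
  qed
  have "transform_adj (\<lambda>l. ?g l * transform f l) y = (LINT l|M. (LINT x|M. ?g l * f x * ?K l x))"
    unfolding transform_adj_def transform_def
    by (simp add: mult_ac flip: integral_mult_right_zero integral_mult_left_zero)
  also have "\<dots> = (LINT x|M. (LINT l|M. ?g l * f x * ?K l x))"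
    by (rule MM.Fubini_integral[OF int, symmetric])
  also have "\<dots> = (LINT x|M. complex_of_real (H n y x) * f x)"
  proof (intro Bochner_Integration.integral_cong refl)
    fix x assume x: "x \<in> space M"
    have "(LINT l|M. ?g l * f x * ?K l x) = (LINT l|M. f x * (?g l * E l x * cnj (E l y)))"
      by (simp add: mult_ac)
    also have "\<dots> = complex_of_real (H n x y) * f x"
      by (simp add: H_eq[OF x y])
    finally show "(LINT l|M. ?g l * f x * ?K l x) = complex_of_real (H n y x) * f x"
      by (simp add: H_commute[OF x y])
  qed
  finally show ?thesis by (simp add: mollify_def)
qed

lemma integral_\<gamma>_transform_square:
  assumes f: "integrable M f"
  shows "complex_of_real (LINT l|M. \<gamma> n l * (cmod (transform f l))\<^sup>2) = (LINT y|M. cnj (f y) * mollify n f y)"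
proof -
  have [measurable]: "f \<in> borel_measurable M" using f by auto
  let ?g = "\<lambda>l. complex_of_real (\<gamma> n l) * transform f l"
  have int: "integrable (M \<Otimes>\<^sub>M M) (\<lambda>(l, y). ?g l * cnj (f y) * cnj (E l y))"
  proof (rule MM.integrable_product_kernel[OF integrable_\<gamma>_transform[OF f]])
    show "integrable M (\<lambda>y. cnj (f y))" using f by simp
    show "(\<lambda>(l, y). cnj (E l y)) \<in> borel_measurable (M \<Otimes>\<^sub>M M)" by measurable
  qed (simp add: norm_E_le)
  have "complex_of_real (LINT l|M. \<gamma> n l * (cmod (transform f l))\<^sup>2) = (LINT l|M. ?g l * cnj (transform f l))"
    unfolding integral_complex_of_real[symmetric]
    by (intro Bochner_Integration.integral_cong refl) (simp add: complex_norm_square del: of_real_power)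
  also have "\<dots> = (LINT l|M. (LINT y|M. ?g l * cnj (f y) * cnj (E l y)))"
  proof (intro Bochner_Integration.integral_cong refl)
    fix l
    have "cnj (transform f l) = (LINT y|M. cnj (f y) * cnj (E l y))"
      by (simp only: transform_def Bochner_Integration.integral_cnj[symmetric] complex_cnj_mult)
    then show "?g l * cnj (transform f l) = (LINT y|M. ?g l * cnj (f y) * cnj (E l y))"
      by (simp only: mult.assoc[of "?g l"] integral_mult_right_zero)
  qed
  also have "\<dots> = (LINT y|M. (LINT l|M. ?g l * cnj (f y) * cnj (E l y)))"
    by (rule MM.Fubini_integral[OF int, symmetric])
  also have "\<dots> = (LINT y|M. cnj (f y) * transform_adj ?g y)"
    unfolding transform_adj_def by (simp add: mult_ac flip: integral_mult_right_zero)
  also have "\<dots> = (LINT y|M. cnj (f y) * mollify n f y)"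
    by (intro Bochner_Integration.integral_cong refl) (simp add: transform_adj_\<gamma>_transform[OF f])
  finally show ?thesis .
qed

text \<open>Schur's test: the quadratic form of \<open>H n\<close> is bounded through |f(x) f(y)|
  \<le> (|f(x)|^2 + |f(y)|^2) / 2, since both marginals of the kernel are 1. When f is not in L2 the
  right side is infinite.\<close>

lemma nn_integral_\<gamma>_transform_square_le:
  assumes f: "integrable M f"
  shows "(\<integral>\<^sup>+ l. ennreal (\<gamma> n l * (cmod (transform f l))\<^sup>2) \<partial>M) \<le> L2_norm_sq M f"
proof (cases "L2_norm_sq M f < \<infinity>")
  case True
  have [measurable]: "f \<in> borel_measurable M" using f by auto
  let ?q = "\<lambda>y. ennreal ((cmod (f y))\<^sup>2 / 2)"
  have int: "integrable M (\<lambda>l. \<gamma> n l * (cmod (transform f l))\<^sup>2)"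
  proof (rule Bochner_Integration.integrable_bound)
    show "integrable M (\<lambda>l. (LINT x|M. cmod (f x))\<^sup>2 * \<gamma> n l)"
      using integrable_\<gamma>[of n] by simp
    show "AE l in M. norm (\<gamma> n l * (cmod (transform f l))\<^sup>2) \<le> norm ((LINT x|M. cmod (f x))\<^sup>2 * \<gamma> n l)"
      using norm_transform_le[OF f] \<gamma>_nonneg[of n]
      by (auto simp: abs_mult mult.commute intro!: mult_left_mono power_mono)
  qed measurable
  have "(\<integral>\<^sup>+ l. ennreal (\<gamma> n l * (cmod (transform f l))\<^sup>2) \<partial>M) = ennreal (LINT l|M. \<gamma> n l * (cmod (transform f l))\<^sup>2)"
    by (rule nn_integral_eq_integral[OF int]) (simp add: \<gamma>_nonneg)
  also have "\<dots> = ennreal (cmod (complex_of_real (LINT l|M. \<gamma> n l * (cmod (transform f l))\<^sup>2)))"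
    by (simp add: abs_of_nonneg \<gamma>_nonneg)
  \<comment> \<open>If the product were not integrable, its Bochner integral would be 0 and the
    bound trivial.\<close>
  also have "\<dots> \<le> (\<integral>\<^sup>+ y. ennreal (cmod (cnj (f y) * mollify n f y)) \<partial>M)"
    unfolding integral_\<gamma>_transform_square[OF f]
    by (cases "integrable M (\<lambda>y. cnj (f y) * mollify n f y)")
      (simp_all add: integral_norm_bound_ennreal not_integrable_integral_eq)
  also have "\<dots> \<le> (\<integral>\<^sup>+ y. (\<integral>\<^sup>+ x. ennreal (H n y x) * ?q y + ennreal (H n y x) * ?q x \<partial>M) \<partial>M)"
  proof (rule nn_integral_mono)
    fix y assume y: "y \<in> space M"
    have "ennreal (cmod (cnj (f y) * mollify n f y)) = ennreal (cmod (f y)) * ennreal (cmod (mollify n f y))"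
      by (simp add: norm_mult ennreal_mult')
    also have "\<dots> \<le> ennreal (cmod (f y)) * (\<integral>\<^sup>+ x. ennreal (cmod (complex_of_real (H n y x) * f x)) \<partial>M)"
      unfolding mollify_def
      by (intro mult_left_mono integral_norm_bound_ennreal integrable_mollify_integrand[OF f y]) simp
    also have "\<dots> = (\<integral>\<^sup>+ x. ennreal (cmod (f y)) * ennreal (cmod (complex_of_real (H n y x) * f x)) \<partial>M)"
      using y by (intro nn_integral_cmult[symmetric]) measurable
    also have "\<dots> \<le> (\<integral>\<^sup>+ x. ennreal (H n y x) * ?q y + ennreal (H n y x) * ?q x \<partial>M)"
    proof (rule nn_integral_mono)
      fix x
      have "cmod (f y) * cmod (f x) \<le> (cmod (f y))\<^sup>2 / 2 + (cmod (f x))\<^sup>2 / 2"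
        using sum_squares_bound[of "cmod (f y)" "cmod (f x)"] by simp
      then have "H n y x * (cmod (f y) * cmod (f x)) \<le> H n y x * ((cmod (f y))\<^sup>2 / 2 + (cmod (f x))\<^sup>2 / 2)"
        by (intro mult_left_mono H_nonneg)
      then have "ennreal (cmod (f y) * cmod (complex_of_real (H n y x) * f x)) \<le>
          ennreal (H n y x * ((cmod (f y))\<^sup>2 / 2) + H n y x * ((cmod (f x))\<^sup>2 / 2))"
        by (intro ennreal_leI) (simp add: norm_mult H_nonneg distrib_left mult.left_commute)
      also have "\<dots> = ennreal (H n y x) * ?q y + ennreal (H n y x) * ?q x"
        by (simp only: ennreal_plus ennreal_mult'[symmetric] H_nonneg mult_nonneg_nonneg zero_le_divide_iff zero_le_power2 zero_le_numeral simp_thms)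
      finally show "ennreal (cmod (f y)) * ennreal (cmod (complex_of_real (H n y x) * f x)) \<le>
          ennreal (H n y x) * ?q y + ennreal (H n y x) * ?q x"
        by (simp add: ennreal_mult')
    qed
    finally show "ennreal (cmod (cnj (f y) * mollify n f y)) \<le>
        (\<integral>\<^sup>+ x. ennreal (H n y x) * ?q y + ennreal (H n y x) * ?q x \<partial>M)" .
  qed
  also have "\<dots> = (\<integral>\<^sup>+ y. (\<integral>\<^sup>+ x. ennreal (H n y x) * ?q y \<partial>M) + (\<integral>\<^sup>+ x. ennreal (H n y x) * ?q x \<partial>M) \<partial>M)"
    by (intro nn_integral_cong nn_integral_add) measurable
  also have "\<dots> = (\<integral>\<^sup>+ y. (\<integral>\<^sup>+ x. ennreal (H n y x) * ?q y \<partial>M) \<partial>M) + (\<integral>\<^sup>+ y. (\<integral>\<^sup>+ x. ennreal (H n y x) * ?q x \<partial>M) \<partial>M)"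
    by (rule nn_integral_add) measurable
  also have "(\<integral>\<^sup>+ y. (\<integral>\<^sup>+ x. ennreal (H n y x) * ?q x \<partial>M) \<partial>M) = (\<integral>\<^sup>+ x. (\<integral>\<^sup>+ y. ennreal (H n y x) * ?q x \<partial>M) \<partial>M)"
    by (rule MM.Fubini'[symmetric]) measurable
  also have "\<dots> = (\<integral>\<^sup>+ x. ?q x \<partial>M)"
    by (intro nn_integral_cong) (simp add: nn_integral_multc nn_integral_H')
  also have "(\<integral>\<^sup>+ y. (\<integral>\<^sup>+ x. ennreal (H n y x) * ?q y \<partial>M) \<partial>M) = (\<integral>\<^sup>+ y. ?q y \<partial>M)"
    by (intro nn_integral_cong) (simp add: nn_integral_multc nn_integral_H)
  also have "(\<integral>\<^sup>+ y. ?q y \<partial>M) + (\<integral>\<^sup>+ x. ?q x \<partial>M) = (\<integral>\<^sup>+ y. ?q y + ?q y \<partial>M)"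
    by (rule nn_integral_add[symmetric]) measurable
  also have "\<dots> = L2_norm_sq M f"
    unfolding L2_norm_sq_def by (intro nn_integral_cong) (simp flip: ennreal_plus)
  finally show ?thesis .
qed (simp add: not_less top_unique)

text \<open>Fatou's lemma removes the weights; the statement is in \<open>[0,\<infinity>]\<close>,
  with f only in L1.\<close>

lemma L2_norm_sq_transform_le:
  assumes f: "integrable M f"
  shows "L2_norm_sq M (transform f) \<le> L2_norm_sq M f"
proof -
  have [measurable]: "f \<in> borel_measurable M" using f by auto
  have "L2_norm_sq M (transform f) = (\<integral>\<^sup>+ l. liminf (\<lambda>n. ennreal (\<gamma> n l * (cmod (transform f l))\<^sup>2)) \<partial>M)"
    unfolding L2_norm_sq_def
  proof (rule nn_integral_cong)
    fix l
    have "(\<lambda>n. ennreal (\<gamma> n l * (cmod (transform f l))\<^sup>2)) \<longlonglongrightarrow> ennreal (1 * (cmod (transform f l))\<^sup>2)"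
      by (intro tendsto_intros \<gamma>_tendsto)
    from lim_imp_Liminf[OF trivial_limit_sequentially this]
    show "ennreal ((cmod (transform f l))\<^sup>2) = liminf (\<lambda>n. ennreal (\<gamma> n l * (cmod (transform f l))\<^sup>2))"
      by simp
  qed
  also have "\<dots> \<le> liminf (\<lambda>n. \<integral>\<^sup>+ l. ennreal (\<gamma> n l * (cmod (transform f l))\<^sup>2) \<partial>M)"
    by (rule nn_integral_liminf) measurable
  also have "\<dots> \<le> L2_norm_sq M f"
    by (intro Liminf_le always_eventually allI nn_integral_\<gamma>_transform_square_le f) simp
  finally show ?thesis .
qed

lemma L2_norm_sq_transform_adj_eq: "L2_norm_sq M (transform_adj f) = L2_norm_sq M (transform (\<lambda>x. cnj (f x)))"
  unfolding transform_adj_eq[abs_def] by (simp add: L2_norm_sq_def)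

lemma L2_norm_sq_transform_adj_le:
  assumes f: "integrable M f"
  shows "L2_norm_sq M (transform_adj f) \<le> L2_norm_sq M f"
  using L2_norm_sq_transform_le[of "\<lambda>x. cnj (f x)"] f
  unfolding L2_norm_sq_transform_adj_eq by (simp add: L2_norm_sq_def)

lemma mollify_AE_subseq:
  assumes f: "integrable M f"
  obtains r where "strict_mono (r :: nat \<Rightarrow> nat)" "AE x in M. (\<lambda>n. mollify (r n) f x) \<longlonglongrightarrow> f x"
proof -
  have "\<exists>r::nat \<Rightarrow> nat. strict_mono r \<and> (AE x in M. (\<lambda>n. mollify (r n) f x - f x) \<longlonglongrightarrow> 0)"
    by (rule tendsto_L1_AE_subseq[OF Bochner_Integration.integrable_diff[OF integrable_mollify[OF f] f] mollify_tendsto_L1[OF f]])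
  then show thesis
    using that by (auto simp: LIM_zero_iff)
qed

text \<open>For the lower bound, the smoothing of f is the adjoint of the weighted transform, so its
  norm is at most that of \<open>transform f\<close>. Fatou's lemma along an almost everywhere
  convergent subsequence recovers f.\<close>

theorem L2_norm_sq_transform:
  assumes f: "integrable M f"
  shows "L2_norm_sq M (transform f) = L2_norm_sq M f"
proof (rule antisym)
  have [measurable]: "f \<in> borel_measurable M" using f by auto
  obtain r where r: "AE x in M. (\<lambda>n. mollify (r n) f x) \<longlonglongrightarrow> f x"
    by (rule mollify_AE_subseq[OF f])
  have "L2_norm_sq M f = (\<integral>\<^sup>+ x. liminf (\<lambda>n. ennreal ((cmod (mollify (r n) f x))\<^sup>2)) \<partial>M)"
    unfolding L2_norm_sq_def
  proof (rule nn_integral_cong_AE)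
    show "AE x in M. ennreal ((cmod (f x))\<^sup>2) = liminf (\<lambda>n. ennreal ((cmod (mollify (r n) f x))\<^sup>2))"
      using r
    proof eventually_elim
      case (elim x)
      have "(\<lambda>n. ennreal ((cmod (mollify (r n) f x))\<^sup>2)) \<longlonglongrightarrow> ennreal ((cmod (f x))\<^sup>2)"
        by (intro tendsto_intros elim)
      then show ?case by (rule lim_imp_Liminf[OF trivial_limit_sequentially, symmetric])
    qed
  qed
  also have "\<dots> \<le> liminf (\<lambda>n. \<integral>\<^sup>+ x. ennreal ((cmod (mollify (r n) f x))\<^sup>2) \<partial>M)"
    by (rule nn_integral_liminf) measurable
  also have "\<dots> \<le> L2_norm_sq M (transform f)"
  proof (intro Liminf_le always_eventually allI)
    fix n
    let ?g = "\<lambda>l. complex_of_real (\<gamma> (r n) l) * transform f l"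
    have "(\<integral>\<^sup>+ x. ennreal ((cmod (mollify (r n) f x))\<^sup>2) \<partial>M) = L2_norm_sq M (transform_adj ?g)"
      unfolding L2_norm_sq_def by (intro nn_integral_cong) (simp add: transform_adj_\<gamma>_transform[OF f])
    also have "\<dots> \<le> L2_norm_sq M ?g"
      by (rule L2_norm_sq_transform_adj_le[OF integrable_\<gamma>_transform[OF f]])
    also have "\<dots> \<le> L2_norm_sq M (transform f)"
      unfolding L2_norm_sq_def
      by (intro nn_integral_mono ennreal_leI power_mono)
        (auto simp: norm_mult \<gamma>_nonneg \<gamma>_le_1 intro!: mult_left_le_one_le)
    finally show "(\<integral>\<^sup>+ x. ennreal ((cmod (mollify (r n) f x))\<^sup>2) \<partial>M) \<le> L2_norm_sq M (transform f)" .
  qed simp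
  finally show "L2_norm_sq M f \<le> L2_norm_sq M (transform f)" .
qed (rule L2_norm_sq_transform_le[OF f])

corollary L2_norm_sq_transform_adj:
  assumes f: "integrable M f"
  shows "L2_norm_sq M (transform_adj f) = L2_norm_sq M f"
  using L2_norm_sq_transform[of "\<lambda>x. cnj (f x)"] f
  unfolding L2_norm_sq_transform_adj_eq by (simp add: L2_norm_sq_def)

text \<open>The smoothings have two limits: f almost everywhere along a subsequence, and the
  inversion integral at every point by dominated convergence, with \<open>transform f\<close> as
  majorant.\<close>

theorem transform_inversion:
  assumes f: "integrable M f" and Ff: "integrable M (transform f)"
  shows "AE x in M. f x = transform_adj (transform f) x"
proof -
  have [measurable]: "f \<in> borel_measurable M" using f by auto
  obtain r where r: "strict_mono r" "AE x in M. (\<lambda>n. mollify (r n) f x) \<longlonglongrightarrow> f x"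
    by (rule mollify_AE_subseq[OF f])
  have lim: "(\<lambda>n. mollify n f x) \<longlonglongrightarrow> transform_adj (transform f) x" if x: "x \<in> space M" for x
  proof -
    have "(\<lambda>n. transform_adj (\<lambda>l. complex_of_real (\<gamma> n l) * transform f l) x) \<longlonglongrightarrow> transform_adj (transform f) x"
      unfolding transform_adj_def
    proof (rule integral_dominated_convergence[where w = "\<lambda>l. cmod (transform f l)"])
      show "AE l in M. (\<lambda>n. complex_of_real (\<gamma> n l) * transform f l * cnj (E l x)) \<longlonglongrightarrow> transform f l * cnj (E l x)"
      proof (rule AE_I2)
        fix l
        have "(\<lambda>n. complex_of_real (\<gamma> n l) * transform f l * cnj (E l x)) \<longlonglongrightarrow> complex_of_real 1 * transform f l * cnj (E l x)"
          by (intro tendsto_intros \<gamma>_tendsto)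
        then show "(\<lambda>n. complex_of_real (\<gamma> n l) * transform f l * cnj (E l x)) \<longlonglongrightarrow> transform f l * cnj (E l x)"
          by simp
      qed
      show "AE l in M. cmod (complex_of_real (\<gamma> n l) * transform f l * cnj (E l x)) \<le> cmod (transform f l)" for n
      proof (rule AE_I2)
        fix l
        have "\<gamma> n l * (cmod (transform f l) * cmod (E l x)) \<le> 1 * (cmod (transform f l) * 1)"
          by (intro mult_mono mult_left_mono \<gamma>_le_1 norm_E_le) (auto simp: \<gamma>_nonneg)
        then show "cmod (complex_of_real (\<gamma> n l) * transform f l * cnj (E l x)) \<le> cmod (transform f l)"
          by (simp add: norm_mult \<gamma>_nonneg mult.assoc)
      qed
      show "(\<lambda>l. transform f l * cnj (E l x)) \<in> borel_measurable M" using x by measurable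
      show "(\<lambda>l. complex_of_real (\<gamma> n l) * transform f l * cnj (E l x)) \<in> borel_measurable M" for n
        using x by measurable
    qed (use Ff in simp)
    then show ?thesis by (simp add: transform_adj_\<gamma>_transform[OF f x])
  qed
  from r(2) AE_space show ?thesis
  proof eventually_elim
    case (elim x)
    show ?case
      using LIMSEQ_unique[OF elim(1) LIMSEQ_subseq_LIMSEQ[OF lim[OF elim(2)] r(1), unfolded o_def]] .
  qed
qed

text \<open>The graph of the extended transform as a relation between representatives. It has the
  shape of the property in \<open>L2_extension\<close>, so statements about it do not depend on
  which representative is picked.\<close>

definition L2_pair :: "('a \<Rightarrow> complex) \<Rightarrow> ('a \<Rightarrow> complex) \<Rightarrow> bool" where
  "L2_pair f g \<longleftrightarrow> f \<in> L2 M \<and> g \<in> L2 M \<and>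
     (\<exists>u. (\<forall>n. u n \<in> {u. integrable M u} \<inter> L2 M) \<and> (\<lambda>n. L2_norm_sq M (\<lambda>x. u n x - f x)) \<longlonglongrightarrow> 0 \<and>
        (\<lambda>n. L2_norm_sq M (\<lambda>x. transform (u n) x - g x)) \<longlonglongrightarrow> 0)"

lemma transform_L2:
  assumes "integrable M f" "f \<in> L2 M"
  shows "transform f \<in> L2 M"
proof (rule L2_I)
  have [measurable]: "f \<in> borel_measurable M" using assms by auto
  show "transform f \<in> borel_measurable M" by measurable
  show "L2_norm_sq M (transform f) < \<infinity>"
    using assms(2) by (simp only: L2_norm_sq_transform[OF assms(1)] L2_finite)
qed

lemma L2_pair_transform:
  assumes "integrable M f" "f \<in> L2 M"
  shows "L2_pair f (transform f)"
  unfolding L2_pair_def using assms transform_L2[OF assms]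
  by (auto intro!: exI[of _ "\<lambda>_. f"] simp: L2_norm_sq_def)

lemma L2_pair_norm:
  assumes "L2_pair f g"
  shows "L2_norm_sq M f = L2_norm_sq M g"
proof -
  obtain u where u: "\<And>n. integrable M (u n)" "\<And>n. u n \<in> L2 M"
    "(\<lambda>n. L2_norm_sq M (\<lambda>x. u n x - f x)) \<longlonglongrightarrow> 0" "(\<lambda>n. L2_norm_sq M (\<lambda>x. transform (u n) x - g x)) \<longlonglongrightarrow> 0"
    and fg: "f \<in> L2 M" "g \<in> L2 M"
    using assms unfolding L2_pair_def by auto
  have "(\<lambda>n. L2_norm_sq M (u n)) \<longlonglongrightarrow> L2_norm_sq M f"
    by (intro L2_norm_sq_tendsto u fg)
  moreover have "(\<lambda>n. L2_norm_sq M (transform (u n))) \<longlonglongrightarrow> L2_norm_sq M g"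
    by (intro L2_norm_sq_tendsto transform_L2 u fg)
  ultimately show ?thesis
    using LIMSEQ_unique by (simp add: L2_norm_sq_transform[OF u(1)]) blast
qed

lemma L2_norm_sq_add_tendsto_0:
  assumes a: "(\<lambda>n. L2_norm_sq M (a n)) \<longlonglongrightarrow> 0" and b: "(\<lambda>n. L2_norm_sq M (b n)) \<longlonglongrightarrow> 0"
    and [measurable]: "\<And>n. a n \<in> borel_measurable M" "\<And>n. b n \<in> borel_measurable M"
  shows "(\<lambda>n. L2_norm_sq M (\<lambda>x. a n x + c * b n x)) \<longlonglongrightarrow> 0"
proof (rule tendsto_sandwich[OF always_eventually always_eventually tendsto_const])
  show "\<forall>n. L2_norm_sq M (\<lambda>x. a n x + c * b n x) \<le> 2 * L2_norm_sq M (a n) + 2 * (ennreal ((cmod c)\<^sup>2) * L2_norm_sq M (b n))"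
    using L2_norm_sq_add_le[of "a _" M "\<lambda>x. c * b _ x"] by (simp add: L2_norm_sq_cmult)
  have "(\<lambda>n. 2 * L2_norm_sq M (a n) + 2 * (ennreal ((cmod c)\<^sup>2) * L2_norm_sq M (b n))) \<longlonglongrightarrow>
      2 * 0 + 2 * (ennreal ((cmod c)\<^sup>2) * 0)"
    by (intro tendsto_add ennreal_tendsto_cmult a b) auto
  then show "(\<lambda>n. 2 * L2_norm_sq M (a n) + 2 * (ennreal ((cmod c)\<^sup>2) * L2_norm_sq M (b n))) \<longlonglongrightarrow> 0"
    by simp
qed simp

lemma L2_pair_add_cmult:
  assumes "L2_pair f g" "L2_pair f' g'"
  shows "L2_pair (\<lambda>x. f x + c * f' x) (\<lambda>x. g x + c * g' x)"
proof -
  obtain u where u: "\<And>n. integrable M (u n)" "\<And>n. u n \<in> L2 M"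
    "(\<lambda>n. L2_norm_sq M (\<lambda>x. u n x - f x)) \<longlonglongrightarrow> 0" "(\<lambda>n. L2_norm_sq M (\<lambda>x. transform (u n) x - g x)) \<longlonglongrightarrow> 0"
    and fg: "f \<in> L2 M" "g \<in> L2 M"
    using assms(1) unfolding L2_pair_def by auto
  obtain v where v: "\<And>n. integrable M (v n)" "\<And>n. v n \<in> L2 M"
    "(\<lambda>n. L2_norm_sq M (\<lambda>x. v n x - f' x)) \<longlonglongrightarrow> 0" "(\<lambda>n. L2_norm_sq M (\<lambda>x. transform (v n) x - g' x)) \<longlonglongrightarrow> 0"
    and fg': "f' \<in> L2 M" "g' \<in> L2 M"
    using assms(2) unfolding L2_pair_def by auto
  have [measurable]: "u n \<in> borel_measurable M" "v n \<in> borel_measurable M"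
      "f \<in> borel_measurable M" "g \<in> borel_measurable M" "f' \<in> borel_measurable M" "g' \<in> borel_measurable M" for n
    using u(2) v(2) fg fg' by (auto intro: L2_measurable)
  let ?w = "\<lambda>n x. u n x + c * v n x"
  have "(\<lambda>n. L2_norm_sq M (\<lambda>x. (u n x - f x) + c * (v n x - f' x))) \<longlonglongrightarrow> 0"
    by (rule L2_norm_sq_add_tendsto_0[OF u(3) v(3)]) measurable
  then have 1: "(\<lambda>n. L2_norm_sq M (\<lambda>x. ?w n x - (f x + c * f' x))) \<longlonglongrightarrow> 0"
    by (simp add: algebra_simps)
  have "(\<lambda>n. L2_norm_sq M (\<lambda>x. (transform (u n) x - g x) + c * (transform (v n) x - g' x))) \<longlonglongrightarrow> 0"
    by (rule L2_norm_sq_add_tendsto_0[OF u(4) v(4)]) measurable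
  moreover have "L2_norm_sq M (\<lambda>x. (transform (u n) x - g x) + c * (transform (v n) x - g' x)) =
      L2_norm_sq M (\<lambda>x. transform (?w n) x - (g x + c * g' x))" for n
    by (rule L2_norm_sq_cong) (simp add: transform_add_cmult u(1) v(1) algebra_simps)
  ultimately have 2: "(\<lambda>n. L2_norm_sq M (\<lambda>x. transform (?w n) x - (g x + c * g' x))) \<longlonglongrightarrow> 0"
    by simp
  have "?w n \<in> {u. integrable M u} \<inter> L2 M" for n
    using u(1,2) v(1,2) by (auto intro!: L2_add L2_cmult)
  moreover have "(\<lambda>x. f x + c * f' x) \<in> L2 M" "(\<lambda>x. g x + c * g' x) \<in> L2 M"
    using fg fg' by (auto intro!: L2_add L2_cmult)
  ultimately show ?thesis
    unfolding L2_pair_def using 1 2 by (auto intro!: exI[of _ ?w])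
qed

text \<open>Pairs form a linear relation that preserves norms, so polarization applies.\<close>

theorem L2_pair_Parseval:
  assumes fg: "L2_pair f g" and fg': "L2_pair f' g'"
  shows "(LINT x|M. f x * cnj (f' x)) = (LINT x|M. g x * cnj (g' x))"
  using fg fg' by (intro L2_inner_eqI L2_pair_norm[OF L2_pair_add_cmult[OF fg fg']] L2_pair_norm)
    (auto simp: L2_pair_def)

text \<open>Truncations to \<open>\<Omega> k\<close> lie in L1 by Cauchy-Schwarz and converge to f
  by dominated convergence; by the isometry their transforms form a Cauchy sequence.\<close>

lemma L2_pair_exists:
  assumes f: "f \<in> L2 M"
  shows "\<exists>g. L2_pair f g"
proof -
  have [measurable]: "f \<in> borel_measurable M" "\<Omega> k \<in> sets M" for k
    using f \<Omega>_G by (auto simp: sets_eq_G intro: L2_measurable)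
  define u where "u k x = indicator (\<Omega> k) x * f x" for k x
  have uL2: "u k \<in> L2 M" for k
  proof (rule L2_I)
    show "u k \<in> borel_measurable M" unfolding u_def[abs_def] by measurable
    have "L2_norm_sq M (u k) \<le> L2_norm_sq M f"
      unfolding L2_norm_sq_def by (intro nn_integral_mono) (auto simp: u_def indicator_def)
    then show "L2_norm_sq M (u k) < \<infinity>"
      using L2_finite[OF f] by (rule le_less_trans)
  qed
  have uint: "integrable M (u k)" for k
  proof -
    have "indicator (\<Omega> k) \<in> L2 M"
    proof (rule L2_I)
      have "L2_norm_sq M (indicator (\<Omega> k)) = (\<integral>\<^sup>+ x. indicator (\<Omega> k) x \<partial>M)"
        unfolding L2_norm_sq_def by (intro nn_integral_cong) (auto simp: indicator_def)
      then show "L2_norm_sq M (indicator (\<Omega> k)) < \<infinity>" using \<Omega>_finite[of k] by simp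
    qed measurable
    then show ?thesis unfolding u_def[abs_def] by (intro L2_mult_integrable f)
  qed
  have "(\<lambda>k. \<integral>\<^sup>+ x. ennreal ((cmod (u k x - f x))\<^sup>2) \<partial>M) \<longlonglongrightarrow> (\<integral>\<^sup>+ x. 0 \<partial>M)"
  proof (rule nn_integral_dominated_convergence[where w = "\<lambda>x. ennreal ((cmod (f x))\<^sup>2)"])
    show "AE x in M. ennreal ((cmod (u k x - f x))\<^sup>2) \<le> ennreal ((cmod (f x))\<^sup>2)" for k
      by (auto simp: u_def indicator_def)
    show "(\<integral>\<^sup>+ x. ennreal ((cmod (f x))\<^sup>2) \<partial>M) < \<infinity>"
      using L2_finite[OF f] by (simp add: L2_norm_sq_def)
    show "AE x in M. (\<lambda>k. ennreal ((cmod (u k x - f x))\<^sup>2)) \<longlonglongrightarrow> 0"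
    proof (rule AE_I2)
      fix x assume "x \<in> space M"
      then obtain i where i: "x \<in> \<Omega> i" using \<Omega>_UN by auto
      have "\<forall>\<^sub>F k in sequentially. ennreal ((cmod (u k x - f x))\<^sup>2) = 0"
        using eventually_ge_at_top[of i]
        by eventually_elim (use \<Omega>_inc i in \<open>auto simp: u_def indicator_def incseq_def\<close>)
      then show "(\<lambda>k. ennreal ((cmod (u k x - f x))\<^sup>2)) \<longlonglongrightarrow> 0"
        by (rule tendsto_eventually)
    qed
    show "(\<lambda>x. ennreal ((cmod (u k x - f x))\<^sup>2)) \<in> borel_measurable M" for k
      unfolding u_def by measurable
  qed measurable
  then have lim: "(\<lambda>k. L2_norm_sq M (\<lambda>x. u k x - f x)) \<longlonglongrightarrow> 0"
    by (simp add: L2_norm_sq_def)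
  have "\<exists>g\<in>L2 M. (\<lambda>n. L2_norm_sq M (\<lambda>x. transform (u n) x - g x)) \<longlonglongrightarrow> 0"
  proof (rule L2_complete)
    show "transform (u n) \<in> L2 M" for n by (intro transform_L2 uint uL2)
    fix e :: real assume e: "e > 0"
    then obtain N where N: "\<And>n. n \<ge> N \<Longrightarrow> L2_norm_sq M (\<lambda>x. u n x - f x) < ennreal (e / 4)"
      using order_tendstoD(2)[OF lim, of "ennreal (e / 4)"] by (auto simp: eventually_sequentially)
    have "L2_norm_sq M (\<lambda>x. transform (u m) x - transform (u n) x) \<le> ennreal e" if "m \<ge> N" "n \<ge> N" for m n
    proof -
      have "L2_norm_sq M (\<lambda>x. transform (u m) x - transform (u n) x) = L2_norm_sq M (transform (\<lambda>x. u m x + (- 1) * u n x))"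
        by (intro L2_norm_sq_cong) (simp only: transform_add_cmult[OF uint uint], simp)
      also have "\<dots> = L2_norm_sq M (\<lambda>x. u m x + (- 1) * u n x)"
        by (intro L2_norm_sq_transform Bochner_Integration.integrable_add integrable_mult_right uint)
      also have "\<dots> = L2_norm_sq M (\<lambda>x. (u m x - f x) + (f x - u n x))" by simp
      also have "\<dots> \<le> 2 * L2_norm_sq M (\<lambda>x. u m x - f x) + 2 * L2_norm_sq M (\<lambda>x. f x - u n x)"
        using uL2[THEN L2_measurable] by (intro L2_norm_sq_add_le) auto
      also have "L2_norm_sq M (\<lambda>x. f x - u n x) = L2_norm_sq M (\<lambda>x. u n x - f x)"
        by (rule L2_norm_sq_minus_commute)
      also have "2 * L2_norm_sq M (\<lambda>x. u m x - f x) + 2 * L2_norm_sq M (\<lambda>x. u n x - f x) \<le> 2 * ennreal (e / 4) + 2 * ennreal (e / 4)"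
        by (intro add_mono mult_left_mono less_imp_le N that) auto
      also have "\<dots> = ennreal (2 * (e / 4) + 2 * (e / 4))"
        using e by (simp only: ennreal_plus ennreal_mult' ennreal_numeral zero_le_numeral mult_nonneg_nonneg divide_nonneg_nonneg less_imp_le)
      also have "\<dots> = ennreal e" by simp
      finally show ?thesis .
    qed
    then show "\<exists>N. \<forall>m\<ge>N. \<forall>n\<ge>N. L2_norm_sq M (\<lambda>x. transform (u m) x - transform (u n) x) \<le> ennreal e"
      by blast
  qed
  then obtain g where "g \<in> L2 M" "(\<lambda>n. L2_norm_sq M (\<lambda>x. transform (u n) x - g x)) \<longlonglongrightarrow> 0" by blast
  then have "L2_pair f g"
    unfolding L2_pair_def using f uint uL2 lim by (auto intro!: exI[of _ u])
  then show ?thesis by blast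
qed

text \<open>Has the shape of \<open>weinstein\<close>, so that the two agree by unfolding once the
  kernel is instantiated.\<close>

definition transform_ext :: "('a \<Rightarrow> complex) \<Rightarrow> 'a \<Rightarrow> complex" where
  "transform_ext f = (if integrable M f then transform f else L2_extension M {u. integrable M u} transform f)"

theorem L2_pair_transform_ext:
  assumes f: "f \<in> L2 M"
  shows "L2_pair f (transform_ext f)"
proof (cases "integrable M f")
  case True
  then show ?thesis using L2_pair_transform f by (simp add: transform_ext_def)
next
  case False
  let ?P = "\<lambda>g. g \<in> L2 M \<and>
        (\<exists>u. (\<forall>n. u n \<in> {u. integrable M u} \<inter> L2 M) \<and>
             (\<lambda>n. L2_norm_sq M (\<lambda>x. u n x - f x)) \<longlonglongrightarrow> 0 \<and>
             (\<lambda>n. L2_norm_sq M (\<lambda>x. transform (u n) x - g x)) \<longlonglongrightarrow> 0)"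
  \<comment> \<open>Existence is what entitles the choice operator to the properties of a
    pair.\<close>
  have "\<exists>g. ?P g" using L2_pair_exists[OF f] by (auto simp: L2_pair_def)
  then have "?P (SOME g. ?P g)" by (rule someI_ex)
  then have "?P (transform_ext f)"
    using False by (simp only: transform_ext_def L2_extension_def if_False)
  then show ?thesis using f by (simp only: L2_pair_def simp_thms)
qed

end

section \<open>The Weinstein measure and its heat kernel\<close>

text \<open>
  The second factor gives no mass to \<open>(-\<infinity>, 0]\<close>, so that restricting to the half space
  does not change integrals of Borel functions.
\<close>

abbreviation weinstein_product :: "real \<Rightarrow> ('d::finite) space measure" where
  "weinstein_product \<alpha> \<equiv> fourier_measure \<Otimes>\<^sub>M bessel_measure \<alpha>"

lemma half_space_open: "open (half_space :: ('d::finite) space set)"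
  unfolding half_space_def by (intro open_Collect_less continuous_intros)

lemma half_space_borel [measurable, simp]: "(half_space :: ('d::finite) space set) \<in> sets borel"
  using half_space_open by (rule borel_open)

lemma measurable_snd_powr [measurable]:
  "(\<lambda>x :: ('d::finite) space. ennreal (snd x powr a / c)) \<in> borel_measurable borel"
  unfolding borel_prod[symmetric] by measurable

lemma measurable_half_space_density:
  "(\<lambda>x :: ('d::finite) space. indicator half_space x * ennreal (snd x powr a / c)) \<in> borel_measurable borel"
  by (rule borel_measurable_times_ennreal[OF borel_measurable_indicator[OF half_space_borel] measurable_snd_powr])

lemma weinstein_product_eq:
  assumes \<alpha>: "\<alpha> > - 1 / 2"
  shows "(weinstein_product \<alpha> :: ('d::finite) space measure) = density lborel (\<lambda>x. indicator half_space x *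
     ennreal (snd x powr (2 * \<alpha> + 1) / ((2 * pi) powr (real CARD('d) / 2) * 2 powr \<alpha> * Gamma (\<alpha> + 1))))"
proof -
  have G: "Gamma (\<alpha> + 1) > 0" using \<alpha> by (intro Gamma_real_pos) auto
  have m: "(\<lambda>(x, t). ennreal ((2 * pi) powr - (real DIM(real ^ 'd) / 2)) * ennreal (bessel_density \<alpha> t)) \<in> borel_measurable (borel :: 'd space measure)"
    unfolding borel_prod[symmetric] by measurable
  have "(weinstein_product \<alpha> :: 'd space measure) =
    density (lborel \<Otimes>\<^sub>M lborel) (\<lambda>(x, t). ennreal ((2 * pi) powr - (real DIM(real ^ 'd) / 2)) * ennreal (bessel_density \<alpha> t))"
    unfolding fourier_measure_def bessel_measure_def
    using sigma_finite_bessel_measure[of \<alpha>] sigma_finite_lborel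
    by (intro pair_measure_density) (auto simp: bessel_measure_def)
  also have "\<dots> = density lborel (\<lambda>(x, t). ennreal ((2 * pi) powr - (real DIM(real ^ 'd) / 2)) * ennreal (bessel_density \<alpha> t))"
    by (simp only: lborel_prod)
  also have "\<dots> = density lborel (\<lambda>x. indicator half_space x *
     ennreal (snd x powr (2 * \<alpha> + 1) / ((2 * pi) powr (real CARD('d) / 2) * 2 powr \<alpha> * Gamma (\<alpha> + 1))))"
  proof (intro density_cong AE_I2)
    fix x :: "'d space"
    show "(case x of (x, t) \<Rightarrow> ennreal ((2 * pi) powr - (real DIM(real ^ 'd) / 2)) * ennreal (bessel_density \<alpha> t)) =
      indicator half_space x * ennreal (snd x powr (2 * \<alpha> + 1) / ((2 * pi) powr (real CARD('d) / 2) * 2 powr \<alpha> * Gamma (\<alpha> + 1)))"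
    proof (cases "snd x > 0")
      case True
      have "(2 * pi) powr - (real CARD('d) / 2) * (snd x powr (2 * \<alpha> + 1) / (2 powr \<alpha> * Gamma (\<alpha> + 1))) =
          snd x powr (2 * \<alpha> + 1) / ((2 * pi) powr (real CARD('d) / 2) * 2 powr \<alpha> * Gamma (\<alpha> + 1))"
        by (simp only: powr_minus_divide times_divide_times_eq mult_1_left mult.assoc)
      with True show ?thesis
        by (cases x) (simp add: half_space_def bessel_density_def flip: ennreal_mult')
    next
      case False
      then show ?thesis
        by (cases x) (simp add: half_space_def bessel_density_def)
    qed
  qed (simp_all only: measurable_lborel2 m measurable_half_space_density)
  finally show ?thesis .
qed

lemma weinstein_measure_eq:
  assumes \<alpha>: "\<alpha> > - 1 / 2"
  shows "weinstein_measure \<alpha> = restrict_space (weinstein_product \<alpha>) (half_space :: ('d::finite) space set)"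
proof -
  let ?w = "\<lambda>x :: 'd space. ennreal (snd x powr (2 * \<alpha> + 1) / ((2 * pi) powr (real CARD('d) / 2) * 2 powr \<alpha> * Gamma (\<alpha> + 1)))"
  have "restrict_space (weinstein_product \<alpha>) half_space = restrict_space (density lborel (\<lambda>x. indicator half_space x * ?w x)) half_space"
    by (simp only: weinstein_product_eq[OF \<alpha>])
  also have "\<dots> = density (restrict_space lborel half_space) ?w"
  proof (rule measure_eqI)
    fix A assume "A \<in> sets (restrict_space (density lborel (\<lambda>x. indicator half_space x * ?w x)) half_space)"
    then have A: "A \<in> sets borel" "A \<subseteq> half_space"
      by (auto simp: sets_restrict_space_iff)
    have "emeasure (restrict_space (density lborel (\<lambda>x. indicator half_space x * ?w x)) half_space) A =
      emeasure (density lborel (\<lambda>x. indicator half_space x * ?w x)) A"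
      using A by (simp add: emeasure_restrict_space)
    also have "\<dots> = (\<integral>\<^sup>+ x. (indicator half_space x * ?w x) * indicator A x \<partial>lborel)"
      using A by (intro emeasure_density) (simp_all only: measurable_lborel2 sets_lborel measurable_half_space_density)
    also have "\<dots> = (\<integral>\<^sup>+ x. (?w x * indicator A x) * indicator half_space x \<partial>lborel)"
      by (simp only: mult_ac)
    also have "\<dots> = (\<integral>\<^sup>+ x. ?w x * indicator A x \<partial>restrict_space lborel half_space)"
      by (rule nn_integral_restrict_space[symmetric]) simp
    also have "\<dots> = emeasure (density (restrict_space lborel half_space) ?w) A"
      using A by (intro emeasure_density[symmetric])
        (auto simp: sets_restrict_space_iff intro!: measurable_restrict_space1)
    finally show "emeasure (restrict_space (density lborel (\<lambda>x. indicator half_space x * ?w x)) half_space) A =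
      emeasure (density (restrict_space lborel half_space) ?w) A" .
  qed (auto simp: sets_restrict_space)
  finally show ?thesis
    by (simp add: weinstein_measure_def)
qed

lemma sets_weinstein_measure: "sets (weinstein_measure \<alpha> :: ('d::finite) space measure) = sets (restrict_space borel half_space)"
  by (simp add: weinstein_measure_def sets_restrict_space)

lemma space_weinstein_measure [simp]: "space (weinstein_measure \<alpha> :: ('d::finite) space measure) = half_space"
  by (simp add: weinstein_measure_def space_restrict_space)

lemma measurable_weinstein_borel:
  "f \<in> N \<rightarrow>\<^sub>M (weinstein_measure \<alpha> :: ('d::finite) space measure) \<Longrightarrow> f \<in> N \<rightarrow>\<^sub>M borel"
  by (subst (asm) measurable_cong_sets[OF refl sets_weinstein_measure]) (rule measurable_restrict_space2_iff[THEN iffD1, THEN conjunct1])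

lemma borel_measurable_weinsteinI:
  "f \<in> borel_measurable borel \<Longrightarrow> f \<in> borel_measurable (weinstein_measure \<alpha> :: ('d::finite) space measure)"
  by (subst measurable_cong_sets[OF sets_weinstein_measure refl]) (rule measurable_restrict_space1)

lemma sets_weinstein_product [simp]: "sets (weinstein_product \<alpha> :: ('d::finite) space measure) = sets borel"
  by (simp add: borel_prod[symmetric] cong: sets_pair_measure_cong)

lemma AE_weinstein_product:
  assumes \<alpha>: "\<alpha> > - 1 / 2"
  shows "AE x in (weinstein_product \<alpha> :: ('d::finite) space measure). x \<in> half_space"
  unfolding weinstein_product_eq[OF \<alpha>]
proof (subst AE_density)
  show "(\<lambda>x :: 'd space. indicator half_space x *
     ennreal (snd x powr (2 * \<alpha> + 1) / ((2 * pi) powr (real CARD('d) / 2) * 2 powr \<alpha> * Gamma (\<alpha> + 1))))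
    \<in> borel_measurable lborel"
    by (simp only: measurable_lborel2 measurable_half_space_density)
qed (auto simp: indicator_def)

lemma
  fixes f :: "('d::finite) space \<Rightarrow> 'b :: {banach, second_countable_topology}"
  assumes \<alpha>: "\<alpha> > - 1 / 2" and f: "f \<in> borel_measurable borel"
  shows integrable_weinstein_iff: "integrable (weinstein_measure \<alpha>) f \<longleftrightarrow> integrable (weinstein_product \<alpha>) f"
    and integral_weinstein_eq: "(LINT x|weinstein_measure \<alpha>. f x) = (LINT x|weinstein_product \<alpha>. f x)"
proof -
  have h: "half_space \<inter> space (weinstein_product \<alpha> :: 'd space measure) \<in> sets (weinstein_product \<alpha>)"
    by (subst sets_weinstein_product) (simp add: space_pair_measure)
  have m: "f \<in> borel_measurable (weinstein_product \<alpha>)" "(\<lambda>x. indicator half_space x *\<^sub>R f x) \<in> borel_measurable (weinstein_product \<alpha>)"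
    using f by (auto simp: measurable_cong_sets[OF sets_weinstein_product refl])
  have ae: "AE x in weinstein_product \<alpha>. indicator half_space x *\<^sub>R f x = f x"
    using AE_weinstein_product[OF \<alpha>] by eventually_elim simp
  show "integrable (weinstein_measure \<alpha>) f \<longleftrightarrow> integrable (weinstein_product \<alpha>) f"
    unfolding weinstein_measure_eq[OF \<alpha>] integrable_restrict_space[OF h]
    by (rule integrable_cong_AE[OF m(2,1) ae])
  show "(LINT x|weinstein_measure \<alpha>. f x) = (LINT x|weinstein_product \<alpha>. f x)"
    unfolding weinstein_measure_eq[OF \<alpha>] integral_restrict_space[OF h]
    by (rule integral_cong_AE[OF m(2,1) ae])
qed

lemma
  fixes g :: "real ^ ('d::finite) \<Rightarrow> 'c :: {real_normed_field, banach, second_countable_topology}" and h :: "real \<Rightarrow> 'c"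
  assumes \<alpha>: "\<alpha> > - 1 / 2" and g: "integrable fourier_measure g" and h: "integrable (bessel_measure \<alpha>) h"
  shows integrable_weinstein_times: "integrable (weinstein_measure \<alpha>) (\<lambda>x. g (fst x) * h (snd x))"
    and integral_weinstein_times: "(LINT x|weinstein_measure \<alpha>. g (fst x) * h (snd x)) =
      (LINT y|fourier_measure. g y) * (LINT t|bessel_measure \<alpha>. h t)"
proof -
  interpret pair_sigma_finite "fourier_measure :: (real ^ 'd) measure" "bessel_measure \<alpha>"
    by (intro pair_sigma_finite.intro sigma_finite_fourier_measure sigma_finite_bessel_measure)
  have [measurable]: "g \<in> borel_measurable borel" "h \<in> borel_measurable borel"
    using borel_measurable_integrable[OF g] borel_measurable_integrable[OF h] by simp_all
  have m: "(\<lambda>x. g (fst x) * h (snd x)) \<in> borel_measurable borel"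
    unfolding borel_prod[symmetric] by measurable
  have int: "integrable (weinstein_product \<alpha>) (\<lambda>x. g (fst x) * h (snd x))"
    using integrable_product[OF g h] by (simp only: case_prod_unfold)
  show "integrable (weinstein_measure \<alpha>) (\<lambda>x. g (fst x) * h (snd x))"
    unfolding integrable_weinstein_iff[OF \<alpha> m] by (rule int)
  show "(LINT x|weinstein_measure \<alpha>. g (fst x) * h (snd x)) = (LINT y|fourier_measure. g y) * (LINT t|bessel_measure \<alpha>. h t)"
    unfolding integral_weinstein_eq[OF \<alpha> m]
    by (subst integral_fst'[OF int, symmetric]) simp
qed

lemma sigma_finite_weinstein_measure:
  "sigma_finite_measure (weinstein_measure \<alpha> :: ('d::finite) space measure)"
proof -
  have "sigma_finite_measure (restrict_space lborel (half_space :: 'd space set))"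
    by (intro sigma_finite_measure_restrict_space sigma_finite_lborel) simp
  then show ?thesis
    unfolding weinstein_measure_def
    by (subst sigma_finite_measure.sigma_finite_iff_density_finite)
      (auto intro!: measurable_restrict_space1)
qed

section \<open>Gaussian weights and the heat kernel on the half space\<close>

definition gauss_weight :: "nat \<Rightarrow> ('d::finite) space \<Rightarrow> real" where
  "gauss_weight n l = exp (- inverse (real (Suc n)) * (norm (fst l))\<^sup>2 / 2) * exp (- inverse (real (Suc n)) * (snd l)\<^sup>2 / 2)"

definition weinstein_heat :: "real \<Rightarrow> nat \<Rightarrow> ('d::finite) space \<Rightarrow> 'd space \<Rightarrow> real" where
  "weinstein_heat \<alpha> n x y = fourier_heat (inverse (real (Suc n))) (fst x) (fst y) * bessel_heat \<alpha> (inverse (real (Suc n))) (snd x) (snd y)"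

lemma integrable_gauss_weight:
  assumes "\<alpha> > - 1 / 2"
  shows "integrable (weinstein_measure \<alpha>) (gauss_weight n :: ('d::finite) space \<Rightarrow> real)"
  unfolding gauss_weight_def[abs_def]
  by (intro integrable_weinstein_times integrable_fourier_gaussian_real integrable_gaussian_bessel_measure assms) simp_all

lemma gauss_weight_tendsto: "(\<lambda>n. gauss_weight n l) \<longlonglongrightarrow> 1"
proof -
  have "(\<lambda>n. gauss_weight n l) \<longlonglongrightarrow> exp (- 0 * (norm (fst l))\<^sup>2 / 2) * exp (- 0 * (snd l)\<^sup>2 / 2)"
    unfolding gauss_weight_def by (intro tendsto_intros LIMSEQ_inverse_real_of_nat) auto
  then show ?thesis by simp
qed

lemma measurable_weinstein_kernel:
  assumes \<alpha>: "\<alpha> > - 1 / 2"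
  shows "(\<lambda>(l, x). weinstein_kernel \<alpha> l x) \<in> borel_measurable (borel \<Otimes>\<^sub>M borel)"
proof -
  have [measurable]: "norm_bessel \<alpha> \<in> borel_measurable borel"
    by (rule measurable_norm_bessel[OF \<alpha>])
  show ?thesis unfolding weinstein_kernel_def borel_prod[symmetric] by measurable
qed

lemma measurable_weinstein_heat:
  assumes \<alpha>: "\<alpha> > - 1 / 2"
  shows "(\<lambda>(x, y). weinstein_heat \<alpha> n x y) \<in> borel_measurable (borel \<Otimes>\<^sub>M borel)"
proof -
  have [measurable]: "bessel_series \<alpha> \<in> borel_measurable borel"
    by (rule measurable_bessel_series[OF \<alpha>])
  show ?thesis unfolding weinstein_heat_def fourier_heat_def bessel_heat_def borel_prod[symmetric] by measurable
qed

lemma measurable_pair_weinsteinI: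
  assumes "f \<in> borel_measurable (borel \<Otimes>\<^sub>M borel)"
  shows "f \<in> borel_measurable (weinstein_measure \<alpha> \<Otimes>\<^sub>M (weinstein_measure \<alpha> :: ('d::finite) space measure))"
proof -
  have "(\<lambda>p. (fst p, snd p)) \<in> weinstein_measure \<alpha> \<Otimes>\<^sub>M (weinstein_measure \<alpha> :: 'd space measure) \<rightarrow>\<^sub>M borel \<Otimes>\<^sub>M borel"
    by (intro measurable_Pair measurable_weinstein_borel[OF measurable_fst] measurable_weinstein_borel[OF measurable_snd])
  from measurable_compose[OF this assms] show ?thesis by simp
qed

lemma norm_weinstein_kernel_le:
  assumes \<alpha>: "\<alpha> > - 1 / 2"
  shows "cmod (weinstein_kernel \<alpha> l x) \<le> 1"
proof -
  have "cmod (exp (- \<i> * complex_of_real (fst x \<bullet> fst l))) = 1"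
    by (simp add: norm_exp_eq_Re)
  then show ?thesis
    unfolding weinstein_kernel_def norm_mult using abs_norm_bessel_le_1[OF \<alpha>] by simp
qed

lemma weinstein_kernel_commute: "weinstein_kernel \<alpha> x y = weinstein_kernel \<alpha> y x"
  by (simp add: weinstein_kernel_def inner_commute mult.commute)

text \<open>Conjugating the kernel at y merges the two characters into one at
  \<open>fst x - fst y\<close>, after which the integral splits into a Fourier factor and a Bessel
  factor.\<close>

lemma weinstein_heat_eq:
  fixes x y :: "('d::finite) space"
  assumes \<alpha>: "\<alpha> > - 1 / 2"
  shows "complex_of_real (weinstein_heat \<alpha> n x y) =
    (LINT l|weinstein_measure \<alpha>. complex_of_real (gauss_weight n l) * weinstein_kernel \<alpha> l x * cnj (weinstein_kernel \<alpha> l y))"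
proof -
  let ?e = "inverse (real (Suc n))"
  let ?g = "\<lambda>l. complex_of_real (exp (- ?e * (norm l)\<^sup>2 / 2)) * exp (- \<i> * complex_of_real ((fst x - fst y) \<bullet> l))"
  let ?h = "\<lambda>t. exp (- ?e * t\<^sup>2 / 2) * (norm_bessel \<alpha> (snd x * t) * norm_bessel \<alpha> (snd y * t))"
  have e: "?e > 0" by simp
  have [measurable]: "norm_bessel \<alpha> \<in> borel_measurable borel"
    by (rule measurable_norm_bessel[OF \<alpha>])
  have h: "integrable (bessel_measure \<alpha>) ?h"
  proof (rule Bochner_Integration.integrable_bound[OF integrable_gaussian_bessel_measure[OF \<alpha> e]])
    show "AE t in bessel_measure \<alpha>. norm (?h t) \<le> norm (exp (- ?e * t\<^sup>2 / 2))"
      using abs_norm_bessel_le_1[OF \<alpha>] by (intro AE_I2) (auto simp: abs_mult intro!: mult_left_le mult_le_one)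
  qed measurable
  have "(LINT l|weinstein_measure \<alpha>. complex_of_real (gauss_weight n l) * weinstein_kernel \<alpha> l x * cnj (weinstein_kernel \<alpha> l y)) =
    (LINT l|weinstein_measure \<alpha>. ?g (fst l) * complex_of_real (?h (snd l)))"
  proof (intro Bochner_Integration.integral_cong refl)
    fix l :: "'d space"
    have e: "exp (- \<i> * complex_of_real (fst x \<bullet> fst l)) * cnj (exp (- \<i> * complex_of_real (fst y \<bullet> fst l))) =
        exp (- \<i> * complex_of_real ((fst x - fst y) \<bullet> fst l))"
      by (simp add: exp_cnj inner_diff_left algebra_simps flip: exp_add)
    show "complex_of_real (gauss_weight n l) * weinstein_kernel \<alpha> l x * cnj (weinstein_kernel \<alpha> l y) =
      ?g (fst l) * complex_of_real (?h (snd l))"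
      unfolding weinstein_kernel_def gauss_weight_def complex_cnj_mult complex_cnj_complex_of_real of_real_mult e[symmetric]
      by (simp only: mult_ac)
  qed
  also have "\<dots> = (LINT l|fourier_measure. ?g l) * (LINT t|bessel_measure \<alpha>. complex_of_real (?h t))"
    by (intro integral_weinstein_times \<alpha> integrable_fourier_gaussian e integrable_of_real h)
  also have "\<dots> = complex_of_real (weinstein_heat \<alpha> n x y)"
    unfolding integral_fourier_gaussian[OF e] integral_complex_of_real bessel_heat_eq_integral[OF \<alpha> e]
    by (simp only: weinstein_heat_def fourier_heat_def of_real_mult)
  finally show ?thesis ..
qed

text \<open>The parameters r and s are kept separate because the test function of the concentration
  argument treats the two groups of coordinates differently; r = s = 0 is the total mass.\<close>

lemma
  fixes x :: "('d::finite) space"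
  assumes \<alpha>: "\<alpha> > - 1 / 2" and s: "r \<ge> 0" "s \<ge> 0"
  defines "e \<equiv> \<lambda>n. inverse (real (Suc n))"
  shows integrable_weinstein_heat: "integrable (weinstein_measure \<alpha>)
      (\<lambda>y. exp (- r * (norm (fst y - fst x))\<^sup>2 / 2) * exp (- s * (snd y)\<^sup>2 / 2) * weinstein_heat \<alpha> n x y)" (is ?th1)
    and integral_weinstein_heat: "(LINT y|weinstein_measure \<alpha>.
      exp (- r * (norm (fst y - fst x))\<^sup>2 / 2) * exp (- s * (snd y)\<^sup>2 / 2) * weinstein_heat \<alpha> n x y) =
      (1 + r * e n) powr - (real CARD('d) / 2) * ((1 + s * e n) powr - (\<alpha> + 1) * exp (- s * (snd x)\<^sup>2 / (2 * (1 + s * e n))))" (is ?th2)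
proof -
  have e: "e n > 0" by (simp add: e_def)
  have eq: "exp (- r * (norm (fst y - fst x))\<^sup>2 / 2) * exp (- s * (snd y)\<^sup>2 / 2) * weinstein_heat \<alpha> n x y =
      (exp (- r * (norm (fst y - fst x))\<^sup>2 / 2) * fourier_heat (e n) (fst x) (fst y)) *
      (exp (- s * (snd y)\<^sup>2 / 2) * bessel_heat \<alpha> (e n) (snd x) (snd y))" for y
    by (simp add: weinstein_heat_def e_def mult_ac)
  show ?th1
    unfolding eq by (intro integrable_weinstein_times \<alpha> integrable_fourier_heat integrable_bessel_heat e s)
  show ?th2
    unfolding eq integral_weinstein_times[OF \<alpha> integrable_fourier_heat[OF e s(1)] integrable_bessel_heat[OF \<alpha> e s(2)]]
      integral_fourier_heat[OF e s(1)] integral_bessel_heat[OF \<alpha> e s(2)] by simp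
qed

abbreviation half_space_opens :: "('d::finite) space set set" where
  "half_space_opens \<equiv> {A. open A \<and> A \<subseteq> half_space}"

text \<open>The half space is open, so the traces of open sets on it are exactly its open
  subsets.\<close>

lemma sets_weinstein_measure_opens:
  "sets (weinstein_measure \<alpha> :: ('d::finite) space measure) = sigma_sets half_space half_space_opens"
proof -
  have b: "sets (borel :: 'd space measure) = sigma_sets UNIV {S. open S}"
    by (simp add: borel_def)
  have "sets (weinstein_measure \<alpha> :: 'd space measure) = (\<inter>) half_space ` sigma_sets UNIV {S. open S}"
    unfolding sets_weinstein_measure sets_restrict_space b ..
  also have "\<dots> = sigma_sets half_space ((\<inter>) half_space ` {S. open S})"
    using half_space_borel[where 'd = 'd, unfolded b] by (rule sigma_sets_Int) simp
  also have "(\<inter>) half_space ` {S. open S} = (half_space_opens :: 'd space set set)"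
    using half_space_open by (auto intro: image_eqI[of _ "(\<inter>) half_space"])
  finally show ?thesis .
qed

text \<open>
  The function integrated against the heat kernel below vanishes at \<open>x\<close> and is bounded away from
  \<open>0\<close> outside any neighbourhood of \<open>x\<close>, and its integrals are explicit: a Chebyshev-type
  inequality then gives concentration at \<open>x\<close>.
\<close>

definition separation :: "('d::finite) space \<Rightarrow> 'd space \<Rightarrow> real" where
  "separation x y = 1 - exp (- (norm (fst y - fst x))\<^sup>2 / 2) + (exp (- (snd y)\<^sup>2 / 2) - exp (- (snd x)\<^sup>2 / 2))\<^sup>2"

text \<open>Outside a product neighbourhood of x either the first coordinates or the last one differ
  by a fixed amount. Each summand of \<open>separation\<close> is nonnegative and detects one of
  these cases.\<close>

lemma separation_bounded_below:
  fixes x :: "('d::finite) space"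
  assumes A: "open A" "A \<subseteq> half_space" and x: "x \<in> A"
  obtains c where "c > 0" "\<And>y. y \<in> half_space - A \<Longrightarrow> c \<le> separation x y"
proof -
  obtain U V where UV: "open U" "open V" "x \<in> U \<times> V" "U \<times> V \<subseteq> A"
    using open_prod_elim[OF A(1) x] by blast
  obtain d1 where d1: "d1 > 0" "ball (fst x) d1 \<subseteq> U"
    using UV(1,3) openE[of U "fst x"] by (auto simp: mem_Times_iff)
  obtain d2 where d2: "d2 > 0" "ball (snd x) d2 \<subseteq> V"
    using UV(2,3) openE[of V "snd x"] by (auto simp: mem_Times_iff)
  have x0: "snd x > 0" using A(2) x by (auto simp: half_space_def)
  \<comment> \<open>Keeping d at most \<open>snd x\<close> leaves \<open>snd x - d\<close> in the
    range where the Gaussian is decreasing.\<close>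
  define d where "d = min d2 (snd x)"
  have d: "d > 0" "d \<le> snd x" "d \<le> d2" using d2 x0 by (auto simp: d_def)
  let ?g = "\<lambda>t::real. exp (- t\<^sup>2 / 2)"
  \<comment> \<open>The three constants bound the cases where the first coordinates are far apart,
    where the last coordinate of y is larger, and where it is smaller.\<close>
  define c1 where "c1 = 1 - ?g d1"
  define c2 where "c2 = (?g (snd x) - ?g (snd x + d))\<^sup>2"
  define c3 where "c3 = (?g (snd x - d) - ?g (snd x))\<^sup>2"
  have mono: "?g s < ?g t" if "0 \<le> t" "t < s" for s t
    using that by (simp add: power_strict_mono)
  have mono': "?g s \<le> ?g t" if "0 \<le> t" "t \<le> s" for s t
    using that by (simp add: power_mono)
  have pos: "c1 > 0" "c2 > 0" "c3 > 0"
    unfolding c1_def c2_def c3_def using mono[of "snd x" "snd x + d"] mono[of "snd x - d" "snd x"] d x0 d1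
    by auto
  show thesis
  proof (rule that[of "min c1 (min c2 c3)"])
    show "min c1 (min c2 c3) > 0" using pos by simp
    fix y :: "'d space" assume y: "y \<in> half_space - A"
    then have y0: "snd y > 0" by (simp add: half_space_def)
    have le1: "0 \<le> 1 - exp (- (norm (fst y - fst x))\<^sup>2 / 2)" by simp
    have "\<not> (dist (fst x) (fst y) < d1 \<and> dist (snd x) (snd y) < d2)"
      using y UV(4) d1(2) d2(2) by (cases y) (auto simp: subset_iff)
    then consider "d1 \<le> norm (fst y - fst x)" | "d \<le> \<bar>snd y - snd x\<bar>"
      using d by (auto simp: dist_norm norm_minus_commute dist_real_def)
    then show "min c1 (min c2 c3) \<le> separation x y"
    proof cases
      case 1
      have "exp (- (norm (fst y - fst x))\<^sup>2 / 2) \<le> ?g d1"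
        using mono'[of d1 "norm (fst y - fst x)"] d1 1 by simp
      then have "c1 \<le> separation x y"
        unfolding separation_def c1_def by (intro add_increasing2) auto
      then show ?thesis by simp
    next
      case 2
      show ?thesis
      proof (cases "snd y \<ge> snd x")
        case True
        then have "?g (snd y) \<le> ?g (snd x + d)" using 2 x0 d by (intro mono') auto
        moreover have "?g (snd x + d) < ?g (snd x)" using d x0 by (intro mono) auto
        ultimately have "c2 \<le> (?g (snd x) - ?g (snd y))\<^sup>2"
          unfolding c2_def by (intro power_mono) auto
        then have "c2 \<le> separation x y"
          unfolding separation_def power2_commute[of "?g (snd y)"] using le1 by linarith
        then show ?thesis by simp
      next
        case False
        then have "?g (snd x - d) \<le> ?g (snd y)" using 2 y0 d by (intro mono') auto
        moreover have "?g (snd x) < ?g (snd x - d)" using d x0 by (intro mono) auto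
        ultimately have "c3 \<le> (?g (snd y) - ?g (snd x))\<^sup>2"
          unfolding c3_def by (intro power_mono) auto
        then have "c3 \<le> separation x y"
          unfolding separation_def using le1 by linarith
        then show ?thesis by simp
      qed
    qed
  qed
qed

lemma weinstein_heat_nonneg: "\<alpha> > - 1 / 2 \<Longrightarrow> 0 \<le> weinstein_heat \<alpha> n x y"
  by (simp add: weinstein_heat_def fourier_heat_nonneg bessel_heat_nonneg)

lemma weinstein_heat_mass:
  assumes \<alpha>: "\<alpha> > - 1 / 2"
  shows "integrable (weinstein_measure \<alpha>) (weinstein_heat \<alpha> n x)"
    and "(LINT y|weinstein_measure \<alpha>. weinstein_heat \<alpha> n x y) = 1"
  using integrable_weinstein_heat[OF \<alpha>, of 0 0 x n] integral_weinstein_heat[OF \<alpha>, of 0 0 x n] by simp_all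

lemma separation_nonneg: "0 \<le> separation x y"
  unfolding separation_def by (intro add_nonneg_nonneg) auto

text \<open>Expanding the square turns \<open>separation\<close> into a combination of Gaussians
  with known heat integrals. Writing a for the Gaussian at \<open>snd x\<close>, the limit is (1 +
  a^2) - 1 + a^2 - 2 a a = 0.\<close>

lemma
  fixes x :: "('d::finite) space"
  assumes \<alpha>: "\<alpha> > - 1 / 2"
  shows integrable_weinstein_heat_separation:
      "integrable (weinstein_measure \<alpha>) (\<lambda>y. separation x y * weinstein_heat \<alpha> n x y)"
    and weinstein_heat_separation_tendsto:
      "(\<lambda>n. LINT y|weinstein_measure \<alpha>. separation x y * weinstein_heat \<alpha> n x y) \<longlonglongrightarrow> 0"
proof -
  let ?g = "\<lambda>r s n y. exp (- r * (norm (fst y - fst x))\<^sup>2 / 2) * exp (- s * (snd y)\<^sup>2 / 2) * weinstein_heat \<alpha> n x y"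
  let ?e = "\<lambda>n. inverse (real (Suc n))"
  let ?I = "\<lambda>r s n. (1 + r * ?e n) powr - (real CARD('d) / 2) * ((1 + s * ?e n) powr - (\<alpha> + 1) * exp (- s * (snd x)\<^sup>2 / (2 * (1 + s * ?e n))))"
  let ?a = "exp (- (snd x)\<^sup>2 / 2)"
  have eq: "separation x y * weinstein_heat \<alpha> n x y =
      (1 + ?a\<^sup>2) * ?g 0 0 n y - ?g 1 0 n y + ?g 0 2 n y - 2 * ?a * ?g 0 1 n y" for n y
  proof -
    have "(exp (- (snd y)\<^sup>2 / 2))\<^sup>2 = exp (- 2 * (snd y)\<^sup>2 / 2)"
      by (simp add: power2_eq_square flip: exp_add)
    then show ?thesis
      unfolding separation_def power2_diff by (simp add: algebra_simps)
  qed
  have int: "integrable (weinstein_measure \<alpha>) (?g r s n)" if "r \<ge> 0" "s \<ge> 0" for r s n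
    by (rule integrable_weinstein_heat[OF \<alpha> that])
  have I: "(LINT y|weinstein_measure \<alpha>. ?g r s n y) = ?I r s n" if "r \<ge> 0" "s \<ge> 0" for r s n
    by (rule integral_weinstein_heat[OF \<alpha> that])
  show "integrable (weinstein_measure \<alpha>) (\<lambda>y. separation x y * weinstein_heat \<alpha> n x y)"
    unfolding eq by (intro Bochner_Integration.integrable_add Bochner_Integration.integrable_diff integrable_mult_right int) simp_all
  have "(LINT y|weinstein_measure \<alpha>. separation x y * weinstein_heat \<alpha> n x y) =
      (1 + ?a\<^sup>2) * ?I 0 0 n - ?I 1 0 n + ?I 0 2 n - 2 * ?a * ?I 0 1 n" for n
  proof -
    have "(LINT y|weinstein_measure \<alpha>. separation x y * weinstein_heat \<alpha> n x y) =
      (1 + ?a\<^sup>2) * (LINT y|weinstein_measure \<alpha>. ?g 0 0 n y) - (LINT y|weinstein_measure \<alpha>. ?g 1 0 n y)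
       + (LINT y|weinstein_measure \<alpha>. ?g 0 2 n y) - 2 * ?a * (LINT y|weinstein_measure \<alpha>. ?g 0 1 n y)"
    proof -
      note i = integrable_mult_right[OF int[of 0 0 n], of "1 + ?a\<^sup>2"] int[of 1 0 n] int[of 0 2 n]
        integrable_mult_right[OF int[of 0 1 n], of "2 * ?a"]
      show ?thesis
        unfolding eq
        by (simp only: Bochner_Integration.integral_add[OF Bochner_Integration.integrable_diff[OF i(1,2)] i(3)]
            Bochner_Integration.integral_diff[OF i(1,2)]
            Bochner_Integration.integral_diff[OF Bochner_Integration.integrable_add[OF Bochner_Integration.integrable_diff[OF i(1,2)] i(3)] i(4)]
            integral_mult_right_zero order_refl zero_le_one zero_le_numeral)
    qed
    then show ?thesis by (simp only: I order_refl zero_le_one zero_le_numeral)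
  qed
  moreover have "(\<lambda>n. (1 + ?a\<^sup>2) * ?I 0 0 n - ?I 1 0 n + ?I 0 2 n - 2 * ?a * ?I 0 1 n) \<longlonglongrightarrow> 0"
  proof -
    have Ilim: "(\<lambda>n. ?I r s n) \<longlonglongrightarrow> exp (- s * (snd x)\<^sup>2 / 2)" for r s
    proof -
      have "(\<lambda>n. ?I r s n) \<longlonglongrightarrow> (1 + r * 0) powr - (real CARD('d) / 2) * ((1 + s * 0) powr - (\<alpha> + 1) * exp (- s * (snd x)\<^sup>2 / (2 * (1 + s * 0))))"
        by (intro tendsto_intros LIMSEQ_inverse_real_of_nat) auto
      then show ?thesis by simp
    qed
    have "(\<lambda>n. (1 + ?a\<^sup>2) * ?I 0 0 n - ?I 1 0 n + ?I 0 2 n - 2 * ?a * ?I 0 1 n) \<longlonglongrightarrow>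
        (1 + ?a\<^sup>2) * exp (- 0 * (snd x)\<^sup>2 / 2) - exp (- 0 * (snd x)\<^sup>2 / 2) + exp (- 2 * (snd x)\<^sup>2 / 2) - 2 * ?a * exp (- 1 * (snd x)\<^sup>2 / 2)"
      by (intro tendsto_add tendsto_diff tendsto_mult tendsto_const Ilim)
    also have "(1 + ?a\<^sup>2) * exp (- 0 * (snd x)\<^sup>2 / 2) - exp (- 0 * (snd x)\<^sup>2 / 2) + exp (- 2 * (snd x)\<^sup>2 / 2) - 2 * ?a * exp (- 1 * (snd x)\<^sup>2 / 2) = 0"
      by (simp add: power2_eq_square flip: exp_add)
    finally show ?thesis .
  qed
  ultimately show "(\<lambda>n. LINT y|weinstein_measure \<alpha>. separation x y * weinstein_heat \<alpha> n x y) \<longlonglongrightarrow> 0"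
    by (simp only:)
qed

lemma weinstein_heat_concentrated:
  fixes x :: "('d::finite) space"
  assumes \<alpha>: "\<alpha> > - 1 / 2" and A: "A \<in> half_space_opens" and x: "x \<in> A"
  shows "(\<lambda>n. LINT y|weinstein_measure \<alpha>. indicator A y * weinstein_heat \<alpha> n x y) \<longlonglongrightarrow> 1"
proof -
  let ?M = "weinstein_measure \<alpha> :: 'd space measure"
  obtain c where c: "c > 0" "\<And>y. y \<in> half_space - A \<Longrightarrow> c \<le> separation x y"
    by (rule separation_bounded_below[of A x]) (use A x in auto)
  have sA: "A \<in> sets ?M"
    using A by (auto simp: sets_weinstein_measure sets_restrict_space_iff)
  have int: "integrable ?M (\<lambda>y. indicator A y * weinstein_heat \<alpha> n x y)" for n
    using integrable_mult_indicator[OF sA weinstein_heat_mass(1)[OF \<alpha>]] by simp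
  \<comment> \<open>Unit mass turns the left side into the integral of the kernel off A, where
    \<open>separation x y / c\<close> is at least 1.\<close>
  have bound: "norm ((LINT y|?M. indicator A y * weinstein_heat \<alpha> n x y) - 1) \<le>
      1 / c * (LINT y|?M. separation x y * weinstein_heat \<alpha> n x y)" for n
  proof -
    have "(LINT y|?M. indicator A y * weinstein_heat \<alpha> n x y) - 1 =
        (LINT y|?M. indicator A y * weinstein_heat \<alpha> n x y - weinstein_heat \<alpha> n x y)"
      using int weinstein_heat_mass[OF \<alpha>, of n x] by simp
    also have "norm \<dots> \<le> (LINT y|?M. 1 / c * (separation x y * weinstein_heat \<alpha> n x y))"
    proof (rule norm_integral_le)
      fix y assume y: "y \<in> space ?M"
      note h0 = weinstein_heat_nonneg[OF \<alpha>, of n x y]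
      show "norm (indicator A y * weinstein_heat \<alpha> n x y - weinstein_heat \<alpha> n x y) \<le>
          1 / c * (separation x y * weinstein_heat \<alpha> n x y)"
      proof (cases "y \<in> A")
        case True
        then show ?thesis using c h0 separation_nonneg[of x y] by simp
      next
        case False
        then have "1 \<le> 1 / c * separation x y" using c y by simp
        then have "1 * weinstein_heat \<alpha> n x y \<le> 1 / c * separation x y * weinstein_heat \<alpha> n x y"
          by (rule mult_right_mono[OF _ h0])
        then show ?thesis using False h0 by simp
      qed
    qed (intro integrable_mult_right integrable_weinstein_heat_separation \<alpha> Bochner_Integration.integrable_diff int weinstein_heat_mass(1))+
    also have "\<dots> = 1 / c * (LINT y|?M. separation x y * weinstein_heat \<alpha> n x y)"
      by (rule integral_mult_right_zero)
    finally show ?thesis .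
  qed
  have lim: "(\<lambda>n. 1 / c * (LINT y|?M. separation x y * weinstein_heat \<alpha> n x y)) \<longlonglongrightarrow> 0"
    by (rule tendsto_mult_right_zero[OF weinstein_heat_separation_tendsto[OF \<alpha>]])
  have "(\<lambda>n. (LINT y|?M. indicator A y * weinstein_heat \<alpha> n x y) - 1) \<longlonglongrightarrow> 0"
    by (rule Lim_null_comparison[OF always_eventually[OF allI[OF bound]] lim])
  then show ?thesis by (simp add: LIM_zero_iff)
qed

lemma gauss_weight_nonneg: "0 \<le> gauss_weight n l"
  by (simp add: gauss_weight_def)

lemma gauss_weight_le_1: "gauss_weight n l \<le> 1"
  unfolding gauss_weight_def by (intro mult_le_one) auto

lemma kernel_transform_weinstein:
  assumes \<alpha>: "\<alpha> > - 1 / 2"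
  shows "kernel_transform (weinstein_measure \<alpha> :: ('d::finite) space measure) (weinstein_kernel \<alpha>)
     gauss_weight (weinstein_heat \<alpha>) half_space_opens (\<lambda>k. half_space \<inter> ball 0 (real (Suc k)))"
proof (intro kernel_transform.intro sigma_finite_weinstein_measure kernel_transform_axioms.intro)
  let ?M = "weinstein_measure \<alpha> :: 'd space measure"
  show "case_prod (weinstein_kernel \<alpha>) \<in> borel_measurable (?M \<Otimes>\<^sub>M ?M)"
    by (rule measurable_pair_weinsteinI[OF measurable_weinstein_kernel[OF \<alpha>]])
  show "case_prod (weinstein_heat \<alpha> n) \<in> borel_measurable (?M \<Otimes>\<^sub>M ?M)" for n
    by (rule measurable_pair_weinsteinI[OF measurable_weinstein_heat[OF \<alpha>]])
  show "Int_stable (half_space_opens :: 'd space set set)"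
    by (auto simp: Int_stable_def)
  show "incseq (\<lambda>k. half_space \<inter> ball 0 (real (Suc k)))"
    by (auto simp: incseq_def)
  show "(\<Union>k. half_space \<inter> ball 0 (real (Suc k))) = space ?M"
  proof -
    have "\<exists>k. norm x < real (Suc k)" for x :: "'d space"
      using reals_Archimedean2[of "norm x"] by (metis less_trans lessI of_nat_less_iff)
    then show ?thesis by (auto simp: dist_norm)
  qed
  fix k
  show "emeasure ?M (half_space \<inter> ball 0 (real (Suc k))) < \<infinity>"
  proof -
    let ?R = "real (Suc k)"
    have "emeasure ?M (half_space \<inter> ball 0 ?R) = (\<integral>\<^sup>+ x. indicator (half_space \<inter> ball 0 ?R) x \<partial>?M)"
      by (rule nn_integral_indicator[symmetric]) (auto simp: sets_weinstein_measure sets_restrict_space_iff)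
    \<comment> \<open>On the ball of radius R the weight with index 0, where the Gaussian parameter
      is 1, is at least \<open>exp (- R^2 / 2)\<close>.\<close>
    also have "\<dots> \<le> (\<integral>\<^sup>+ x. ennreal (exp (?R\<^sup>2 / 2) * gauss_weight 0 x) \<partial>?M)"
    proof (rule nn_integral_mono)
      fix x :: "'d space"
      show "indicator (half_space \<inter> ball 0 ?R) x \<le> ennreal (exp (?R\<^sup>2 / 2) * gauss_weight 0 x)"
      proof (cases "x \<in> ball 0 ?R")
        case True
        have "(norm (fst x))\<^sup>2 + (snd x)\<^sup>2 = (norm x)\<^sup>2"
          by (cases x) (simp add: norm_Pair)
        also have "\<dots> \<le> ?R\<^sup>2"
          using True by (intro power_mono) auto
        finally have "1 \<le> exp (?R\<^sup>2 / 2 + (- (norm (fst x))\<^sup>2 / 2 + - (snd x)\<^sup>2 / 2))"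
          by (simp add: field_simps)
        then have "1 \<le> exp (?R\<^sup>2 / 2) * gauss_weight 0 x"
          by (simp add: gauss_weight_def flip: exp_add)
        then show ?thesis by (auto simp: indicator_def)
      qed simp
    qed
    also have "\<dots> < \<infinity>"
      by (subst nn_integral_eq_integral[OF integrable_mult_right[OF integrable_gauss_weight[OF \<alpha>]]])
        (simp_all add: gauss_weight_nonneg)
    finally show ?thesis .
  qed
  show "half_space \<inter> ball 0 (real (Suc k)) \<in> half_space_opens"
    using half_space_open by auto
qed (rule weinstein_kernel_commute norm_weinstein_kernel_le[OF \<alpha>] integrable_gauss_weight[OF \<alpha>]
    gauss_weight_nonneg gauss_weight_le_1 gauss_weight_tendsto weinstein_heat_nonneg[OF \<alpha>] weinstein_heat_eq[OF \<alpha>]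
    weinstein_heat_mass(2)[OF \<alpha>] weinstein_heat_concentrated[OF \<alpha>] | simp add: sets_weinstein_measure_opens | force)+

section \<open>Reflection, translation and dilation\<close>

lemma measurable_reflect [measurable]: "reflect \<in> borel_measurable (borel :: ('d::finite) space measure)"
  unfolding reflect_def[abs_def] by (intro borel_measurable_continuous_onI continuous_intros)

lemma reflect_half_space [simp]: "reflect x \<in> half_space \<longleftrightarrow> x \<in> half_space"
  by (simp add: reflect_def half_space_def)

lemma measurable_reflect_weinstein:
  "reflect \<in> weinstein_measure \<alpha> \<rightarrow>\<^sub>M (weinstein_measure \<alpha> :: ('d::finite) space measure)"
  unfolding measurable_cong_sets[OF sets_weinstein_measure sets_weinstein_measure]
  by (intro measurable_restrict_space2 measurable_restrict_space1 measurable_reflect)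
    (auto simp: space_restrict_space)

lemma borel_measurable_weinstein_iff:
  fixes f :: "('d::finite) space \<Rightarrow> ennreal"
  shows "f \<in> borel_measurable (weinstein_measure \<alpha>) \<longleftrightarrow> (\<lambda>x. f x * indicator half_space x) \<in> borel_measurable borel"
  unfolding measurable_cong_sets[OF sets_weinstein_measure refl]
  by (rule borel_measurable_restrict_space_iff_ennreal) simp

lemma nn_integral_weinstein_eq:
  fixes f :: "('d::finite) space \<Rightarrow> ennreal"
  assumes \<alpha>: "\<alpha> > - 1 / 2"
  shows "(\<integral>\<^sup>+ x. f x \<partial>weinstein_measure \<alpha>) = (\<integral>\<^sup>+ x. f x * indicator half_space x \<partial>weinstein_product \<alpha>)"
  unfolding weinstein_measure_eq[OF \<alpha>]
proof (rule nn_integral_restrict_space)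
  show "half_space \<inter> space (weinstein_product \<alpha> :: 'd space measure) \<in> sets (weinstein_product \<alpha>)"
    by (subst sets_weinstein_product) (simp add: space_pair_measure)
qed

lemma fourier_measure_uminus: "distr fourier_measure borel uminus = (fourier_measure :: 'a::euclidean_space measure)"
proof -
  have "distr fourier_measure borel uminus = density (distr lborel borel uminus) (\<lambda>_ :: 'a. ennreal ((2 * pi) powr - (real DIM('a) / 2)))"
    unfolding fourier_measure_def by (subst density_distr) auto
  also have "distr lborel borel uminus = (lborel :: 'a measure)"
    using lborel_affine[of "-1" "0 :: 'a"] by (simp add: density_1)
  finally show ?thesis by (simp add: fourier_measure_def)
qed

lemma nn_integral_weinstein_reflect:
  fixes f :: "('d::finite) space \<Rightarrow> ennreal"
  assumes \<alpha>: "\<alpha> > - 1 / 2" and f: "f \<in> borel_measurable (weinstein_measure \<alpha>)"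
  shows "(\<integral>\<^sup>+ x. f (reflect x) \<partial>weinstein_measure \<alpha>) = (\<integral>\<^sup>+ x. f x \<partial>weinstein_measure \<alpha>)"
proof -
  interpret pair_sigma_finite "fourier_measure :: (real ^ 'd) measure" "bessel_measure \<alpha>"
    by (intro pair_sigma_finite.intro sigma_finite_fourier_measure sigma_finite_bessel_measure)
  let ?g = "\<lambda>x. f x * indicator half_space x"
  have g: "?g \<in> borel_measurable borel"
    using f by (simp only: borel_measurable_weinstein_iff)
  have gP: "?g \<in> borel_measurable (weinstein_product \<alpha>)"
    using g by (simp only: measurable_cong_sets[OF sets_weinstein_product refl])
  have grP: "(\<lambda>x. ?g (reflect x)) \<in> borel_measurable (weinstein_product \<alpha>)"
    using measurable_compose[OF measurable_reflect g] by (simp only: measurable_cong_sets[OF sets_weinstein_product refl])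
  have "(\<integral>\<^sup>+ x. f (reflect x) \<partial>weinstein_measure \<alpha>) = (\<integral>\<^sup>+ x. ?g (reflect x) \<partial>weinstein_product \<alpha>)"
    unfolding nn_integral_weinstein_eq[OF \<alpha>] by (simp add: indicator_def)
  also have "\<dots> = (\<integral>\<^sup>+ t. (\<integral>\<^sup>+ x. ?g (- x, t) \<partial>fourier_measure) \<partial>bessel_measure \<alpha>)"
    by (subst nn_integral_snd[OF grP, symmetric]) (simp add: reflect_def)
  also have "\<dots> = (\<integral>\<^sup>+ t. (\<integral>\<^sup>+ x. ?g (x, t) \<partial>fourier_measure) \<partial>bessel_measure \<alpha>)"
  proof (rule nn_integral_cong)
    fix t
    have m: "(\<lambda>x. ?g (x, t)) \<in> borel_measurable borel"
      by (rule measurable_compose[OF _ g]) (auto intro!: borel_measurable_continuous_onI continuous_intros)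
    have "(\<integral>\<^sup>+ x. ?g (x, t) \<partial>fourier_measure) = (\<integral>\<^sup>+ x. ?g (x, t) \<partial>distr fourier_measure borel uminus)"
      by (simp only: fourier_measure_uminus)
    also have "\<dots> = (\<integral>\<^sup>+ x. ?g (- x, t) \<partial>fourier_measure)"
      by (rule nn_integral_distr) (use m in auto)
    finally show "(\<integral>\<^sup>+ x. ?g (- x, t) \<partial>fourier_measure) = (\<integral>\<^sup>+ x. ?g (x, t) \<partial>fourier_measure)" ..
  qed
  also have "\<dots> = (\<integral>\<^sup>+ x. ?g x \<partial>weinstein_product \<alpha>)"
    by (rule nn_integral_snd[OF gP])
  also have "\<dots> = (\<integral>\<^sup>+ x. f x \<partial>weinstein_measure \<alpha>)"
    by (rule nn_integral_weinstein_eq[OF \<alpha>, symmetric])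
  finally show ?thesis .
qed

lemma L2_norm_sq_reflect:
  fixes f :: "('d::finite) space \<Rightarrow> complex"
  assumes \<alpha>: "\<alpha> > - 1 / 2" and f: "f \<in> borel_measurable (weinstein_measure \<alpha>)"
  shows "L2_norm_sq (weinstein_measure \<alpha>) (\<lambda>x. f (reflect x)) = L2_norm_sq (weinstein_measure \<alpha>) f"
proof -
  have "(\<lambda>x. ennreal ((cmod (f x))\<^sup>2)) \<in> borel_measurable (weinstein_measure \<alpha>)"
    using f by measurable
  then show ?thesis
    unfolding L2_norm_sq_def by (rule nn_integral_weinstein_reflect[OF \<alpha>])
qed

lemma L2_reflect:
  fixes f :: "('d::finite) space \<Rightarrow> complex"
  assumes \<alpha>: "\<alpha> > - 1 / 2" and f: "f \<in> L2 (weinstein_measure \<alpha>)"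
  shows "(\<lambda>x. f (reflect x)) \<in> L2 (weinstein_measure \<alpha>)"
proof (rule L2_I)
  note m = L2_measurable[OF f]
  show "(\<lambda>x. f (reflect x)) \<in> borel_measurable (weinstein_measure \<alpha>)"
    by (rule measurable_compose[OF measurable_reflect_weinstein m])
  show "L2_norm_sq (weinstein_measure \<alpha>) (\<lambda>x. f (reflect x)) < \<infinity>"
    unfolding L2_norm_sq_reflect[OF \<alpha> m] by (rule L2_finite[OF f])
qed

text \<open>The Bessel factor is real and conjugation only reverses the character; so on L1
  \<open>weinstein_inv\<close> is the adjoint transform.\<close>

lemma cnj_weinstein_kernel: "cnj (weinstein_kernel \<alpha> l x) = weinstein_kernel \<alpha> l (reflect x)"
  by (simp add: weinstein_kernel_def reflect_def exp_cnj)

section \<open>Continuity of transforms and their translates\<close>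

lemma continuous_norm_bessel:
  assumes "\<alpha> > - 1 / 2"
  shows "continuous_on UNIV (norm_bessel \<alpha>)"
  using continuous_on_compose2[OF continuous_bessel_series[OF assms], of UNIV "\<lambda>t. t\<^sup>2"]
  by (simp add: norm_bessel_eq[OF assms] continuous_intros cong: continuous_on_cong)

lemma continuous_weinstein_kernel:
  assumes "\<alpha> > - 1 / 2"
  shows "continuous_on UNIV (\<lambda>l. weinstein_kernel \<alpha> l x)"
  unfolding weinstein_kernel_def
  by (intro continuous_intros continuous_on_compose2[OF continuous_norm_bessel[OF assms]]) auto

lemma borel_measurable_weinstein_kernel:
  assumes "\<alpha> > - 1 / 2"
  shows "weinstein_kernel \<alpha> l \<in> borel_measurable (weinstein_measure \<alpha>)"
  using continuous_weinstein_kernel[OF assms, of l]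
  by (intro borel_measurable_weinsteinI borel_measurable_continuous_onI) (simp add: weinstein_kernel_commute[of \<alpha> l])

lemma integrable_mult_weinstein_kernel:
  fixes h :: "('d::finite) space \<Rightarrow> complex"
  assumes \<alpha>: "\<alpha> > - 1 / 2" and h: "integrable (weinstein_measure \<alpha>) h"
  shows "integrable (weinstein_measure \<alpha>) (\<lambda>x. h x * weinstein_kernel \<alpha> l x)"
proof (rule Bochner_Integration.integrable_bound[OF h])
  show "(\<lambda>x. h x * weinstein_kernel \<alpha> l x) \<in> borel_measurable (weinstein_measure \<alpha>)"
    using borel_measurable_integrable[OF h] borel_measurable_weinstein_kernel[OF \<alpha>] by (rule borel_measurable_times)
qed (auto simp: norm_mult norm_weinstein_kernel_le[OF \<alpha>] intro!: mult_left_le)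

text \<open>Dominated convergence. Continuity is proved on the whole space, beyond the half space,
  because \<open>cont_even\<close> demands it there.\<close>

lemma continuous_weinstein_integral:
  fixes h :: "('d::finite) space \<Rightarrow> complex"
  assumes \<alpha>: "\<alpha> > - 1 / 2" and h: "integrable (weinstein_measure \<alpha>) h"
  shows "continuous_on UNIV (weinstein_integral \<alpha> h)"
  unfolding continuous_on_sequentially
proof (intro allI ballI impI, elim conjE)
  fix u :: "nat \<Rightarrow> 'd space" and l assume u: "u \<longlonglongrightarrow> l"
  show "(weinstein_integral \<alpha> h \<circ> u) \<longlonglongrightarrow> weinstein_integral \<alpha> h l"
    unfolding weinstein_integral_def o_def
  proof (rule integral_dominated_convergence[where w = "\<lambda>x. cmod (h x)"])
    show "(\<lambda>x. h x * weinstein_kernel \<alpha> v x) \<in> borel_measurable (weinstein_measure \<alpha>)" for v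
      by (rule borel_measurable_integrable[OF integrable_mult_weinstein_kernel[OF \<alpha> h]])
    then show "(\<lambda>x. h x * weinstein_kernel \<alpha> (u n) x) \<in> borel_measurable (weinstein_measure \<alpha>)" for n .
    show "integrable (weinstein_measure \<alpha>) (\<lambda>x. cmod (h x))" using h by (rule integrable_norm)
    show "AE x in weinstein_measure \<alpha>. (\<lambda>n. h x * weinstein_kernel \<alpha> (u n) x) \<longlonglongrightarrow> h x * weinstein_kernel \<alpha> l x"
      using continuous_on_tendsto_compose[OF continuous_weinstein_kernel[OF \<alpha>] u] by (intro AE_I2 tendsto_intros) auto
    show "AE x in weinstein_measure \<alpha>. cmod (h x * weinstein_kernel \<alpha> (u n) x) \<le> cmod (h x)" for n
      by (auto simp: norm_mult norm_weinstein_kernel_le[OF \<alpha>] intro!: mult_left_le)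
  qed
qed

text \<open>The kernel depends on its last variable through the square. Membership in
  \<open>cont_even\<close> sends the inverse transform of an L1 function to the integral branch of
  \<open>translation\<close>, with a value at every point.\<close>

lemma weinstein_integral_reflect_cont_even:
  fixes h :: "('d::finite) space \<Rightarrow> complex"
  assumes \<alpha>: "\<alpha> > - 1 / 2" and h: "integrable (weinstein_measure \<alpha>) h"
  shows "(\<lambda>l. weinstein_integral \<alpha> h (reflect l)) \<in> cont_even"
proof -
  have "continuous_on UNIV (reflect :: 'd space \<Rightarrow> 'd space)"
    unfolding reflect_def[abs_def] by (intro continuous_intros)
  then have "continuous_on UNIV (\<lambda>l. weinstein_integral \<alpha> h (reflect l))"
    by (rule continuous_on_compose2[OF continuous_weinstein_integral[OF \<alpha> h]]) simp
  then show ?thesis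
    by (simp add: cont_even_def weinstein_integral_def weinstein_kernel_def reflect_def norm_bessel_eq[OF \<alpha>])
qed

lemma translation_integral_eq:
  assumes \<alpha>: "\<alpha> > - 1 / 2" and f: "continuous_on UNIV f"
  shows "translation_integral \<alpha> x f y = (LINT \<theta>|gegenbauer_measure \<alpha>.
     f (fst x + fst y, sqrt ((snd x)\<^sup>2 + (snd y)\<^sup>2 + 2 * snd x * snd y * cos \<theta>)))"
proof -
  let ?f = "\<lambda>\<theta>. f (fst x + fst y, sqrt ((snd x)\<^sup>2 + (snd y)\<^sup>2 + 2 * snd x * snd y * cos \<theta>))"
  have m: "?f \<in> borel_measurable borel"
    by (intro borel_measurable_continuous_onI continuous_on_compose2[OF f] continuous_intros) auto
  show ?thesis
    unfolding integral_gegenbauer_measure[OF \<alpha> m] translation_integral_def set_lebesgue_integral_def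
      integral_mult_right_zero[symmetric]
    by (intro Bochner_Integration.integral_cong refl)
      (simp add: gegenbauer_density_def scaleR_conv_of_real mult_ac)
qed

text \<open>Translation multiplies a character by its value at x and, by
  \<open>norm_bessel_product\<close>, does the same to the Bessel factor. Fubini's theorem carries
  this inside the integral; the two reflections account for the conjugate.\<close>

lemma translation_weinstein_integral:
  fixes h :: "('d::finite) space \<Rightarrow> complex"
  assumes \<alpha>: "\<alpha> > - 1 / 2" and h: "integrable (weinstein_measure \<alpha>) h"
  shows "translation \<alpha> x (\<lambda>l. weinstein_integral \<alpha> h (reflect l)) (reflect y) =
    weinstein_integral \<alpha> (\<lambda>l. h l * cnj (weinstein_kernel \<alpha> l x)) y"
proof -
  let ?M = "weinstein_measure \<alpha> :: 'd space measure" and ?\<nu> = "gegenbauer_measure \<alpha>"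
  let ?T = "\<lambda>l. weinstein_integral \<alpha> h (reflect l)"
  let ?q = "\<lambda>\<theta>. sqrt ((snd x)\<^sup>2 + (snd y)\<^sup>2 + 2 * snd x * snd y * cos \<theta>)"
  let ?e = "\<lambda>l :: 'd space. exp (- \<i> * complex_of_real (fst l \<bullet> (fst y - fst x)))"
  let ?K = "\<lambda>l \<theta>. ?e l * complex_of_real (norm_bessel \<alpha> (snd l * ?q \<theta>))"
  interpret G: prob_space ?\<nu> by (rule prob_space_gegenbauer_measure[OF \<alpha>])
  interpret W: sigma_finite_measure ?M by (rule sigma_finite_weinstein_measure)
  interpret P: pair_sigma_finite ?M ?\<nu> ..
  have ce: "?T \<in> cont_even" by (rule weinstein_integral_reflect_cont_even[OF \<alpha> h])
  have mK: "(\<lambda>(l, \<theta>). ?K l \<theta>) \<in> borel_measurable (?M \<Otimes>\<^sub>M ?\<nu>)"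
  proof -
    have "continuous_on UNIV (\<lambda>p. ?K (fst p) (snd p))"
      by (intro continuous_intros continuous_on_compose2[OF continuous_norm_bessel[OF \<alpha>]]) auto
    then have "(\<lambda>p. ?K (fst p) (snd p)) \<in> borel_measurable borel"
      by (rule borel_measurable_continuous_onI)
    then have K: "(\<lambda>p. ?K (fst p) (snd p)) \<in> borel_measurable (borel \<Otimes>\<^sub>M borel)"
      by (simp only: borel_prod)
    have "(\<lambda>p. (fst p, snd p)) \<in> ?M \<Otimes>\<^sub>M ?\<nu> \<rightarrow>\<^sub>M borel \<Otimes>\<^sub>M borel"
      by (intro measurable_Pair measurable_weinstein_borel[OF measurable_fst]) measurable
    from measurable_compose[OF this K] show ?thesis by (simp add: case_prod_unfold)
  qed
  have K1: "cmod (?K l \<theta>) \<le> 1" for l \<theta>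
    using abs_norm_bessel_le_1[OF \<alpha>] by (simp add: norm_mult norm_exp_eq_Re)
  have int: "integrable (?M \<Otimes>\<^sub>M ?\<nu>) (\<lambda>(l, \<theta>). h l * 1 * ?K l \<theta>)"
    by (rule P.integrable_product_kernel[OF h _ mK K1]) simp
  have "translation \<alpha> x ?T (reflect y) = (LINT \<theta>|?\<nu>. ?T (fst x - fst y, ?q \<theta>))"
    using ce translation_integral_eq[OF \<alpha>, of ?T x "reflect y"]
    by (simp add: translation_def cont_even_def reflect_def)
  also have "\<dots> = (LINT \<theta>|?\<nu>. (LINT l|?M. h l * 1 * ?K l \<theta>))"
    unfolding weinstein_integral_def weinstein_kernel_def by (simp add: reflect_def mult.assoc)
  also have "\<dots> = (LINT l|?M. (LINT \<theta>|?\<nu>. h l * 1 * ?K l \<theta>))"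
    by (rule P.Fubini_integral[OF int])
  also have "\<dots> = (LINT l|?M. h l * cnj (weinstein_kernel \<alpha> l x) * weinstein_kernel \<alpha> y l)"
  proof (intro Bochner_Integration.integral_cong refl)
    fix l :: "'d space"
    have "(LINT \<theta>|?\<nu>. h l * 1 * ?K l \<theta>) = h l * ?e l * (LINT \<theta>|?\<nu>. complex_of_real (norm_bessel \<alpha> (snd l * ?q \<theta>)))"
      by (simp only: mult_1_right mult.assoc integral_mult_right_zero)
    also have "\<dots> = h l * ?e l * complex_of_real (norm_bessel \<alpha> (snd l * snd x) * norm_bessel \<alpha> (snd l * snd y))"
      by (simp only: integral_complex_of_real norm_bessel_product[OF \<alpha>, symmetric])
    also have "\<dots> = h l * cnj (weinstein_kernel \<alpha> l x) * weinstein_kernel \<alpha> y l"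
    proof -
      have e: "?e l = cnj (exp (- \<i> * complex_of_real (fst x \<bullet> fst l))) * exp (- \<i> * complex_of_real (fst l \<bullet> fst y))"
        by (simp add: exp_cnj inner_diff_right inner_commute algebra_simps flip: exp_add)
      show ?thesis
        unfolding e weinstein_kernel_def complex_cnj_mult complex_cnj_complex_of_real of_real_mult
        by (simp only: mult_ac)
    qed
    finally show "(LINT \<theta>|?\<nu>. h l * 1 * ?K l \<theta>) = h l * cnj (weinstein_kernel \<alpha> l x) * weinstein_kernel \<alpha> y l" .
  qed
  finally show ?thesis by (simp add: weinstein_integral_def)
qed

section \<open>Dilations\<close>

lemma sigma_finite_dilation_measure: "sigma_finite_measure dilation_measure"
proof -
  have "sigma_finite_measure (restrict_space lborel {0::real<..})"
    by (intro sigma_finite_measure_restrict_space sigma_finite_lborel) simp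
  then show ?thesis
    unfolding dilation_measure_def
    by (subst sigma_finite_measure.sigma_finite_iff_density_finite)
      (auto intro!: measurable_restrict_space1)
qed

lemma space_dilation_measure [simp]: "space dilation_measure = {0<..}"
  by (simp add: dilation_measure_def space_restrict_space)

text \<open>m is only measurable on the half space, so the point is that scaling by a positive
  factor stays inside it, jointly measurably.\<close>

lemma measurable_dilate:
  fixes m :: "('d::finite) space \<Rightarrow> complex"
  assumes m: "m \<in> borel_measurable (weinstein_measure \<alpha>)"
  shows "(\<lambda>p. dilate (fst p) m (snd p)) \<in> borel_measurable (dilation_measure \<Otimes>\<^sub>M weinstein_measure \<alpha>)"
proof -
  have s: "sets dilation_measure = sets (restrict_space borel {0<..})"
    by (simp add: dilation_measure_def sets_restrict_space)
  have id: "(\<lambda>x. x) \<in> dilation_measure \<rightarrow>\<^sub>M borel"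
    unfolding measurable_cong_sets[OF s refl] by (rule measurable_restrict_space1) simp
  have 1: "fst \<in> dilation_measure \<Otimes>\<^sub>M (weinstein_measure \<alpha> :: 'd space measure) \<rightarrow>\<^sub>M borel"
    using measurable_compose[OF measurable_fst id] .
  have 2: "snd \<in> dilation_measure \<Otimes>\<^sub>M (weinstein_measure \<alpha> :: 'd space measure) \<rightarrow>\<^sub>M borel"
    by (rule measurable_weinstein_borel[OF measurable_snd])
  have "(\<lambda>p. fst p *\<^sub>R snd p) \<in> dilation_measure \<Otimes>\<^sub>M weinstein_measure \<alpha> \<rightarrow>\<^sub>M (weinstein_measure \<alpha> :: 'd space measure)"
    unfolding measurable_cong_sets[OF refl sets_weinstein_measure]
    using borel_measurable_scaleR[OF 1 2]
    by (intro measurable_restrict_space2) (auto simp: space_pair_measure half_space_def)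
  from measurable_compose[OF this m] show ?thesis by (simp add: dilate_def)
qed

text \<open>The measure is homogeneous, so the squared norms of m and of its dilate differ by the
  positive factor \<open>\<sigma> ^ DIM * \<sigma> powr (2 * \<alpha> + 1)\<close>; an infinite norm
  of the dilate would make that of m infinite.\<close>

lemma dilate_L2:
  fixes m :: "('d::finite) space \<Rightarrow> complex"
  assumes \<sigma>: "\<sigma> > 0" and m: "m \<in> L2 (weinstein_measure \<alpha>)"
  shows "dilate \<sigma> m \<in> L2 (weinstein_measure \<alpha>)"
proof (rule L2_I)
  let ?C = "(2 * pi) powr (real CARD('d) / 2) * 2 powr \<alpha> * Gamma (\<alpha> + 1)"
  let ?w = "\<lambda>x :: 'd space. ennreal (snd x powr (2 * \<alpha> + 1) / ?C)"
  let ?f = "\<lambda>x. ennreal ((cmod (m x))\<^sup>2)"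
  let ?g = "\<lambda>x. ?w x * (?f x * indicator half_space x)"
  note mm = L2_measurable[OF m]
  have d: "(\<lambda>p. dilate (fst p) m (snd p)) \<in> borel_measurable (dilation_measure \<Otimes>\<^sub>M weinstein_measure \<alpha>)"
    by (rule measurable_dilate[OF mm])
  show md: "dilate \<sigma> m \<in> borel_measurable (weinstein_measure \<alpha>)"
    using measurable_compose[OF measurable_Pair1'[of \<sigma> dilation_measure "weinstein_measure \<alpha>"] d] \<sigma> by simp
  have nn: "(\<integral>\<^sup>+ x. u x \<partial>weinstein_measure \<alpha>) = (\<integral>\<^sup>+ x. ?w x * (u x * indicator half_space x) \<partial>lborel)"
    if u: "u \<in> borel_measurable (weinstein_measure \<alpha>)" for u :: "'d space \<Rightarrow> ennreal"
  proof -
    have "u \<in> borel_measurable (restrict_space lborel half_space)"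
      using u by (simp add: weinstein_measure_def)
    then have "(\<integral>\<^sup>+ x. u x \<partial>weinstein_measure \<alpha>) = (\<integral>\<^sup>+ x. ?w x * u x \<partial>restrict_space lborel half_space)"
      unfolding weinstein_measure_def by (intro nn_integral_density) (auto intro!: measurable_restrict_space1)
    also have "\<dots> = (\<integral>\<^sup>+ x. ?w x * u x * indicator half_space x \<partial>lborel)"
      by (rule nn_integral_restrict_space) simp
    finally show ?thesis by (simp only: mult.assoc)
  qed
  have f: "?f \<in> borel_measurable (weinstein_measure \<alpha>)" using mm by measurable
  have fd: "(\<lambda>x. ennreal ((cmod (dilate \<sigma> m x))\<^sup>2)) \<in> borel_measurable (weinstein_measure \<alpha>)" using md by measurable
  have g: "?g \<in> borel_measurable borel"
    by (rule borel_measurable_times_ennreal[OF measurable_snd_powr iffD1[OF borel_measurable_weinstein_iff f]])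
  have "L2_norm_sq (weinstein_measure \<alpha>) m = (\<integral>\<^sup>+ x. ?g x \<partial>(lborel :: 'd space measure))"
    unfolding L2_norm_sq_def by (rule nn[OF f])
  also have "\<dots> = (\<integral>\<^sup>+ x. ?g x \<partial>density (distr lborel borel (\<lambda>x. 0 + \<sigma> *\<^sub>R x)) (\<lambda>_. \<bar>\<sigma>\<bar> ^ DIM('d space)))"
    using \<sigma> by (simp only: lborel_affine[of \<sigma> "0 :: 'd space", symmetric])
  also have "\<dots> = (\<integral>\<^sup>+ x. ennreal (\<sigma> ^ DIM('d space)) * ?g (\<sigma> *\<^sub>R x) \<partial>lborel)"
    using \<sigma> g by (subst nn_integral_density) (auto simp: nn_integral_distr)
  also have "\<dots> = (\<integral>\<^sup>+ x. ennreal (\<sigma> ^ DIM('d space) * \<sigma> powr (2 * \<alpha> + 1)) *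
      (?w x * (ennreal ((cmod (dilate \<sigma> m x))\<^sup>2) * indicator half_space x)) \<partial>lborel)"
  proof (rule nn_integral_cong)
    fix x :: "'d space"
    show "ennreal (\<sigma> ^ DIM('d space)) * ?g (\<sigma> *\<^sub>R x) = ennreal (\<sigma> ^ DIM('d space) * \<sigma> powr (2 * \<alpha> + 1)) *
      (?w x * (ennreal ((cmod (dilate \<sigma> m x))\<^sup>2) * indicator half_space x))"
    proof (cases "x \<in> half_space")
      case True
      then have "snd x > 0" by (simp add: half_space_def)
      then have "?w (\<sigma> *\<^sub>R x) = ennreal (\<sigma> powr (2 * \<alpha> + 1)) * ?w x"
        using \<sigma> by (simp add: powr_mult flip: ennreal_mult')
      moreover have "\<sigma> *\<^sub>R x \<in> half_space" using True \<sigma> by (simp add: half_space_def)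
      ultimately show ?thesis
        using True \<sigma> by (simp add: dilate_def ennreal_mult' mult.assoc)
    next
      case False
      moreover have "\<sigma> *\<^sub>R x \<notin> half_space"
        using False \<sigma> by (simp add: half_space_def zero_less_mult_iff)
      ultimately show ?thesis by simp
    qed
  qed
  also have "\<dots> = ennreal (\<sigma> ^ DIM('d space) * \<sigma> powr (2 * \<alpha> + 1)) *
      (\<integral>\<^sup>+ x. ?w x * (ennreal ((cmod (dilate \<sigma> m x))\<^sup>2) * indicator half_space x) \<partial>lborel)"
    by (rule nn_integral_cmult)
      (simp only: measurable_lborel2 borel_measurable_times_ennreal[OF measurable_snd_powr iffD1[OF borel_measurable_weinstein_iff fd]])
  also have "\<dots> = ennreal (\<sigma> ^ DIM('d space) * \<sigma> powr (2 * \<alpha> + 1)) * L2_norm_sq (weinstein_measure \<alpha>) (dilate \<sigma> m)"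
    unfolding L2_norm_sq_def by (simp only: nn[OF fd])
  finally have eq: "L2_norm_sq (weinstein_measure \<alpha>) m =
    ennreal (\<sigma> ^ DIM('d space) * \<sigma> powr (2 * \<alpha> + 1)) * L2_norm_sq (weinstein_measure \<alpha>) (dilate \<sigma> m)" .
  show "L2_norm_sq (weinstein_measure \<alpha>) (dilate \<sigma> m) < \<infinity>"
  proof (rule ccontr)
    assume "\<not> ?thesis"
    then have "L2_norm_sq (weinstein_measure \<alpha>) m = \<infinity>"
      unfolding eq using \<sigma> by (simp add: less_top[symmetric] ennreal_mult_top)
    then show False using L2_finite[OF m] by simp
  qed
qed

section \<open>Plancherel and Calderon formulas\<close>

theorem theorem2p3:
  fixes \<alpha> :: real and m :: "('d::finite) space \<Rightarrow> complex"
  assumes alpha: "\<alpha> > - 1 / 2"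
    and m_L2: "m \<in> L2 (weinstein_measure \<alpha>)"
    and admissible: "\<And>x. x \<in> half_space \<Longrightarrow>
          (\<integral>\<^sup>+ \<sigma>. ennreal ((cmod (m (\<sigma> *\<^sub>R x)))\<^sup>2) \<partial>dilation_measure) = 1"
  shows "(\<forall>\<phi> \<in> L2 (weinstein_measure \<alpha>).
           (\<integral>\<^sup>+ x. ennreal ((cmod (\<phi> x))\<^sup>2) \<partial>weinstein_measure \<alpha>) =
           (\<integral>\<^sup>+ \<sigma>. L2_norm_sq (weinstein_measure \<alpha>) (multiplier_op \<alpha> m \<sigma> \<phi>)
              \<partial>dilation_measure)) \<and>
         (\<forall>\<phi>. integrable (weinstein_measure \<alpha>) \<phi> \<and>
             integrable (weinstein_measure \<alpha>) (weinstein \<alpha> \<phi>) \<longrightarrow>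
           (AE x in weinstein_measure \<alpha>.
              integrable dilation_measure
                (\<lambda>\<sigma>. weinstein_conv \<alpha> (multiplier_op \<alpha> m \<sigma> \<phi>)
                        (weinstein_inv \<alpha> (\<lambda>y. cnj (dilate \<sigma> m y))) x) \<and>
              \<phi> x = (LINT \<sigma>|dilation_measure.
                weinstein_conv \<alpha> (multiplier_op \<alpha> m \<sigma> \<phi>)
                        (weinstein_inv \<alpha> (\<lambda>y. cnj (dilate \<sigma> m y))) x)))"
proof -
  let ?M = "weinstein_measure \<alpha> :: 'd space measure"
  interpret W: kernel_transform ?M "weinstein_kernel \<alpha>" gauss_weight "weinstein_heat \<alpha>" half_space_opens
    "\<lambda>k. half_space \<inter> ball 0 (real (Suc k))"
    by (rule kernel_transform_weinstein[OF alpha])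
  interpret D: sigma_finite_measure dilation_measure
    by (rule sigma_finite_dilation_measure)
  interpret DM: pair_sigma_finite dilation_measure ?M ..
  have F: "W.transform = weinstein_integral \<alpha>"
    by (intro ext) (simp add: W.transform_def weinstein_integral_def)
  have F_ext: "W.transform_ext = weinstein \<alpha>"
    by (intro ext) (simp only: W.transform_ext_def weinstein_def F)
  have F_adj: "W.transform_adj g x = weinstein_integral \<alpha> g (reflect x)" for g x
    by (simp only: W.transform_adj_def weinstein_integral_def cnj_weinstein_kernel weinstein_kernel_commute[of \<alpha> "reflect x"])
  note mm = L2_measurable[OF m_L2]
  have m_dilate: "dilate \<sigma> m \<in> L2 ?M" if "\<sigma> > 0" for \<sigma>
    by (rule dilate_L2[OF that m_L2])
  have inv_L1: "weinstein_inv \<alpha> h = (\<lambda>l. weinstein_integral \<alpha> h (reflect l))" if "integrable ?M h" for h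
    using that by (simp add: weinstein_inv_def[abs_def] weinstein_def)
  have adm: "(\<integral>\<^sup>+ \<sigma>. ennreal ((cmod (dilate \<sigma> m x))\<^sup>2) \<partial>dilation_measure) = 1" if "x \<in> half_space" for x
    using admissible[OF that] by (simp add: dilate_def)
  have md: "(\<lambda>p. dilate (fst p) m (snd p)) \<in> borel_measurable (dilation_measure \<Otimes>\<^sub>M ?M)"
    by (rule measurable_dilate[OF mm])

  have Plancherel: "(\<integral>\<^sup>+ x. ennreal ((cmod (\<phi> x))\<^sup>2) \<partial>?M) =
      (\<integral>\<^sup>+ \<sigma>. L2_norm_sq ?M (multiplier_op \<alpha> m \<sigma> \<phi>) \<partial>dilation_measure)" if \<phi>: "\<phi> \<in> L2 ?M" for \<phi>
  proof -
    let ?F = "weinstein \<alpha> \<phi>"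
    have pair: "W.L2_pair \<phi> ?F"
      using W.L2_pair_transform_ext[OF \<phi>] by (simp only: F_ext)
    then have FL2: "?F \<in> L2 ?M" by (simp add: W.L2_pair_def)
    note Fm = L2_measurable[OF FL2]
    \<comment> \<open>The product is in L1, so \<open>weinstein_inv\<close> is an integral and the
      isometry in \<open>[0,\<infinity>]\<close> applies to it directly.\<close>
    have T: "L2_norm_sq ?M (multiplier_op \<alpha> m \<sigma> \<phi>) = (\<integral>\<^sup>+ x. ennreal ((cmod (dilate \<sigma> m x))\<^sup>2) * ennreal ((cmod (?F x))\<^sup>2) \<partial>?M)"
      if "\<sigma> > 0" for \<sigma>
    proof -
      let ?h = "\<lambda>x. dilate \<sigma> m x * ?F x"
      have h: "integrable ?M ?h"
        by (rule L2_mult_integrable[OF m_dilate[OF that] FL2])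
      have "multiplier_op \<alpha> m \<sigma> \<phi> = W.transform_adj ?h"
        unfolding multiplier_op_def inv_L1[OF h] F_adj[abs_def] ..
      then have "L2_norm_sq ?M (multiplier_op \<alpha> m \<sigma> \<phi>) = L2_norm_sq ?M ?h"
        by (simp only: W.L2_norm_sq_transform_adj[OF h])
      then show ?thesis
        by (simp add: L2_norm_sq_def norm_mult power_mult_distrib ennreal_mult')
    qed
    have "(\<integral>\<^sup>+ \<sigma>. L2_norm_sq ?M (multiplier_op \<alpha> m \<sigma> \<phi>) \<partial>dilation_measure) =
       (\<integral>\<^sup>+ \<sigma>. (\<integral>\<^sup>+ x. ennreal ((cmod (dilate \<sigma> m x))\<^sup>2) * ennreal ((cmod (?F x))\<^sup>2) \<partial>?M) \<partial>dilation_measure)"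
      by (intro nn_integral_cong) (simp add: T)
    also have "\<dots> = (\<integral>\<^sup>+ x. (\<integral>\<^sup>+ \<sigma>. ennreal ((cmod (dilate \<sigma> m x))\<^sup>2) * ennreal ((cmod (?F x))\<^sup>2) \<partial>dilation_measure) \<partial>?M)"
    proof (rule DM.Fubini'[symmetric])
      have "(\<lambda>p. ennreal ((cmod (dilate (fst p) m (snd p)))\<^sup>2) * ennreal ((cmod (?F (snd p)))\<^sup>2))
          \<in> borel_measurable (dilation_measure \<Otimes>\<^sub>M ?M)"
        using md Fm by measurable
      then show "(\<lambda>(\<sigma>, x). ennreal ((cmod (dilate \<sigma> m x))\<^sup>2) * ennreal ((cmod (?F x))\<^sup>2))
          \<in> borel_measurable (dilation_measure \<Otimes>\<^sub>M ?M)"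
        by (simp only: case_prod_unfold)
    qed
    also have "\<dots> = (\<integral>\<^sup>+ x. ennreal ((cmod (?F x))\<^sup>2) \<partial>?M)"
    \<comment> \<open>For fixed x the transform is a constant factor, and admissibility integrates
      the dilates to 1.\<close>
    proof (rule nn_integral_cong)
      fix x assume x: "x \<in> space ?M"
      have "(\<lambda>\<sigma>. dilate \<sigma> m x) \<in> borel_measurable dilation_measure"
        using measurable_compose[OF measurable_Pair2'[OF x] md] by simp
      then have "(\<integral>\<^sup>+ \<sigma>. ennreal ((cmod (dilate \<sigma> m x))\<^sup>2) * ennreal ((cmod (?F x))\<^sup>2) \<partial>dilation_measure) =
          (\<integral>\<^sup>+ \<sigma>. ennreal ((cmod (dilate \<sigma> m x))\<^sup>2) \<partial>dilation_measure) * ennreal ((cmod (?F x))\<^sup>2)"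
        by (intro nn_integral_multc) measurable
      then show "(\<integral>\<^sup>+ \<sigma>. ennreal ((cmod (dilate \<sigma> m x))\<^sup>2) * ennreal ((cmod (?F x))\<^sup>2) \<partial>dilation_measure) = ennreal ((cmod (?F x))\<^sup>2)"
        using x by (simp add: adm)
    qed
    also have "\<dots> = (\<integral>\<^sup>+ x. ennreal ((cmod (\<phi> x))\<^sup>2) \<partial>?M)"
      using W.L2_pair_norm[OF pair] by (simp add: L2_norm_sq_def)
    finally show ?thesis ..
  qed

  have Calderon: "AE x in ?M.
      integrable dilation_measure
        (\<lambda>\<sigma>. weinstein_conv \<alpha> (multiplier_op \<alpha> m \<sigma> \<phi>) (weinstein_inv \<alpha> (\<lambda>y. cnj (dilate \<sigma> m y))) x) \<and>
      \<phi> x = (LINT \<sigma>|dilation_measure.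
        weinstein_conv \<alpha> (multiplier_op \<alpha> m \<sigma> \<phi>) (weinstein_inv \<alpha> (\<lambda>y. cnj (dilate \<sigma> m y))) x)"
    if \<phi>: "integrable ?M \<phi>" and F\<phi>: "integrable ?M (weinstein \<alpha> \<phi>)" for \<phi>
  proof -
    let ?F = "weinstein \<alpha> \<phi>"
    have F_eq: "?F = W.transform \<phi>"
      using \<phi> by (simp add: weinstein_def F)
    define C where "C = (LINT x|?M. cmod (\<phi> x))"
    have FC: "cmod (?F l) \<le> C" if "l \<in> space ?M" for l
      unfolding F_eq C_def by (rule W.norm_transform_le[OF \<phi> that])
    note Fm = borel_measurable_integrable[OF F\<phi>]
    have conv: "weinstein_conv \<alpha> (multiplier_op \<alpha> m \<sigma> \<phi>) (weinstein_inv \<alpha> (\<lambda>y. cnj (dilate \<sigma> m y))) x =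
        (LINT l|?M. complex_of_real ((cmod (dilate \<sigma> m l))\<^sup>2) * (?F l * cnj (weinstein_kernel \<alpha> l x)))"
      if \<sigma>: "\<sigma> > 0" for \<sigma> x
    proof -
      let ?h = "\<lambda>l. dilate \<sigma> m l * ?F l"
      let ?h' = "\<lambda>l. ?h l * cnj (weinstein_kernel \<alpha> l x)"
      let ?k = "\<lambda>l. cnj (dilate \<sigma> m l)"
      let ?G = "weinstein \<alpha> ?k"
      note dm = L2_measurable[OF m_dilate[OF \<sigma>]]
      \<comment> \<open>Two memberships of \<open>?h\<close> are wanted: L1 for the integral
        branches of the definitions, L2 for Parseval. The second rests on the bound C of the
        transform.\<close>
      have h_L2: "?h \<in> L2 ?M"
      proof (rule L2_iff_integrable_square[THEN iffD2], rule conjI)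
        show hm: "?h \<in> borel_measurable ?M" using dm Fm by measurable
        show "integrable ?M (\<lambda>l. (cmod (?h l))\<^sup>2)"
        proof (rule Bochner_Integration.integrable_bound)
          show "integrable ?M (\<lambda>l. C\<^sup>2 * (cmod (dilate \<sigma> m l))\<^sup>2)"
            by (intro integrable_mult_right L2_integrable_square m_dilate \<sigma>)
          show "(\<lambda>l. (cmod (?h l))\<^sup>2) \<in> borel_measurable ?M" using hm by measurable
          show "AE l in ?M. norm ((cmod (?h l))\<^sup>2) \<le> norm (C\<^sup>2 * (cmod (dilate \<sigma> m l))\<^sup>2)"
          proof (rule AE_I2)
            fix l assume "l \<in> space ?M"
            from power_mono[OF FC[OF this], of 2]
            have "(cmod (dilate \<sigma> m l))\<^sup>2 * (cmod (?F l))\<^sup>2 \<le> (cmod (dilate \<sigma> m l))\<^sup>2 * C\<^sup>2"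
              by (intro mult_left_mono) auto
            then show "norm ((cmod (?h l))\<^sup>2) \<le> norm (C\<^sup>2 * (cmod (dilate \<sigma> m l))\<^sup>2)"
              by (simp add: norm_mult power_mult_distrib mult.commute)
          qed
        qed
      qed
      \<comment> \<open>Bounded and integrable: |F|^2 is at most C |F|.\<close>
      have F_L2: "?F \<in> L2 ?M"
      proof (rule L2_iff_integrable_square[THEN iffD2], rule conjI)
        show "?F \<in> borel_measurable ?M" by (rule Fm)
        show "integrable ?M (\<lambda>l. (cmod (?F l))\<^sup>2)"
        proof (rule Bochner_Integration.integrable_bound)
          show "integrable ?M (\<lambda>l. C * cmod (?F l))" using F\<phi> by simp
          show "(\<lambda>l. (cmod (?F l))\<^sup>2) \<in> borel_measurable ?M" using Fm by measurable
          show "AE l in ?M. norm ((cmod (?F l))\<^sup>2) \<le> norm (C * cmod (?F l))"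
          proof (rule AE_I2)
            fix l assume "l \<in> space ?M"
            from mult_right_mono[OF FC[OF this], of "cmod (?F l)"]
            show "norm ((cmod (?F l))\<^sup>2) \<le> norm (C * cmod (?F l))"
              by (simp add: power2_eq_square)
          qed
        qed
      qed
      have h_L1: "integrable ?M ?h"
        by (rule L2_mult_integrable[OF m_dilate[OF \<sigma>] F_L2])
      have h'_eq: "?h' = (\<lambda>l. ?h l * weinstein_kernel \<alpha> (reflect x) l)"
        by (simp only: cnj_weinstein_kernel weinstein_kernel_commute[of \<alpha> "reflect x"])
      have h'_L1: "integrable ?M ?h'"
        unfolding h'_eq by (rule integrable_mult_weinstein_kernel[OF alpha h_L1])
      have h'_L2: "?h' \<in> L2 ?M"
      proof (rule L2_I[OF borel_measurable_integrable[OF h'_L1]])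
        have "L2_norm_sq ?M ?h' \<le> L2_norm_sq ?M ?h"
          unfolding L2_norm_sq_def
          by (intro nn_integral_mono ennreal_leI power_mono)
            (auto simp: norm_mult norm_weinstein_kernel_le[OF alpha] intro!: mult_left_le)
        then show "L2_norm_sq ?M ?h' < \<infinity>"
          using L2_finite[OF h_L2] by (rule le_less_trans)
      qed
      have k_L2: "?k \<in> L2 ?M" by (rule L2_cnj[OF m_dilate[OF \<sigma>]])
      have pair_k: "W.L2_pair ?k ?G"
        using W.L2_pair_transform_ext[OF k_L2] by (simp only: F_ext)
      \<comment> \<open>Parseval conjugates its second entry, so a pair for
        \<open>dilate \<sigma> m\<close> itself is wanted. The transform of a conjugate is the
        conjugate of the transform at the reflected point, and reflection preserves the measure;
        conjugating the approximating sequence of \<open>?k\<close> therefore works.\<close>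
      have pair_m: "W.L2_pair (dilate \<sigma> m) (\<lambda>y. cnj (?G (reflect y)))"
      proof -
        obtain u where u: "\<And>n. integrable ?M (u n)" "\<And>n. u n \<in> L2 ?M"
          "(\<lambda>n. L2_norm_sq ?M (\<lambda>x. u n x - ?k x)) \<longlonglongrightarrow> 0"
          "(\<lambda>n. L2_norm_sq ?M (\<lambda>x. W.transform (u n) x - ?G x)) \<longlonglongrightarrow> 0"
          and G_L2: "?G \<in> L2 ?M"
          using pair_k unfolding W.L2_pair_def by auto
        let ?u = "\<lambda>n x. cnj (u n x)"
        have 1: "L2_norm_sq ?M (\<lambda>x. ?u n x - dilate \<sigma> m x) = L2_norm_sq ?M (\<lambda>x. u n x - ?k x)" for n
          unfolding L2_norm_sq_def by (metis (no_types, lifting) complex_cnj_cnj complex_cnj_diff complex_mod_cnj)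
        have 2: "L2_norm_sq ?M (\<lambda>x. W.transform (?u n) x - cnj (?G (reflect x))) = L2_norm_sq ?M (\<lambda>x. W.transform (u n) x - ?G x)" for n
        proof -
          let ?v = "\<lambda>x. W.transform (u n) x - ?G x"
          have "?v \<in> borel_measurable ?M"
            using W.measurable_transform[OF borel_measurable_integrable[OF u(1)[of n]]] L2_measurable[OF G_L2]
            by (rule borel_measurable_diff)
          then have "L2_norm_sq ?M ?v = L2_norm_sq ?M (\<lambda>x. ?v (reflect x))"
            by (rule L2_norm_sq_reflect[OF alpha, symmetric])
          also have "\<dots> = L2_norm_sq ?M (\<lambda>x. W.transform (?u n) x - cnj (?G (reflect x)))"
          proof -
            have "W.transform (?u n) x = cnj (W.transform (u n) (reflect x))" for x
              using W.transform_adj_eq[of "u n" x] F_adj[of "u n" x] by (simp add: F)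
            then have "cmod (?v (reflect x)) = cmod (W.transform (?u n) x - cnj (?G (reflect x)))" for x
              by (metis complex_cnj_diff complex_mod_cnj)
            then show ?thesis by (simp only: L2_norm_sq_def)
          qed
          finally show ?thesis ..
        qed
        show ?thesis
          unfolding W.L2_pair_def
        proof (intro conjI exI[of _ ?u] allI)
          show "?u n \<in> {u. integrable ?M u} \<inter> L2 ?M" for n
            using u(1,2) L2_cnj by auto
          show "(\<lambda>n. L2_norm_sq ?M (\<lambda>x. ?u n x - dilate \<sigma> m x)) \<longlonglongrightarrow> 0"
            unfolding 1 by (rule u(3))
          show "(\<lambda>n. L2_norm_sq ?M (\<lambda>x. W.transform (?u n) x - cnj (?G (reflect x)))) \<longlonglongrightarrow> 0"
            unfolding 2 by (rule u(4))
          show "dilate \<sigma> m \<in> L2 ?M" by (rule m_dilate[OF \<sigma>])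
          show "(\<lambda>y. cnj (?G (reflect y))) \<in> L2 ?M"
            by (rule L2_cnj[OF L2_reflect[OF alpha G_L2]])
        qed
      qed
      have T: "multiplier_op \<alpha> m \<sigma> \<phi> = (\<lambda>l. weinstein_integral \<alpha> ?h (reflect l))"
        unfolding multiplier_op_def by (rule inv_L1[OF h_L1])
      \<comment> \<open>The double conjugate brings the integrand into the shape of Parseval's
        identity for \<open>?h'\<close> and \<open>dilate \<sigma> m\<close>.\<close>
      have "weinstein_conv \<alpha> (multiplier_op \<alpha> m \<sigma> \<phi>) (weinstein_inv \<alpha> ?k) x =
          (LINT y|?M. W.transform ?h' y * cnj (cnj (?G (reflect y))))"
        unfolding weinstein_conv_def T translation_weinstein_integral[OF alpha h_L1] F weinstein_inv_def
        by (simp only: complex_cnj_cnj)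
      also have "\<dots> = (LINT l|?M. ?h' l * cnj (dilate \<sigma> m l))"
        by (rule W.L2_pair_Parseval[OF W.L2_pair_transform[OF h'_L1 h'_L2] pair_m, symmetric])
      also have "\<dots> = (LINT l|?M. complex_of_real ((cmod (dilate \<sigma> m l))\<^sup>2) * (?F l * cnj (weinstein_kernel \<alpha> l x)))"
        unfolding complex_norm_square by (simp only: mult_ac)
      finally show ?thesis .
    qed
    have formula: "integrable dilation_measure
        (\<lambda>\<sigma>. weinstein_conv \<alpha> (multiplier_op \<alpha> m \<sigma> \<phi>) (weinstein_inv \<alpha> (\<lambda>y. cnj (dilate \<sigma> m y))) x) \<and>
        (LINT \<sigma>|dilation_measure.
          weinstein_conv \<alpha> (multiplier_op \<alpha> m \<sigma> \<phi>) (weinstein_inv \<alpha> (\<lambda>y. cnj (dilate \<sigma> m y))) x) =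
        W.transform_adj ?F x" for x
    proof -
      let ?E = "\<lambda>l. ?F l * cnj (weinstein_kernel \<alpha> l x)"
      let ?f = "\<lambda>\<sigma> l. complex_of_real ((cmod (dilate \<sigma> m l))\<^sup>2) * ?E l"
      have E_eq: "?E = (\<lambda>l. ?F l * weinstein_kernel \<alpha> (reflect x) l)"
        by (simp only: cnj_weinstein_kernel weinstein_kernel_commute[of \<alpha> "reflect x"])
      have E: "integrable ?M ?E"
        unfolding E_eq by (rule integrable_mult_weinstein_kernel[OF alpha F\<phi>])
      note Em = borel_measurable_integrable[OF E]
      have fm: "case_prod ?f \<in> borel_measurable (dilation_measure \<Otimes>\<^sub>M ?M)"
      proof -
        have "(\<lambda>p. ?E (snd p)) \<in> borel_measurable (dilation_measure \<Otimes>\<^sub>M ?M)"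
          by (rule measurable_compose[OF measurable_snd Em])
        moreover have "(\<lambda>p. complex_of_real ((cmod (dilate (fst p) m (snd p)))\<^sup>2)) \<in> borel_measurable (dilation_measure \<Otimes>\<^sub>M ?M)"
          using md by measurable
        ultimately have "(\<lambda>p. ?f (fst p) (snd p)) \<in> borel_measurable (dilation_measure \<Otimes>\<^sub>M ?M)"
          by (rule borel_measurable_times[rotated])
        then show ?thesis by (simp only: case_prod_unfold)
      qed
      have md': "(\<lambda>\<sigma>. dilate \<sigma> m l) \<in> borel_measurable dilation_measure" if "l \<in> space ?M" for l
        using measurable_compose[OF measurable_Pair2'[OF that] md] by simp
      \<comment> \<open>Integrating first over \<sigma> collapses the dilates to 1 by admissibility,
        which leaves the integrable function \<open>?E\<close>.\<close>
      have int: "integrable (dilation_measure \<Otimes>\<^sub>M ?M) (case_prod ?f)"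
      proof (rule integrableI_bounded[OF fm])
        have nf: "(\<lambda>p. ennreal (cmod (case_prod ?f p))) \<in> borel_measurable (dilation_measure \<Otimes>\<^sub>M ?M)"
          using fm by measurable
        have "(\<integral>\<^sup>+ p. ennreal (cmod (case_prod ?f p)) \<partial>(dilation_measure \<Otimes>\<^sub>M ?M)) =
            (\<integral>\<^sup>+ l. (\<integral>\<^sup>+ \<sigma>. ennreal (cmod (?f \<sigma> l)) \<partial>dilation_measure) \<partial>?M)"
          using DM.nn_integral_snd[OF nf] by simp
        also have "\<dots> = (\<integral>\<^sup>+ l. ennreal (cmod (?E l)) \<partial>?M)"
        proof (rule nn_integral_cong)
          fix l assume l: "l \<in> space ?M"
          have "(\<integral>\<^sup>+ \<sigma>. ennreal (cmod (?f \<sigma> l)) \<partial>dilation_measure) =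
              (\<integral>\<^sup>+ \<sigma>. ennreal ((cmod (dilate \<sigma> m l))\<^sup>2) * ennreal (cmod (?E l)) \<partial>dilation_measure)"
            by (intro nn_integral_cong) (simp only: norm_mult[of "complex_of_real _"] norm_of_real abs_power2 ennreal_mult' zero_le_power2)
          also have "\<dots> = (\<integral>\<^sup>+ \<sigma>. ennreal ((cmod (dilate \<sigma> m l))\<^sup>2) \<partial>dilation_measure) * ennreal (cmod (?E l))"
            using md'[OF l] by (intro nn_integral_multc) measurable
          finally show "(\<integral>\<^sup>+ \<sigma>. ennreal (cmod (?f \<sigma> l)) \<partial>dilation_measure) = ennreal (cmod (?E l))"
            using l by (simp add: adm)
        qed
        also have "\<dots> < \<infinity>" using E by (simp only: integrable_iff_bounded)
        finally show "(\<integral>\<^sup>+ p. ennreal (cmod (case_prod ?f p)) \<partial>(dilation_measure \<Otimes>\<^sub>M ?M)) < \<infinity>" .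
      qed
      have 1: "integrable dilation_measure (\<lambda>\<sigma>. LINT l|?M. ?f \<sigma> l)"
        using DM.integrable_fst'[OF int] by simp
      have 2: "(LINT \<sigma>|dilation_measure. (LINT l|?M. ?f \<sigma> l)) = W.transform_adj ?F x"
      proof -
        have "(LINT \<sigma>|dilation_measure. (LINT l|?M. ?f \<sigma> l)) = (LINT l|?M. (LINT \<sigma>|dilation_measure. ?f \<sigma> l))"
          by (rule DM.Fubini_integral[OF int, symmetric])
        also have "\<dots> = (LINT l|?M. ?E l)"
        proof (intro Bochner_Integration.integral_cong refl)
          fix l assume l: "l \<in> space ?M"
          have "(LINT \<sigma>|dilation_measure. (cmod (dilate \<sigma> m l))\<^sup>2) = 1"
            using adm[of l] l md'[OF l] by (subst integral_eq_nn_integral) auto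
          then show "(LINT \<sigma>|dilation_measure. ?f \<sigma> l) = ?E l"
            by (simp only: integral_mult_left_zero integral_complex_of_real of_real_1 mult_1_left)
        qed
        finally show ?thesis by (simp only: W.transform_adj_def)
      qed
      \<comment> \<open>\<open>conv\<close> requires \<sigma> > 0, which is exactly the space of
        \<open>dilation_measure\<close>.\<close>
      have 3: "weinstein_conv \<alpha> (multiplier_op \<alpha> m \<sigma> \<phi>) (weinstein_inv \<alpha> (\<lambda>y. cnj (dilate \<sigma> m y))) x = (LINT l|?M. ?f \<sigma> l)"
        if "\<sigma> \<in> space dilation_measure" for \<sigma>
        using that by (intro conv) simp
      show ?thesis
        using Bochner_Integration.integrable_cong[OF refl 3, THEN iffD2, OF _ 1]
          Bochner_Integration.integral_cong[OF refl 3, THEN trans, OF _ 2] by blast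
    qed
    \<comment> \<open>\<open>formula\<close> holds at every x; the exceptional null set comes only
      from inversion.\<close>
    have "AE x in ?M. \<phi> x = W.transform_adj ?F x"
      using W.transform_inversion[OF \<phi>] F\<phi> unfolding F_eq by simp
    then show ?thesis
      by eventually_elim (use formula in auto)
  qed
  show ?thesis using Plancherel Calderon by blast
qed

end
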